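(* Let $\beta>0$, $\gamma>0$ and $c<c_*=3(\beta^2\gamma/4)^{1/3}$. Let $k\ge 0$ be an integer and suppose in addition that $f\in C^k(\mathbb R)$. Then every solitary wave $\varphi\in\mathcal X$ satisfies: - $\varphi\in H^{k+1}(\mathbb R)$; - $\partial_x^{-1}\varphi\in H^{k+2}(\mathbb R)$; - $\partial_x^{-2}\varphi\in H^{k+3}(\mathbb R)$.
   Context: Fix $p>1$ and a $C^2$ function $f:\mathbb R\to\mathbb R$ homogeneous of degree $p$, i.e. $f(\lambda s)=\lambda^p f(s)$ for all $\lambda>0$ and $s\in\mathbb R$. The operators are defined as follows. $\mathcal H$ is the Hilbert transform, $\mathcal Hu(x)=\mathrm{p.v.}\frac1\pi\int_{\mathbb R}\frac{u(z)}{x-z}dz$, with Fourier symbol $-i\,\mathrm{sgn}\,\xi$. $\partial_x^{-1}$ is the Fourier multiplier with symbol $(i\xi)^{-1}$, and $\partial_x^{-2}=(\partial_x^{-1})^2$. Let $\mathcal X=\{u\in H^{1/2}(\mathbb R):\partial_x^{-1}u\in L^2(\mathbb R)\}$, with norm $\|u\|_{\mathcal X}=\|u\|_{H^{1/2}}+\|\partial_x^{-1}u\|_{L^2}$. A solitary wave is a function $\varphi\in\mathcal X$ satisfying, in the distributional sense, $$\beta\mathcal H\varphi_x-c\varphi+f(\varphi)=\gamma\partial_x^{-2}\varphi. \tag{2.1}$$ *)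

theory Defs
  imports "HOL-Analysis.Analysis"
begin

definition L2 :: "(real \<Rightarrow> real) \<Rightarrow> bool" where
  "L2 u \<longleftrightarrow> u \<in> borel_measurable lborel \<and> integrable lborel (\<lambda>x. (u x)^2)"

definition test_fun :: "(real \<Rightarrow> real) \<Rightarrow> bool" where
  "test_fun \<psi> \<longleftrightarrow> (\<forall>n x. ((deriv ^^ n) \<psi>) differentiable (at x))
                   \<and> (\<exists>R. \<forall>x. R < \<bar>x\<bar> \<longrightarrow> \<psi> x = 0)"

definition FT :: "(real \<Rightarrow> real) \<Rightarrow> real \<Rightarrow> complex" where
  "FT g \<xi> = (LINT x|lborel. complex_of_real (g x) * cis (- (x * \<xi>)))"

text \<open>U is the (Plancherel) Fourier transform of the L2 function u, characterised
  by duality against test functions.\<close>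
definition is_fourier :: "(real \<Rightarrow> real) \<Rightarrow> (real \<Rightarrow> complex) \<Rightarrow> bool" where
  "is_fourier u U \<longleftrightarrow> L2 u \<and> U \<in> borel_measurable lborel
     \<and> integrable lborel (\<lambda>\<xi>. (cmod (U \<xi>))^2)
     \<and> (\<forall>\<psi>. test_fun \<psi> \<longrightarrow>
          (LINT \<xi>|lborel. U \<xi> * complex_of_real (\<psi> \<xi>))
          = (LINT x|lborel. complex_of_real (u x) * FT \<psi> x))"

definition sobolev :: "real \<Rightarrow> (real \<Rightarrow> real) \<Rightarrow> bool" where
  "sobolev s u \<longleftrightarrow> (\<exists>U. is_fourier u U
      \<and> integrable lborel (\<lambda>\<xi>. (1 + \<xi>^2) powr s * (cmod (U \<xi>))^2))"

definition inv_deriv_in :: "nat \<Rightarrow> real \<Rightarrow> (real \<Rightarrow> real) \<Rightarrow> bool" where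
  "inv_deriv_in n s \<phi> \<longleftrightarrow> (\<exists>w \<Phi> W. sobolev s w \<and> is_fourier \<phi> \<Phi> \<and> is_fourier w W
      \<and> (AE \<xi> in lborel. \<Phi> \<xi> = (\<i> * complex_of_real \<xi>)^n * W \<xi>))"

definition space_X :: "(real \<Rightarrow> real) \<Rightarrow> bool" where
  "space_X \<phi> \<longleftrightarrow> sobolev (1/2) \<phi> \<and> inv_deriv_in 1 0 \<phi>"

definition Ck :: "nat \<Rightarrow> (real \<Rightarrow> real) \<Rightarrow> bool" where
  "Ck k f \<longleftrightarrow> (\<exists>D. D 0 = f
      \<and> (\<forall>j<k. \<forall>x. (D j has_real_derivative D (Suc j) x) (at x))
      \<and> (\<forall>j\<le>k. continuous_on UNIV (D j)))"

text \<open>Solitary wave: phi in X solving beta H phi_x - c phi + f(phi) = gamma d_x^{-2} phi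
  in the sense of distributions. Since d_x^{-2} phi is the distribution whose derivative is
  w = d_x^{-1} phi (in L2), the equation is tested against derivatives psi' of test
  functions: <T, psi'> = - <w, psi> for T = d_x^{-2} phi.  The term H phi_x is the Fourier
  multiplier with symbol (-i sgn xi)(i xi), paired via Parseval.\<close>
definition solitary_wave :: "real \<Rightarrow> real \<Rightarrow> real \<Rightarrow> (real \<Rightarrow> real) \<Rightarrow> (real \<Rightarrow> real) \<Rightarrow> bool" where
  "solitary_wave \<beta> \<gamma> c f \<phi> \<longleftrightarrow> space_X \<phi>
     \<and> (\<forall>a b. set_integrable lborel {a..b} (\<lambda>x. f (\<phi> x)))
     \<and> (\<exists>\<Phi> w W. is_fourier \<phi> \<Phi> \<and> is_fourier w W
          \<and> (AE \<xi> in lborel. \<Phi> \<xi> = (\<i> * complex_of_real \<xi>) * W \<xi>)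
          \<and> (\<forall>\<psi>. test_fun \<psi> \<longrightarrow>
               complex_of_real \<beta> * (1 / (2 * complex_of_real pi)) *
                 (LINT \<xi>|lborel. ((- \<i> * complex_of_real (sgn \<xi>)) * (\<i> * complex_of_real \<xi>))
                     * \<Phi> \<xi> * FT (deriv \<psi>) (- \<xi>))
               - complex_of_real (c * (LINT x|lborel. \<phi> x * deriv \<psi> x))
               + complex_of_real (LINT x|lborel. f (\<phi> x) * deriv \<psi> x)
               = - complex_of_real (\<gamma> * (LINT x|lborel. w x * \<psi> x))))"

end

theory Submission
  imports Defs "HOL-Probability.Probability"
begin

text \<open>On the Fourier side the equation reads \<open>m(\<xi>) \<Phi>(\<xi>) = - \<xi>\<^sup>2 F(\<xi>)\<close>, where \<open>F\<close> is the transform of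
  \<open>f \<circ> \<phi>\<close> and \<open>m(\<xi>) = \<beta> |\<xi>|\<^sup>3 - c \<xi>\<^sup>2 + \<gamma>\<close>. By the arithmetic-geometric mean inequality,
  \<open>c < c\<^sub>*\<close> bounds \<open>m(\<xi>)\<close> below by a multiple of \<open>(1 + \<xi>\<^sup>2)\<^sup>3\<^sup>/\<^sup>2\<close>, so \<open>F / m\<close>, the transform of the
  second antiderivative of \<open>\<phi>\<close>, gains three derivatives over \<open>f \<circ> \<phi>\<close>. The embedding of
  \<open>H\<^sup>1\<^sup>/\<^sup>2\<close> into all \<open>L\<^sup>q\<close>, \<open>2 \<le> q < \<infinity>\<close>, puts \<open>f \<circ> \<phi>\<close> in \<open>L\<^sup>2\<close>; from then on each step gains one
  derivative of \<open>\<phi>\<close>, since \<open>H\<^sup>j\<close> with \<open>j \<ge> 1\<close> is stable under composition with \<open>C\<^sup>j\<close> functions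
  vanishing at 0.\<close>

section \<open>Square integrable functions\<close>

text \<open>The transform is given only by pairings with test functions, and the equation is
  likewise only tested. Parseval turns the tested equation into pairings with
  \<open>FT \<psi>\<close>, in general no test function, so every identity on the Fourier side rests
  on a uniqueness statement for such pairings. Moreover the dispersive term
  \<beta>\<xi>|\<xi>|\<Phi> is in L^2 only after division by 1 + \<xi>^2, which fixes the form of
  that statement. The threshold c_* is the minimum of (\<beta>t^3 + \<gamma>)/t^2 over t > 0, taken
  at t^3 = 2\<gamma>/\<beta>, so c < c_* says exactly that m is positive. The first step differs
  from the others because H^(1/2) does not embed into L^\<infinity>: neither the chain rule nor the
  algebra property is available, and homogeneity replaces them through |f(s)| \<le> C|s|^p. After it
  \<phi> is in H^1 and bounded. Of the three derivatives won by 1/m, two are spent on returning from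
  the second antiderivative to \<phi>, hence the gain of one per step; f in C^k allows composition
  up to H^k, hence k + 1.\<close>

definition cL2 :: "(real \<Rightarrow> complex) \<Rightarrow> bool" where
  "cL2 U \<longleftrightarrow> U \<in> borel_measurable lborel \<and> integrable lborel (\<lambda>x. (cmod (U x))^2)"

text \<open>The norm is kept squared, so that the triangle inequality appears with factors 2
  (\<open>sqnorm_add_le\<close>) and few square roots enter; some constants below are not sharp for
  this reason.\<close>

definition sqnorm :: "(real \<Rightarrow> complex) \<Rightarrow> real" where
  "sqnorm U = (LINT x|lborel. (cmod (U x))^2)"

lemma cL2_meas [measurable_dest]: "cL2 U \<Longrightarrow> U \<in> borel_measurable borel"
  by (simp add: cL2_def)

lemma cL2_integrable: "cL2 U \<Longrightarrow> integrable lborel (\<lambda>x. (cmod (U x))^2)"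
  by (simp add: cL2_def)

lemma sqnorm_nonneg [simp]: "sqnorm U \<ge> 0"
  by (simp add: sqnorm_def)

lemma cL2I_bound:
  assumes "U \<in> borel_measurable lborel" "integrable lborel g" "\<And>x. (cmod (U x))^2 \<le> g x"
  shows "cL2 U"
  unfolding cL2_def
proof
  show "integrable lborel (\<lambda>x. (cmod (U x))^2)"
    using assms by (intro Bochner_Integration.integrable_bound[OF assms(2)]) (auto intro!: AE_I2 order_trans[OF assms(3) abs_ge_self])
qed (use assms in auto)

lemma cmod_add_sq_le: "(cmod (a + b))^2 \<le> 2 * (cmod a)^2 + 2 * (cmod b)^2"
proof -
  have "(cmod (a + b))^2 \<le> (cmod a + cmod b)^2"
    by (intro power_mono norm_triangle_ineq) auto
  also have "\<dots> \<le> 2 * (cmod a)^2 + 2 * (cmod b)^2"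
    using sum_squares_bound[of "cmod a" "cmod b"] by (simp add: power2_sum)
  finally show ?thesis .
qed

lemma cL2_add: assumes "cL2 U" "cL2 V" shows "cL2 (\<lambda>x. U x + V x)"
proof (rule cL2I_bound)
  show "integrable lborel (\<lambda>x. 2 * (cmod (U x))^2 + 2 * (cmod (V x))^2)"
    using assms by (intro Bochner_Integration.integrable_add integrable_mult_right) (auto simp: cL2_def)
qed (use assms in \<open>auto intro: cmod_add_sq_le simp: cL2_def\<close>)

lemma cL2_mult_bounded:
  assumes "cL2 U" "m \<in> borel_measurable lborel" "\<And>x. cmod (m x) \<le> C"
  shows "cL2 (\<lambda>x. m x * U x)"
proof (rule cL2I_bound)
  show "integrable lborel (\<lambda>x. C^2 * (cmod (U x))^2)"
    using assms by (intro integrable_mult_right) (auto simp: cL2_def)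
  show "(cmod (m x * U x))\<^sup>2 \<le> C\<^sup>2 * (cmod (U x))\<^sup>2" for x
    using assms(3)[of x] by (auto simp: norm_mult power_mult_distrib intro!: mult_right_mono power_mono)
qed (use assms in \<open>auto simp: cL2_def\<close>)

lemma cL2_cmult: "cL2 U \<Longrightarrow> cL2 (\<lambda>x. c * U x)"
  by (rule cL2_mult_bounded[where C="cmod c"]) auto

lemma cL2_diff: assumes "cL2 U" "cL2 V" shows "cL2 (\<lambda>x. U x - V x)"
  using cL2_add[OF assms(1) cL2_cmult[OF assms(2), of "-1"]] by simp

lemma borel_measurable_cnj [measurable (raw)]:
  "f \<in> borel_measurable M \<Longrightarrow> (\<lambda>x. cnj (f x)) \<in> borel_measurable M"
  by (rule measurable_compose[of f M borel cnj])
     (auto intro: borel_measurable_continuous_onI continuous_intros)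

lemma cL2_cnj: "cL2 U \<Longrightarrow> cL2 (\<lambda>x. cnj (U x))"
  by (auto simp: cL2_def)

lemma cL2_reflect: "cL2 U \<Longrightarrow> cL2 (\<lambda>x. U (- x))"
  unfolding cL2_def using lborel_integrable_real_affine[of "\<lambda>x. (cmod (U x))^2" "-1" 0] by auto

lemma sqnorm_reflect: "sqnorm (\<lambda>x. U (- x)) = sqnorm U"
  unfolding sqnorm_def using lborel_integral_real_affine[of "-1" "\<lambda>x. (cmod (U x))^2" 0] by simp

lemma sqnorm_add_le: assumes "cL2 U" "cL2 V"
  shows "sqnorm (\<lambda>x. U x + V x) \<le> 2 * sqnorm U + 2 * sqnorm V"
proof -
  have "sqnorm (\<lambda>x. U x + V x) \<le> (LINT x|lborel. 2 * (cmod (U x))^2 + 2 * (cmod (V x))^2)"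
    unfolding sqnorm_def using cL2_add[OF assms] assms
    by (intro integral_mono Bochner_Integration.integrable_add integrable_mult_right cmod_add_sq_le)
       (auto simp: cL2_def)
  also have "\<dots> = 2 * sqnorm U + 2 * sqnorm V"
    using assms by (simp add: sqnorm_def cL2_def)
  finally show ?thesis .
qed

lemma sqnorm_diff_commute: "sqnorm (\<lambda>x. U x - V x) = sqnorm (\<lambda>x. V x - U x)"
  by (simp add: sqnorm_def norm_minus_commute)

lemma nn_sqnorm: "cL2 U \<Longrightarrow> (\<integral>\<^sup>+x. ennreal (cmod (U x))^2 \<partial>lborel) = ennreal (sqnorm U)"
  unfolding sqnorm_def cL2_def by (subst nn_integral_eq_integral[symmetric]) (auto simp: ennreal_power)

text \<open>Membership in L^2 and the norm bound come together from a bound on the nonnegative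
  integral, the form in which Fatou's lemma and Schur's test deliver it.\<close>

lemma cL2I_nn:
  assumes "U \<in> borel_measurable lborel" "(\<integral>\<^sup>+x. ennreal (cmod (U x))^2 \<partial>lborel) \<le> ennreal C" "0 \<le> C"
  shows "cL2 U" "sqnorm U \<le> C"
proof -
  show *: "cL2 U" unfolding cL2_def
    using assms by (auto intro!: integrableI_bounded simp: ennreal_power intro: le_less_trans)
  show "sqnorm U \<le> C" using nn_sqnorm[OF *] assms(2,3) by simp
qed

lemma cL2_mult_integrable: assumes "cL2 U" "cL2 V" shows "integrable lborel (\<lambda>x. U x * V x)"
proof (rule Bochner_Integration.integrable_bound)
  show "integrable lborel (\<lambda>x. (cmod (U x))^2 + (cmod (V x))^2)"
    using assms by (auto simp: cL2_def)
  show "AE x in lborel. norm (U x * V x) \<le> norm ((cmod (U x))\<^sup>2 + (cmod (V x))\<^sup>2)"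
  proof (intro AE_I2)
    fix x show "norm (U x * V x) \<le> norm ((cmod (U x))\<^sup>2 + (cmod (V x))\<^sup>2)"
      using sum_squares_bound[of "cmod (U x)" "cmod (V x)"] zero_le_power2[of "cmod (U x)"]
        mult_nonneg_nonneg[OF norm_ge_zero[of "U x"] norm_ge_zero[of "V x"]]
      unfolding norm_mult by (auto simp: abs_if)
  qed
qed (use assms in \<open>auto simp: cL2_def\<close>)

lemma cL2_CS_norm: assumes "cL2 U" "cL2 V"
  shows "(LINT x|lborel. cmod (U x * V x))^2 \<le> sqnorm U * sqnorm V"
proof -
  have i: "integrable lborel (\<lambda>x. cmod (U x * V x))"
    using cL2_mult_integrable[OF assms] by simp
  have "ennreal ((LINT x|lborel. cmod (U x * V x))^2) = (\<integral>\<^sup>+x. ennreal (cmod (U x)) * ennreal (cmod (V x)) \<partial>lborel)^2"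
    by (subst ennreal_power[symmetric], simp, subst nn_integral_eq_integral[OF i, symmetric])
       (auto simp: norm_mult ennreal_mult)
  also have "\<dots> \<le> (\<integral>\<^sup>+x. ennreal (cmod (U x))^2 \<partial>lborel) * (\<integral>\<^sup>+x. ennreal (cmod (V x))^2 \<partial>lborel)"
    using assms by (intro Cauchy_Schwarz_nn_integral) (auto simp: cL2_def)
  also have "\<dots> = ennreal (sqnorm U * sqnorm V)"
    using assms by (simp add: nn_sqnorm ennreal_mult)
  finally show ?thesis by (simp add: ennreal_le_iff)
qed

lemma cL2_CS: assumes "cL2 U" "cL2 V"
  shows "cmod (LINT x|lborel. U x * V x) \<le> sqrt (sqnorm U * sqnorm V)"
proof -
  have "cmod (LINT x|lborel. U x * V x) \<le> (LINT x|lborel. cmod (U x * V x))"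
    by (rule integral_norm_bound)
  also have "\<dots> \<le> sqrt (sqnorm U * sqnorm V)"
    using cL2_CS_norm[OF assms] by (intro real_le_rsqrt)
  finally show ?thesis .
qed

lemma cL2_pairing_tendsto:
  assumes "\<And>n. cL2 (s n)" "cL2 U" "cL2 V" "(\<lambda>n. sqnorm (\<lambda>x. s n x - U x)) \<longlonglongrightarrow> 0"
  shows "(\<lambda>n. LINT x|lborel. s n x * V x) \<longlonglongrightarrow> (LINT x|lborel. U x * V x)"
proof (rule Lim_null[THEN iffD2], rule Lim_null_comparison)
  show "\<forall>\<^sub>F n in sequentially. norm ((LINT x|lborel. s n x * V x) - (LINT x|lborel. U x * V x))
     \<le> sqrt (sqnorm (\<lambda>x. s n x - U x) * sqnorm V)"
  proof (intro always_eventually allI)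
    fix n
    have "(LINT x|lborel. s n x * V x) - (LINT x|lborel. U x * V x) = (LINT x|lborel. (s n x - U x) * V x)"
      using assms by (subst Bochner_Integration.integral_diff[symmetric]) (auto intro: cL2_mult_integrable simp: left_diff_distrib)
    then show "norm ((LINT x|lborel. s n x * V x) - (LINT x|lborel. U x * V x))
     \<le> sqrt (sqnorm (\<lambda>x. s n x - U x) * sqnorm V)"
      using cL2_CS[OF cL2_diff[OF assms(1)[of n] assms(2)] assms(3)] by simp
  qed
  have "(\<lambda>n. sqrt (sqnorm (\<lambda>x. s n x - U x) * sqnorm V)) \<longlonglongrightarrow> sqrt (0 * sqnorm V)"
    by (intro tendsto_intros assms)
  then show "(\<lambda>n. sqrt (sqnorm (\<lambda>x. s n x - U x) * sqnorm V)) \<longlonglongrightarrow> 0" by simp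
qed

section \<open>Cutoffs to [-A, A], in space as well as in frequency, and completeness of L^2\<close>

definition trunc :: "real \<Rightarrow> (real \<Rightarrow> complex) \<Rightarrow> real \<Rightarrow> complex" where
  "trunc A U = (\<lambda>x. if x \<in> {-A..A} then U x else 0)"

lemma trunc_measurable [measurable]: "U \<in> borel_measurable borel \<Longrightarrow> trunc A U \<in> borel_measurable borel"
  unfolding trunc_def by (intro measurable_If_set) auto

lemma cL2_trunc: "cL2 U \<Longrightarrow> cL2 (trunc A U)"
  by (rule cL2I_bound[where g="\<lambda>x. (cmod (U x))^2"]) (auto simp: cL2_def trunc_def)

lemma trunc_integrable: assumes "cL2 U" shows "integrable lborel (trunc A U)"
proof -
  have "cL2 (\<lambda>x. indicator {-A..A} x)"
    by (rule cL2I_bound[where g="indicator {-A..A}"]) (auto simp: indicator_def emeasure_lborel_Icc_eq)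
  from cL2_mult_integrable[OF assms this] show ?thesis
    by (rule Bochner_Integration.integrable_cong[THEN iffD1, rotated 2]) (auto simp: trunc_def indicator_def)
qed

lemma trunc_tendsto: assumes "cL2 U"
  shows "(\<lambda>n. sqnorm (\<lambda>x. trunc (real n) U x - U x)) \<longlonglongrightarrow> 0"
proof -
  have [measurable]: "U \<in> borel_measurable borel" using assms by (simp add: cL2_def)
  have "(\<lambda>n. LINT x|lborel. (cmod (trunc (real n) U x - U x))^2) \<longlonglongrightarrow> integral\<^sup>L lborel (\<lambda>x::real. (0::real))"
  proof (rule integral_dominated_convergence[where w="\<lambda>x. (cmod (U x))^2"])
    show "AE x in lborel. (\<lambda>i. (cmod (trunc (real i) U x - U x))\<^sup>2) \<longlonglongrightarrow> 0"
    proof (intro AE_I2)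
      fix x
      obtain N where "\<bar>x\<bar> \<le> real N" using real_arch_simple by blast
      then have "\<forall>n\<ge>N. (cmod (trunc (real n) U x - U x))\<^sup>2 = 0" by (auto simp: trunc_def abs_le_iff)
      then show "(\<lambda>i. (cmod (trunc (real i) U x - U x))\<^sup>2) \<longlonglongrightarrow> 0"
        by (intro tendsto_eventually) (auto simp: eventually_sequentially)
    qed
  qed (use assms in \<open>auto simp: cL2_def trunc_def\<close>)
  then show ?thesis by (simp add: sqnorm_def)
qed

text \<open>Riesz-Fischer. A rapidly converging subsequence converges almost everywhere because its
  weighted squared increments have a finite integral; Fatou's lemma then carries the Cauchy bounds
  over to the limit.\<close>

lemma cL2_complete:
  assumes s: "\<And>n. cL2 (s n)"
    and cauchy: "\<And>e. e > 0 \<Longrightarrow> \<exists>N. \<forall>m\<ge>N. \<forall>n\<ge>N. sqnorm (\<lambda>x. s m x - s n x) < e"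
  shows "\<exists>U. cL2 U \<and> (\<lambda>n. sqnorm (\<lambda>x. s n x - U x)) \<longlonglongrightarrow> 0"
proof -
  have [measurable]: "s n \<in> borel_measurable borel" for n using s[of n] by (simp add: cL2_def)
  \<comment> \<open>The rate 1/4 beats the weights 2^k introduced below and leaves the convergent
    series of (1/2)^k.\<close>
  obtain N where N: "\<And>k m n. m \<ge> N k \<Longrightarrow> n \<ge> N k \<Longrightarrow> sqnorm (\<lambda>x. s m x - s n x) < (1/4)^k"
    using cauchy[of "(1/4)^k" for k] by (metis zero_less_power zero_less_divide_1_iff zero_less_numeral)
  \<comment> \<open>Summing the N i makes r(k) and r(k+1) at least N(k) and r(k) at least k, without
    arranging that N is monotone.\<close>
  define r where "r k = (\<Sum>i\<le>k. N i) + k" for k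
  have rN: "r k \<ge> N k" for k
    unfolding r_def using member_le_sum[of k "{..k}" N] by simp
  have rSuc: "r (Suc k) \<ge> N k" for k
    unfolding r_def using member_le_sum[of k "{..Suc k}" N] by simp
  define d where "d k x = s (r (Suc k)) x - s (r k) x" for k x
  have dcsq: "cL2 (d k)" for k unfolding d_def by (intro cL2_diff s)
  have [measurable]: "d k \<in> borel_measurable borel" for k using dcsq[of k] by (simp add: cL2_def)
  have dn: "sqnorm (d k) \<le> (1/4)^k" for k
    unfolding d_def using N[OF rSuc rN] by (intro less_imp_le)
  have "(\<integral>\<^sup>+x. (\<Sum>k. ennreal (2^k) * ennreal (cmod (d k x))^2) \<partial>lborel)
      = (\<Sum>k. ennreal (2^k) * ennreal (sqnorm (d k)))"
    by (subst nn_integral_suminf) (auto simp: nn_integral_cmult nn_sqnorm[OF dcsq])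
  also have "\<dots> \<le> (\<Sum>k. ennreal ((1/2)^k))"
  proof (intro suminf_le)
    fix k
    have "2^k * sqnorm (d k) \<le> 2^k * (1/4)^k" by (intro mult_left_mono dn) auto
    also have "(2::real)^k * (1/4)^k = (1/2)^k" by (simp add: power_mult_distrib[symmetric])
    finally show "ennreal (2^k) * ennreal (sqnorm (d k)) \<le> ennreal ((1/2)^k)"
      by (simp add: ennreal_mult[symmetric] ennreal_leI)
  qed auto
  also have "\<dots> = ennreal (\<Sum>k. (1/2)^k)"
    by (intro suminf_ennreal2 summable_geometric) auto
  also have "\<dots> < \<infinity>" by simp
  finally have "AE x in lborel. (\<Sum>k. ennreal (2^k) * ennreal (cmod (d k x))^2) \<noteq> \<infinity>"
    by (intro nn_integral_PInf_AE) auto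
  then have conv: "AE x in lborel. convergent (\<lambda>k. s (r k) x)"
  proof eventually_elim
    case (elim x)
    have eq: "ennreal (2^k) * ennreal (cmod (d k x))^2 = ennreal (2^k * (cmod (d k x))^2)" for k
      by (simp add: ennreal_power ennreal_mult)
    have "summable (\<lambda>k. 2^k * (cmod (d k x))^2)"
      using elim unfolding eq by (intro summable_suminf_not_top) auto
    then have "summable (\<lambda>k. 2^k * (cmod (d k x))^2 + (1/2)^k)"
      by (intro summable_add summable_geometric) auto
    then have "summable (\<lambda>k. cmod (d k x))"
    proof (rule summable_comparison_test'[where N=0])
      fix k :: nat
      \<comment> \<open>By 2ab \<le> a^2 + b^2 the weighted squares control the unsquared
        increments, at the price of the summable term (1/2)^k.\<close>
      have "cmod (d k x) = (sqrt (2^k) * cmod (d k x)) * (1 / sqrt (2^k))" by simp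
      also have "2 * \<dots> \<le> (sqrt (2^k) * cmod (d k x))^2 + (1 / sqrt (2^k))^2"
        using sum_squares_bound[of "sqrt (2^k) * cmod (d k x)" "1 / sqrt (2^k)"] by linarith
      finally show "norm (cmod (d k x)) \<le> 2^k * (cmod (d k x))^2 + (1/2)^k"
        using norm_ge_zero[of "d k x"] by (simp add: power_mult_distrib power_divide del: norm_ge_zero)
    qed
    then have "summable (\<lambda>k. d k x)" by (rule summable_norm_cancel)
    then have "convergent (\<lambda>n. \<Sum>k<n. d k x)" by (simp add: summable_iff_convergent)
    moreover have "(\<Sum>k<n. d k x) = s (r n) x - s (r 0) x" for n
      unfolding d_def by (rule sum_lessThan_telescope)
    ultimately have "convergent (\<lambda>n. (s (r n) x - s (r 0) x) + s (r 0) x)"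
      by (intro convergent_add convergent_const) simp
    then show ?case by simp
  qed
  define U where "U x = lim (\<lambda>k. s (r k) x)" for x
  have U[measurable]: "U \<in> borel_measurable borel"
    unfolding U_def by (intro borel_measurable_lim_metric) auto
  have lim: "AE x in lborel. (\<lambda>k. s (r k) x) \<longlonglongrightarrow> U x"
    using conv by eventually_elim (simp add: U_def convergent_LIMSEQ_iff)
  \<comment> \<open>Fatou along the subsequence; the index bound M applies to \<open>r k\<close>
    because r(k) \<ge> k.\<close>
  have bound: "(\<integral>\<^sup>+x. ennreal (cmod (s n x - U x))^2 \<partial>lborel) \<le> ennreal e"
    if e: "e > 0" "\<And>m. m \<ge> M \<Longrightarrow> sqnorm (\<lambda>x. s n x - s m x) < e" for n M e
  proof -
    have "(\<integral>\<^sup>+x. ennreal (cmod (s n x - U x))^2 \<partial>lborel)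
        = (\<integral>\<^sup>+x. liminf (\<lambda>k. ennreal (cmod (s n x - s (r k) x))^2) \<partial>lborel)"
    proof (rule nn_integral_cong_AE)
      show "AE x in lborel. (ennreal (cmod (s n x - U x)))\<^sup>2 = liminf (\<lambda>k. (ennreal (cmod (s n x - s (r k) x)))\<^sup>2)"
        using lim
      proof eventually_elim
        case (elim x)
        have "(\<lambda>k. ennreal ((cmod (s n x - s (r k) x))^2)) \<longlonglongrightarrow> ennreal ((cmod (s n x - U x))^2)"
          by (intro tendsto_intros elim)
        from lim_imp_Liminf[OF _ this] show ?case by (simp add: ennreal_power)
      qed
    qed
    also have "\<dots> \<le> liminf (\<lambda>k. \<integral>\<^sup>+x. ennreal (cmod (s n x - s (r k) x))^2 \<partial>lborel)"
      by (intro nn_integral_liminf) auto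
    also have "\<dots> \<le> ennreal e"
    proof (rule Liminf_le)
      have "(\<integral>\<^sup>+x. ennreal (cmod (s n x - s (r k) x))^2 \<partial>lborel) \<le> ennreal e" if "k \<ge> M" for k
      proof -
        have "r k \<ge> M" using that unfolding r_def by simp
        then show ?thesis using e(2)[of "r k"] nn_sqnorm[OF cL2_diff[OF s s]] by (simp add: ennreal_leI)
      qed
      then show "\<forall>\<^sub>F k in sequentially. (\<integral>\<^sup>+x. ennreal (cmod (s n x - s (r k) x))^2 \<partial>lborel) \<le> ennreal e"
        by (auto simp: eventually_sequentially)
    qed simp
    finally show ?thesis .
  qed
  have diff: "cL2 (\<lambda>x. s n x - U x)" "sqnorm (\<lambda>x. s n x - U x) \<le> e"
    if "e > 0" "\<And>m. m \<ge> M \<Longrightarrow> sqnorm (\<lambda>x. s n x - s m x) < e" for n M e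
    using cL2I_nn[OF _ bound[OF that]] that(1) by auto
  \<comment> \<open>A single difference, at level 1 = (1/4)^0, already places U in L^2.\<close>
  have "cL2 (\<lambda>x. s (N 0) x - U x)"
    using N[of 0 "N 0"] by (intro diff(1)[of 1 "N 0"]) auto
  from cL2_diff[OF s[of "N 0"] this] have "cL2 U" by simp
  moreover have "(\<lambda>n. sqnorm (\<lambda>x. s n x - U x)) \<longlonglongrightarrow> 0"
  proof (rule LIMSEQ_I)
    fix e :: real assume "e > 0"
    then obtain M where M: "\<And>m n. m \<ge> M \<Longrightarrow> n \<ge> M \<Longrightarrow> sqnorm (\<lambda>x. s m x - s n x) < e/2"
      using cauchy[of "e/2"] by auto
    have "norm (sqnorm (\<lambda>x. s n x - U x) - 0) < e" if "n \<ge> M" for n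
      using diff(2)[of "e/2" M n] M[OF that] \<open>e > 0\<close> by simp
    then show "\<exists>M. \<forall>n\<ge>M. norm (sqnorm (\<lambda>x. s n x - U x) - 0) < e" by blast
  qed
  ultimately show ?thesis by blast
qed

section \<open>Test functions\<close>

definition smooth :: "(real \<Rightarrow> real) \<Rightarrow> bool" where
  "smooth f \<longleftrightarrow> (\<forall>n x. ((deriv ^^ n) f) differentiable (at x))"

lemma smooth_differentiable: "smooth f \<Longrightarrow> f differentiable (at x)"
  unfolding smooth_def by (metis funpow_0)

lemma smooth_deriv: "smooth f \<Longrightarrow> smooth (deriv f)"
  unfolding smooth_def by (metis comp_apply funpow_Suc_right)

lemma smooth_DERIV: "smooth f \<Longrightarrow> (f has_real_derivative deriv f x) (at x)"
  using smooth_differentiable DERIV_deriv_iff_real_differentiable by blast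

lemma smooth_isCont: "smooth f \<Longrightarrow> isCont f x"
  using smooth_DERIV DERIV_isCont by blast

lemma smooth_continuous_on: "smooth f \<Longrightarrow> continuous_on S f"
  using smooth_isCont continuous_at_imp_continuous_on by blast

lemma smooth_measurable [measurable_dest]: "smooth f \<Longrightarrow> f \<in> borel_measurable borel"
  by (intro borel_measurable_continuous_onI smooth_continuous_on)

text \<open>A class in which every function has a derivative belonging to the class contains all
  iterated derivatives. Smoothness thus follows from one differentiation instead of a formula for
  the n-th derivative.\<close>

lemma smooth_coinduct:
  assumes "P f" and step: "\<And>f. P f \<Longrightarrow> \<exists>f'. (\<forall>x. (f has_real_derivative f' x) (at x)) \<and> P f'"
  shows "smooth f"
proof -
  have "P ((deriv ^^ n) f)" for n
  proof (induction n)
    case (Suc n)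
    from step[OF this] obtain f' where f': "\<And>x. ((deriv ^^ n) f has_real_derivative f' x) (at x)" "P f'" by blast
    have "deriv ((deriv ^^ n) f) = f'" using f'(1) DERIV_imp_deriv by blast
    with f'(2) show ?case by simp
  qed (use assms in simp)
  with step show ?thesis
    unfolding smooth_def by (meson real_differentiable_def)
qed

lemma smooth_affine: assumes "smooth f" shows "smooth (\<lambda>x. c * f (a * x + b))"
\<comment> \<open>The factor c varies over the family, because each differentiation multiplies it by
  a.\<close>
proof (rule smooth_coinduct[where P="\<lambda>g. \<exists>f c. smooth f \<and> g = (\<lambda>x. c * f (a * x + b))"])
  fix g assume "\<exists>f c. smooth f \<and> g = (\<lambda>x. c * f (a * x + b))"
  then obtain f c where f: "smooth f" and g: "g = (\<lambda>x. c * f (a * x + b))" by blast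
  show "\<exists>f'. (\<forall>x. (g has_real_derivative f' x) (at x)) \<and> (\<exists>f c. smooth f \<and> f' = (\<lambda>x. c * f (a * x + b)))"
  proof (intro exI conjI allI)
    show "smooth (deriv f)" using f by (rule smooth_deriv)
    show "(g has_real_derivative (c * a) * deriv f (a * x + b)) (at x)" for x
      unfolding g by (rule derivative_eq_intros DERIV_chain2[OF smooth_DERIV[OF f]] refl | simp)+
  qed simp
qed (use assms in blast)

lemma smooth_add: assumes "smooth f" "smooth g" shows "smooth (\<lambda>x. f x + g x)"
proof (rule smooth_coinduct[where P="\<lambda>h. \<exists>f g. smooth f \<and> smooth g \<and> h = (\<lambda>x. f x + g x)"])
  fix h assume "\<exists>f g. smooth f \<and> smooth g \<and> h = (\<lambda>x. f x + g x)"
  then obtain f g where f: "smooth f" "smooth g" and h: "h = (\<lambda>x. f x + g x)" by blast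
  show "\<exists>f'. (\<forall>x. (h has_real_derivative f' x) (at x)) \<and> (\<exists>f g. smooth f \<and> smooth g \<and> f' = (\<lambda>x. f x + g x))"
  proof (intro exI conjI allI)
    show "smooth (deriv f)" "smooth (deriv g)" using f by (auto intro: smooth_deriv)
    show "(h has_real_derivative deriv f x + deriv g x) (at x)" for x
      unfolding h by (intro DERIV_add smooth_DERIV f)
  qed simp
qed (use assms in blast)

text \<open>The derivative of a product of smooth functions is only a sum of such products; this closure is
  the coinduction invariant for \<open>smooth_mult\<close>.\<close>
inductive sum_of_products :: "(real \<Rightarrow> real) \<Rightarrow> bool" where
  prod: "smooth f \<Longrightarrow> smooth g \<Longrightarrow> sum_of_products (\<lambda>x. f x * g x)"
| sum: "sum_of_products f \<Longrightarrow> sum_of_products g \<Longrightarrow> sum_of_products (\<lambda>x. f x + g x)"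

lemma smooth_mult: assumes "smooth f" "smooth g" shows "smooth (\<lambda>x. f x * g x)"
proof (rule smooth_coinduct[where P=sum_of_products])
  fix h assume "sum_of_products h"
  then show "\<exists>h'. (\<forall>x. (h has_real_derivative h' x) (at x)) \<and> sum_of_products h'"
  proof induction
    case (prod f g)
    show ?case
    proof (intro exI conjI allI)
      show "((\<lambda>x. f x * g x) has_real_derivative f x * deriv g x + deriv f x * g x) (at x)" for x
        using DERIV_mult'[OF smooth_DERIV[OF prod(1)] smooth_DERIV[OF prod(2)]] .
      show "sum_of_products (\<lambda>x. f x * deriv g x + deriv f x * g x)"
        using prod by (intro sum_of_products.intros smooth_deriv)
    qed
  next
    case (sum f g)
    then obtain f' g' where "\<forall>x. (f has_real_derivative f' x) (at x)" "sum_of_products f'"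
      "\<forall>x. (g has_real_derivative g' x) (at x)" "sum_of_products g'" by blast
    then show ?case
      by (intro exI[of _ "\<lambda>x. f' x + g' x"]) (auto intro: DERIV_add sum_of_products.intros)
  qed
qed (use assms in \<open>auto intro: sum_of_products.intros\<close>)

section \<open>Smooth functions flat at the origin\<close>

lemma tendsto_poly_mult_exp: "((\<lambda>y::real. poly p y * exp (- y)) \<longlongrightarrow> 0) at_top"
proof (induction p rule: pCons_induct)
  case (pCons a p)
  have "((\<lambda>y::real. y * poly p y * exp (- y)) \<longlongrightarrow> 0) at_top" for p
  proof -
    have "((\<lambda>y::real. \<Sum>i\<le>degree p. coeff p i * (y ^ Suc i / exp y)) \<longlongrightarrow> (\<Sum>i\<le>degree p. coeff p i * 0)) at_top"
      by (intro tendsto_intros tendsto_power_div_exp_0)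
    then show ?thesis
      by (simp add: poly_altdef exp_minus divide_inverse sum_distrib_left sum_distrib_right mult_ac)
  qed
  moreover have "((\<lambda>y::real. a * (y ^ 0 / exp y)) \<longlongrightarrow> a * 0) at_top"
    by (intro tendsto_intros tendsto_power_div_exp_0)
  ultimately have "((\<lambda>y::real. a * (y ^ 0 / exp y) + y * poly p y * exp (- y)) \<longlongrightarrow> 0 + 0) at_top"
    by (intro tendsto_add) auto
  then show ?case by (simp add: exp_minus divide_inverse algebra_simps)
qed simp

text \<open>A family containing e^(-1/x) (the case p = 1) that differentiation preserves: p(1/x)
  e^(-1/x) has the derivative x^(-2) (p - p')(1/x) e^(-1/x), and \<open>[:0,0,1:]\<close> is the
  polynomial X^2.\<close>

definition pexp :: "real poly \<Rightarrow> real \<Rightarrow> real" where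
  "pexp p x = (if x \<le> 0 then 0 else poly p (1/x) * exp (- (1/x)))"

lemma pexp_tendsto_0: "(pexp p \<longlongrightarrow> 0) (at 0)"
proof -
  have "(pexp p \<longlongrightarrow> 0) (at_right 0)"
  proof (rule Lim_transform_eventually)
    show "((\<lambda>x. poly p (1/x) * exp (- (1/x))) \<longlongrightarrow> 0) (at_right 0)"
      using filterlim_compose[OF tendsto_poly_mult_exp filterlim_inverse_at_top_right]
      by (simp add: inverse_eq_divide)
    show "\<forall>\<^sub>F x in at_right 0. poly p (1/x) * exp (- (1/x)) = pexp p x"
      by (auto simp: eventually_at_right_field pexp_def intro!: exI[of _ 1])
  qed
  moreover have "(pexp p \<longlongrightarrow> 0) (at_left 0)"
    by (rule tendsto_eventually) (auto simp: eventually_at_left_field pexp_def intro!: exI[of _ "-1"])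
  ultimately show ?thesis by (simp add: filterlim_split_at)
qed

lemma pexp_deriv: "(pexp p has_real_derivative pexp ([:0,0,1:] * (p - pderiv p)) x) (at x)"
proof -
  consider "x < 0" | "x = 0" | "x > 0" by linarith
  then show ?thesis
  proof cases
    case 1
    have "((\<lambda>x. 0) has_real_derivative 0) (at x)" by simp
    then have "(pexp p has_real_derivative 0) (at x)"
      by (rule DERIV_cong_ev[THEN iffD1, rotated 3, OF _ refl _ refl])
         (use 1 in \<open>auto simp: pexp_def intro!: eventually_mono[OF eventually_nhds_in_open[of "{..<0}"]]\<close>)
    then show ?thesis using 1 by (simp add: pexp_def)
  next
    case 2
    \<comment> \<open>Division by h multiplies the polynomial by X, so the difference quotient at 0
      is again in the family and its limit is known.\<close>
    have "pexp p h / h = pexp (pCons 0 p) h" for h by (auto simp: pexp_def)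
    then have "((\<lambda>h. (pexp p (0 + h) - pexp p 0) / h) \<longlongrightarrow> 0) (at 0)"
      using pexp_tendsto_0[of "pCons 0 p"] by (simp add: pexp_def[of _ 0])
    then show ?thesis using 2 by (simp add: DERIV_def pexp_def[of _ 0])
  next
    case 3
    have "((\<lambda>x. poly p (1/x) * exp (- (1/x))) has_real_derivative
        poly (pderiv p) (1/x) * (- (1/x^2)) * exp (- (1/x)) + poly p (1/x) * (exp (- (1/x)) * (1/x^2))) (at x)"
      using 3 by (auto intro!: derivative_eq_intros DERIV_chain2[OF poly_DERIV] simp: power2_eq_square)
    then have "(pexp p has_real_derivative
        poly (pderiv p) (1/x) * (- (1/x^2)) * exp (- (1/x)) + poly p (1/x) * (exp (- (1/x)) * (1/x^2))) (at x)"
      by (rule DERIV_cong_ev[THEN iffD1, rotated 3, OF _ refl _ refl])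
         (use 3 in \<open>auto simp: pexp_def intro!: eventually_mono[OF eventually_nhds_in_open[of "{0<..}"]]\<close>)
    then show ?thesis
      by (rule DERIV_cong) (use 3 in \<open>simp add: pexp_def field_simps power2_eq_square\<close>)
  qed
qed

lemma smooth_pexp: "smooth (pexp p)"
  by (rule smooth_coinduct[where P="\<lambda>f. \<exists>p. f = pexp p"]) (use pexp_deriv in blast)+

section \<open>Closure properties of test functions\<close>

lemma test_fun_iff: "test_fun \<psi> \<longleftrightarrow> smooth \<psi> \<and> (\<exists>R. \<forall>x. R < \<bar>x\<bar> \<longrightarrow> \<psi> x = 0)"
  by (simp add: test_fun_def smooth_def)

lemma test_fun_smooth: "test_fun \<psi> \<Longrightarrow> smooth \<psi>" by (simp add: test_fun_iff)

lemma test_fun_measurable [measurable_dest]: "test_fun \<psi> \<Longrightarrow> \<psi> \<in> borel_measurable borel"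
  by (auto dest: test_fun_smooth)

lemma test_fun_support:
  assumes "test_fun \<psi>" obtains R where "R > 0" "\<And>x. R < \<bar>x\<bar> \<Longrightarrow> \<psi> x = 0"
proof -
  obtain R where R: "\<And>x. R < \<bar>x\<bar> \<Longrightarrow> \<psi> x = 0" using assms by (auto simp: test_fun_iff)
  show ?thesis by (rule that[of "max R 1"]) (auto intro: R)
qed

lemma test_fun_bounded: assumes "test_fun \<psi>" obtains C where "C > 0" "\<And>x. \<bar>\<psi> x\<bar> \<le> C"
proof -
  obtain R where R: "R > 0" "\<And>x. R < \<bar>x\<bar> \<Longrightarrow> \<psi> x = 0" using test_fun_support[OF assms] by blast
  have "compact (\<psi> ` {-R..R})"
    using assms by (intro compact_continuous_image smooth_continuous_on test_fun_smooth) auto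
  then obtain C where C: "\<And>y. y \<in> \<psi> ` {-R..R} \<Longrightarrow> norm y \<le> C"
    using compact_imp_bounded bounded_iff by metis
  have "\<bar>\<psi> x\<bar> \<le> max C 1" for x
  proof (cases "R < \<bar>x\<bar>")
    case False
    then have "\<psi> x \<in> \<psi> ` {-R..R}" by (auto simp: abs_le_iff not_less)
    from C[OF this] show ?thesis by simp
  qed (use R in simp)
  then show ?thesis by (intro that[of "max C 1"]) auto
qed

lemma bounded_support_integrable:
  fixes g :: "real \<Rightarrow> 'a::{banach, second_countable_topology}"
  assumes "g \<in> borel_measurable borel" "\<And>x. norm (g x) \<le> C" "\<And>x. R < \<bar>x\<bar> \<Longrightarrow> g x = 0"
  shows "integrable lborel g"
proof (rule Bochner_Integration.integrable_bound)
  show "integrable lborel (\<lambda>x. C * indicator {-R..R} x :: real)"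
    by (intro integrable_mult_right) (simp add: emeasure_lborel_Icc_eq)
  have "0 \<le> C" using order_trans[OF norm_ge_zero assms(2)[of 0]] .
  then show "AE x in lborel. norm (g x) \<le> norm (C * indicator {-R..R} x :: real)"
    using assms(2,3) by (intro AE_I2) (auto simp: indicator_def abs_le_iff not_le)
qed (use assms in simp)

lemma test_fun_integrable: assumes "test_fun \<psi>" shows "integrable lborel \<psi>"
proof -
  obtain R where "\<And>x. R < \<bar>x\<bar> \<Longrightarrow> \<psi> x = 0" using test_fun_support[OF assms] by blast
  moreover obtain C where "\<And>x. \<bar>\<psi> x\<bar> \<le> C" using test_fun_bounded[OF assms] by blast
  ultimately show ?thesis using assms by (intro bounded_support_integrable[of \<psi> C R]) auto
qed

lemma cL2_test_fun: assumes "test_fun \<psi>" shows "cL2 (\<lambda>x. complex_of_real (\<psi> x))"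
proof -
  obtain C where C: "\<And>x. \<bar>\<psi> x\<bar> \<le> C" "C > 0" using test_fun_bounded[OF assms] by metis
  show ?thesis
  proof (rule cL2I_bound)
    show "integrable lborel (\<lambda>x. C * \<bar>\<psi> x\<bar>)" using test_fun_integrable[OF assms] by auto
    show "(cmod (complex_of_real (\<psi> x)))\<^sup>2 \<le> C * \<bar>\<psi> x\<bar>" for x
      using mult_right_mono[OF C(1)[of x] abs_ge_zero[of "\<psi> x"]] by (simp add: power2_eq_square)
  qed (use assms in auto)
qed

lemma test_fun_affine: assumes "test_fun \<psi>" "a \<noteq> 0" shows "test_fun (\<lambda>x. c * \<psi> (a * x + b))"
proof -
  obtain R where R: "R > 0" "\<And>x. R < \<bar>x\<bar> \<Longrightarrow> \<psi> x = 0" using test_fun_support[OF assms(1)] by blast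
  have "c * \<psi> (a * x + b) = 0" if "(R + \<bar>b\<bar>) / \<bar>a\<bar> < \<bar>x\<bar>" for x
  proof -
    have "R + \<bar>b\<bar> < \<bar>a * x\<bar>" using that assms(2) by (simp add: field_simps abs_mult)
    then have "R < \<bar>a * x + b\<bar>" by linarith
    then show ?thesis using R by simp
  qed
  then show ?thesis unfolding test_fun_iff using assms smooth_affine test_fun_smooth by blast
qed

lemma test_fun_reflect: "test_fun \<psi> \<Longrightarrow> test_fun (\<lambda>x. \<psi> (- x))"
  using test_fun_affine[of \<psi> "-1" 1 0] by simp

lemma test_fun_shift: "test_fun \<psi> \<Longrightarrow> test_fun (\<lambda>x. \<psi> (x + b))"
  using test_fun_affine[of \<psi> 1 1 b] by simp

lemma test_fun_add: assumes "test_fun \<psi>" "test_fun \<eta>" shows "test_fun (\<lambda>x. \<psi> x + \<eta> x)"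
proof -
  obtain R S where "\<And>x. R < \<bar>x\<bar> \<Longrightarrow> \<psi> x = 0" "\<And>x. S < \<bar>x\<bar> \<Longrightarrow> \<eta> x = 0"
    using test_fun_support[OF assms(1)] test_fun_support[OF assms(2)] by metis
  then have "\<forall>x. max R S < \<bar>x\<bar> \<longrightarrow> \<psi> x + \<eta> x = 0" by auto
  then show ?thesis using assms smooth_add unfolding test_fun_iff by blast
qed

lemma test_fun_diff: assumes "test_fun \<psi>" "test_fun \<eta>" shows "test_fun (\<lambda>x. \<psi> x - \<eta> x)"
  using test_fun_add[OF assms(1) test_fun_affine[OF assms(2), of 1 "-1" 0]] by simp

lemma test_fun_deriv: assumes "test_fun \<psi>" shows "test_fun (deriv \<psi>)"
proof -
  obtain R where R: "R > 0" "\<And>x. R < \<bar>x\<bar> \<Longrightarrow> \<psi> x = 0" using test_fun_support[OF assms(1)] by blast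
  have "deriv \<psi> x = 0" if "R < \<bar>x\<bar>" for x
  proof (rule DERIV_imp_deriv)
    have "((\<lambda>x. 0) has_real_derivative 0) (at x)" by simp
    then show "(\<psi> has_real_derivative 0) (at x)"
    proof (rule DERIV_cong_ev[THEN iffD1, rotated 3, OF _ refl _ refl])
      have "open {x. R < \<bar>x\<bar>}" by (intro open_Collect_less continuous_intros)
      then show "\<forall>\<^sub>F x in nhds x. 0 = \<psi> x"
        using that R by (intro eventually_mono[OF eventually_nhds_in_open[of "{x. R < \<bar>x\<bar>}"]]) auto
    qed
  qed
  then show ?thesis using assms smooth_deriv unfolding test_fun_iff by blast
qed

text \<open>Both factors tend to 1 inside the interval as n grows, and one of them vanishes outside:
  smooth approximations of the indicator of (a, b), bounded by it for every n.\<close>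

definition bump :: "real \<Rightarrow> real \<Rightarrow> nat \<Rightarrow> real \<Rightarrow> real" where
  "bump a b n x = pexp 1 (real n * (x - a)) * pexp 1 (real n * (b - x))"

lemma pexp_1_bounds: "0 \<le> pexp 1 x" "pexp 1 x \<le> 1"
  by (auto simp: pexp_def)

lemma bump_bounds: "0 \<le> bump a b n x" "bump a b n x \<le> 1"
  using pexp_1_bounds by (auto simp: bump_def intro: mult_le_one)

lemma bump_outside: "x \<notin> {a<..<b} \<Longrightarrow> bump a b n x = 0"
  by (auto simp: bump_def pexp_def mult_nonneg_nonpos)

lemma test_fun_bump: "test_fun (bump a b n)"
proof -
  have "smooth (\<lambda>x. (1 * pexp 1 (real n * x + (- real n * a))) * (1 * pexp 1 ((- real n) * x + real n * b)))"
    by (intro smooth_mult smooth_affine smooth_pexp)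
  moreover have "(\<lambda>x. (1 * pexp 1 (real n * x + (- real n * a))) * (1 * pexp 1 ((- real n) * x + real n * b))) = bump a b n"
    by (auto simp: bump_def algebra_simps fun_eq_iff)
  moreover have "\<forall>x. max \<bar>a\<bar> \<bar>b\<bar> < \<bar>x\<bar> \<longrightarrow> bump a b n x = 0"
    by (auto intro!: bump_outside)
  ultimately show ?thesis unfolding test_fun_iff by metis
qed

lemma bump_tendsto: "(\<lambda>n. bump a b n x) \<longlonglongrightarrow> indicator {a<..<b} x"
proof -
  have *: "(\<lambda>n. pexp 1 (real n * y)) \<longlonglongrightarrow> 1" if "y > 0" for y
  proof -
    have "(\<lambda>n. exp (- (inverse (real n) * (1 / y)))) \<longlonglongrightarrow> exp (- (0 * (1 / y)))"
      by (intro tendsto_intros lim_inverse_n)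
    then have "(\<lambda>n. exp (- (inverse (real n) * (1 / y)))) \<longlonglongrightarrow> 1" by simp
    then show ?thesis
    proof (rule Lim_transform_eventually)
      show "\<forall>\<^sub>F n in sequentially. exp (- (inverse (real n) * (1 / y))) = pexp 1 (real n * y)"
        using eventually_gt_at_top[of "0::nat"] by eventually_elim (use that in \<open>auto simp: pexp_def field_simps mult_le_0_iff\<close>)
    qed
  qed
  show ?thesis
  proof (cases "x \<in> {a<..<b}")
    case True
    then have "(\<lambda>n. pexp 1 (real n * (x - a)) * pexp 1 (real n * (b - x))) \<longlonglongrightarrow> 1 * 1"
      by (intro tendsto_mult *) auto
    then show ?thesis using True by (simp add: bump_def)
  next
    case False
    then show ?thesis by (simp add: bump_outside)
  qed
qed

section \<open>Functions determined by their pairings with test functions\<close>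

text \<open>Dynkin's argument: open intervals form an intersection-stable generator, and sets of
  vanishing integral are closed under complements and countable disjoint unions. Complements need
  the integral over the whole line to vanish, which the intervals (-n, n) give.\<close>

lemma integral_eq_0_all_sets:
  fixes G :: "real \<Rightarrow> complex"
  assumes G: "integrable lborel G" and 0: "\<And>a b. (LINT x|lborel. indicator {a<..<b} x *\<^sub>R G x) = 0"
  shows "AE x in lborel. G x = 0"
proof -
  have meas[measurable]: "G \<in> borel_measurable borel" using G by auto
  have ind: "integrable lborel (\<lambda>x. indicator A x *\<^sub>R G x)" if "A \<in> sets borel" for A
    using integrable_mult_indicator[OF _ G, of A] that by simp
  have tot: "integral\<^sup>L lborel G = 0"
  proof -
    have "(\<lambda>n. LINT x|lborel. indicator {- real n<..<real n} x *\<^sub>R G x) \<longlonglongrightarrow> integral\<^sup>L lborel G"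
    proof (rule integral_dominated_convergence[where w="\<lambda>x. norm (G x)"])
      show "AE x in lborel. (\<lambda>n. indicator {- real n<..<real n} x *\<^sub>R G x) \<longlonglongrightarrow> G x"
      proof (intro AE_I2)
        fix x
        obtain N where "\<bar>x\<bar> < real N" using reals_Archimedean2 by blast
        then have "\<forall>n\<ge>N. indicator {- real n<..<real n} x *\<^sub>R G x = G x"
          by (auto simp: indicator_def)
        then show "(\<lambda>n. indicator {- real n<..<real n} x *\<^sub>R G x) \<longlonglongrightarrow> G x"
          by (intro tendsto_eventually) (auto simp: eventually_sequentially)
      qed
    qed (use G in \<open>auto simp: indicator_def\<close>)
    then show ?thesis by (simp add: 0 LIMSEQ_const_iff)
  qed
  have gen: "sets borel = sigma_sets UNIV (range (\<lambda>(a, b). {a<..<b::real}))"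
    by (simp add: borel_eq_box box_real)
  have all: "(LINT x|lborel. indicator A x *\<^sub>R G x) = 0" if "A \<in> sets borel" for A
  proof -
    have "Int_stable (range (\<lambda>(a, b). {a<..<b::real}))"
      by (auto simp: Int_stable_def box_Int_box simp flip: box_real)
    moreover have "range (\<lambda>(a, b). {a<..<b::real}) \<subseteq> Pow UNIV" by simp
    moreover have "A \<in> sigma_sets UNIV (range (\<lambda>(a, b). {a<..<b::real}))" using that gen by simp
    ultimately show ?thesis
    proof (induction rule: sigma_sets_induct_disjoint)
      case (basic A) then show ?case using 0 by auto
    next
      case empty then show ?case by simp
    next
      case (compl A)
      have A: "A \<in> sets borel" using compl gen by auto
      have "(LINT x|lborel. indicator (UNIV - A) x *\<^sub>R G x) = (LINT x|lborel. G x - indicator A x *\<^sub>R G x)"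
        by (intro Bochner_Integration.integral_cong) (auto simp: indicator_def)
      also have "\<dots> = 0"
        using compl ind[OF A] G tot by (subst Bochner_Integration.integral_diff) auto
      finally show ?case .
    next
      case (union A)
      have A: "A i \<in> sets borel" for i using union(2) gen by auto
      have "(\<lambda>n. LINT x|lborel. indicator (\<Union>i\<in>{..<n}. A i) x *\<^sub>R G x) \<longlonglongrightarrow> (LINT x|lborel. indicator (\<Union>(range A)) x *\<^sub>R G x)"
      proof (rule integral_dominated_convergence[where w="\<lambda>x. norm (G x)"])
        show "AE x in lborel. (\<lambda>n. indicator (\<Union>i\<in>{..<n}. A i) x *\<^sub>R G x) \<longlonglongrightarrow> indicator (\<Union>(range A)) x *\<^sub>R G x"
          by (intro AE_I2 tendsto_intros LIMSEQ_indicator_UN)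
        show "(\<lambda>x. indicator (\<Union>(range A)) x *\<^sub>R G x) \<in> borel_measurable lborel"
          using A by measurable
        show "(\<lambda>x. indicator (\<Union>i\<in>{..<n}. A i) x *\<^sub>R G x) \<in> borel_measurable lborel" for n
          using A by measurable
      qed (use G in \<open>auto simp: indicator_def\<close>)
      moreover have "(LINT x|lborel. indicator (\<Union>i\<in>{..<n}. A i) x *\<^sub>R G x) = 0" for n
      proof -
        have "(LINT x|lborel. indicator (\<Union>i\<in>{..<n}. A i) x *\<^sub>R G x) = (LINT x|lborel. (\<Sum>i<n. indicator (A i) x *\<^sub>R G x))"
          using union(1) by (intro Bochner_Integration.integral_cong refl)
            (simp add: scaleR_sum_left[symmetric] indicator_UN_disjoint disjoint_family_on_def)
        also have "\<dots> = 0" using ind[OF A] union by (subst Bochner_Integration.integral_sum) auto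
        finally show ?thesis .
      qed
      ultimately show ?case by (simp add: LIMSEQ_const_iff)
    qed
  qed
  show ?thesis
    by (rule sigma_finite_measure.density_unique_banach[OF sigma_finite_lborel]) (use G all in \<open>auto simp: set_lebesgue_integral_def\<close>)
qed

text \<open>Bumps approximate indicators of intervals, with a truncation of G as majorant, and
  \<open>integral_eq_0_all_sets\<close> applies. G is cut off because it need not be integrable on
  the line.\<close>

lemma cL2_test_zero:
  assumes G: "cL2 G" and 0: "\<And>\<psi>. test_fun \<psi> \<Longrightarrow> (LINT x|lborel. G x * complex_of_real (\<psi> x)) = 0"
  shows "AE x in lborel. G x = 0"
proof -
  have [measurable]: "G \<in> borel_measurable borel" using G by (simp add: cL2_def)
  have int0: "(LINT x|lborel. indicator {a<..<b} x *\<^sub>R G x) = 0" for a b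
  proof -
    define c where "c = max \<bar>a\<bar> \<bar>b\<bar>"
    have "(\<lambda>n. LINT x|lborel. G x * complex_of_real (bump a b n x)) \<longlonglongrightarrow> (LINT x|lborel. indicator {a<..<b} x *\<^sub>R G x)"
    proof (rule integral_dominated_convergence[where w="\<lambda>x. norm (trunc c G x)"])
      show "integrable lborel (\<lambda>x. norm (trunc c G x))" using trunc_integrable[OF G] by simp
      show "AE x in lborel. (\<lambda>n. G x * complex_of_real (bump a b n x)) \<longlonglongrightarrow> indicator {a<..<b} x *\<^sub>R G x"
      proof (intro AE_I2)
        fix x
        have "(\<lambda>n. G x * complex_of_real (bump a b n x)) \<longlonglongrightarrow> G x * complex_of_real (indicator {a<..<b} x)"
          by (intro tendsto_intros bump_tendsto)
        then show "(\<lambda>n. G x * complex_of_real (bump a b n x)) \<longlonglongrightarrow> indicator {a<..<b} x *\<^sub>R G x"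
          by (simp add: scaleR_conv_of_real mult.commute)
      qed
      show "(\<lambda>x. G x * complex_of_real (bump a b n x)) \<in> borel_measurable lborel" for n
        using test_fun_measurable[OF test_fun_bump[of a b n]] by simp
      show "AE x in lborel. norm (G x * complex_of_real (bump a b n x)) \<le> norm (trunc c G x)" for n
      proof (intro AE_I2)
        fix x show "norm (G x * complex_of_real (bump a b n x)) \<le> norm (trunc c G x)"
        proof (cases "x \<in> {a<..<b}")
          case True
          then have "x \<in> {-c..c}" by (auto simp: c_def)
          then show ?thesis using bump_bounds[of a b n x]
            by (auto simp: trunc_def norm_mult intro: mult_left_le)
        qed (simp add: bump_outside)
      qed
    qed simp
    then show ?thesis using 0[OF test_fun_bump] by (simp add: LIMSEQ_const_iff)
  qed
  have "AE x in lborel. trunc (real n) G x = 0" for n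
  proof (rule integral_eq_0_all_sets)
    show "integrable lborel (trunc (real n) G)" by (rule trunc_integrable[OF G])
    fix a b
    \<comment> \<open>The cutoff interval [-n, n] is closed while the others are open; the two
      integrands differ at most at n and -n.\<close>
    define a' b' where "a' = max a (- real n)" and "b' = min b (real n)"
    have "(LINT x|lborel. indicator {a<..<b} x *\<^sub>R trunc (real n) G x) = (LINT x|lborel. indicator {a'<..<b'} x *\<^sub>R G x)"
    proof (rule integral_cong_AE)
      show "AE x in lborel. indicator {a<..<b} x *\<^sub>R trunc (real n) G x = indicator {a'<..<b'} x *\<^sub>R G x"
        using AE_lborel_singleton[of "real n"] AE_lborel_singleton[of "- real n"]
        by eventually_elim (auto simp: trunc_def indicator_def a'_def b'_def)
    qed auto
    then show "(LINT x|lborel. indicator {a<..<b} x *\<^sub>R trunc (real n) G x) = 0" using int0 by simp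
  qed
  then have "AE x in lborel. \<forall>n. trunc (real n) G x = 0" by (simp add: AE_all_countable)
  then show ?thesis
  proof eventually_elim
    case (elim x)
    obtain n where "\<bar>x\<bar> \<le> real n" using real_arch_simple by blast
    with elim show ?case by (auto simp: trunc_def abs_le_iff dest: spec[of _ n])
  qed
qed

section \<open>The Fourier transform on \<open>L\<^sup>1 \<inter> L\<^sup>2\<close>\<close>

definition ft :: "(real \<Rightarrow> complex) \<Rightarrow> real \<Rightarrow> complex" where
  "ft g \<xi> = (LINT x|lborel. g x * cis (- (x * \<xi>)))"

lemma FT_eq_ft: "FT \<psi> = ft (\<lambda>x. complex_of_real (\<psi> x))"
  by (simp add: FT_def ft_def fun_eq_iff)

lemma borel_measurable_cis [measurable (raw)]:
  "f \<in> borel_measurable M \<Longrightarrow> (\<lambda>x. cis (f x)) \<in> borel_measurable M"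
  by (rule measurable_compose[of f M borel cis])
     (auto intro!: borel_measurable_continuous_onI continuous_intros)

lemma integrable_cis_mult:
  assumes "integrable lborel g" "a \<in> borel_measurable borel"
  shows "integrable lborel (\<lambda>x. g x * cis (a x))"
  using assms by (intro Bochner_Integration.integrable_bound[OF assms(1)]) (auto simp: norm_mult)

lemma ft_norm_le: "cmod (ft g \<xi>) \<le> (LINT x|lborel. cmod (g x))"
  unfolding ft_def by (rule order_trans[OF integral_norm_bound]) (simp add: norm_mult)

lemma ft_measurable [measurable]:
  assumes [measurable]: "g \<in> borel_measurable borel" shows "ft g \<in> borel_measurable borel"
  unfolding ft_def by measurable

lemma ft_diff: assumes "integrable lborel g" "integrable lborel h"
  shows "ft (\<lambda>x. g x - h x) \<xi> = ft g \<xi> - ft h \<xi>"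
  unfolding ft_def left_diff_distrib using assms
  by (intro Bochner_Integration.integral_diff integrable_cis_mult) auto

lemma ft_reflect: "ft (\<lambda>x. g (- x)) \<xi> = ft g (- \<xi>)"
  unfolding ft_def using lborel_integral_real_affine[of "-1" "\<lambda>x. g x * cis (x * \<xi>)" 0] by simp

lemma ft_cnj: "ft (\<lambda>x. cnj (g x)) \<xi> = cnj (ft g (- \<xi>))"
proof -
  have "cnj (ft g (- \<xi>)) = (LINT x|lborel. cnj (g x * cis (- (x * - \<xi>))))"
    unfolding ft_def by (rule Bochner_Integration.integral_cnj[symmetric])
  also have "\<dots> = ft (\<lambda>x. cnj (g x)) \<xi>"
    unfolding ft_def by (simp add: cis_cnj)
  finally show ?thesis by simp
qed

lemma ft_shift: "ft (\<lambda>x. g (x + b)) \<xi> = cis (b * \<xi>) * ft g \<xi>"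
proof -
  have "ft g \<xi> = (LINT x|lborel. g (b + x) * cis (- ((b + x) * \<xi>)))"
    unfolding ft_def by (subst lborel_integral_real_affine[of 1 _ b]) auto
  also have "\<dots> = (LINT x|lborel. cis (- (b * \<xi>)) * (g (x + b) * cis (- (x * \<xi>))))"
    by (intro Bochner_Integration.integral_cong refl)
       (simp add: cis_mult mult.left_commute algebra_simps)
  also have "\<dots> = cis (- (b * \<xi>)) * ft (\<lambda>x. g (x + b)) \<xi>"
    unfolding ft_def by simp
  finally show ?thesis by (simp add: mult.assoc[symmetric] cis_mult)
qed

text \<open>Fubini. This identity is what survives the passage to L^2; with Gaussian factors in the
  second function it also yields the L^2 bound and the inversion formula.\<close>

lemma ft_duality:
  assumes g: "integrable lborel g" and h: "integrable lborel h"
  shows "(LINT \<xi>|lborel. ft g \<xi> * h \<xi>) = (LINT x|lborel. g x * ft h x)"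
proof -
  have [measurable]: "g \<in> borel_measurable borel" "h \<in> borel_measurable borel" using g h by auto
  have "integrable (lborel \<Otimes>\<^sub>M lborel) (\<lambda>(x, \<xi>). g x * h \<xi> * cis (- (x * \<xi>)))"
  proof (rule lborel_pair.Fubini_integrable)
    show "integrable lborel (\<lambda>x. LINT \<xi>|lborel. norm (case (x, \<xi>) of (x, \<xi>) \<Rightarrow> g x * h \<xi> * cis (- (x * \<xi>))))"
      using g by (simp add: norm_mult)
    show "AE x in lborel. integrable lborel (\<lambda>\<xi>. case (x, \<xi>) of (x, \<xi>) \<Rightarrow> g x * h \<xi> * cis (- (x * \<xi>)))"
      using h by (auto intro!: integrable_cis_mult)
  qed measurable
  from lborel_pair.Fubini_integral[OF this]
  have "(LINT \<xi>|lborel. LINT x|lborel. g x * h \<xi> * cis (- (x * \<xi>)))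
      = (LINT x|lborel. LINT \<xi>|lborel. g x * h \<xi> * cis (- (x * \<xi>)))" by simp
  also have "(LINT \<xi>|lborel. LINT x|lborel. g x * h \<xi> * cis (- (x * \<xi>)))
      = (LINT \<xi>|lborel. LINT x|lborel. (g x * cis (- (x * \<xi>))) * h \<xi>)"
    by (simp add: mult_ac)
  also have "\<dots> = (LINT \<xi>|lborel. ft g \<xi> * h \<xi>)"
    unfolding ft_def by simp
  also have "(LINT x|lborel. LINT \<xi>|lborel. g x * h \<xi> * cis (- (x * \<xi>)))
      = (LINT x|lborel. LINT \<xi>|lborel. g x * (h \<xi> * cis (- (\<xi> * x))))"
    by (simp add: mult_ac)
  also have "\<dots> = (LINT x|lborel. g x * ft h x)"
    unfolding ft_def by simp
  finally show ?thesis .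
qed

section \<open>Gaussian regularisation: the bound in L^2 and the inversion formula\<close>

definition gauss :: "real \<Rightarrow> real \<Rightarrow> complex" where
  "gauss s \<xi> = complex_of_real (exp (- ((\<xi> / s)^2) / 2))"

lemma gauss_measurable [measurable]: "gauss s \<in> borel_measurable borel"
  unfolding gauss_def by measurable

lemma gauss_integrable: assumes "s > 0" shows "integrable lborel (gauss s)"
proof -
  have "integrable lborel (\<lambda>x. sqrt (2 * pi) * std_normal_density (0 + (1/s) * x))"
    using assms by (intro integrable_mult_right lborel_integrable_real_affine) auto
  then have "integrable lborel (\<lambda>x. complex_of_real (sqrt (2 * pi) * std_normal_density (0 + (1/s) * x)))"
    by (rule integrable_of_real)
  then show ?thesis by (simp add: gauss_def[abs_def] std_normal_density_def)
qed

text \<open>The characteristic function of the standard normal law, rescaled. The result is written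
  as 2\<pi> times a probability density that concentrates at 0 as s grows.\<close>

lemma ft_gauss: assumes s: "s > 0"
  shows "ft (gauss s) t = complex_of_real (2 * pi * s * std_normal_density (s * t))"
proof -
  have "(LINT x|lborel. complex_of_real (std_normal_density x) * cis (- (s * t) * x)) = complex_of_real (exp (- ((s * t)^2) / 2))"
  proof -
    have "char std_normal_distribution (- (s * t)) = (LINT x|lborel. std_normal_density x *\<^sub>R cis (- (s * t) * x))"
      unfolding char_def by (subst integral_density) (auto simp: cis_conv_exp mult_ac)
    then show ?thesis by (simp add: char_std_normal_distribution scaleR_conv_of_real)
  qed
  then have "complex_of_real (sqrt (2 * pi)) * complex_of_real (exp (- ((s * t)^2) / 2))
     = (LINT x|lborel. complex_of_real (sqrt (2 * pi)) * (complex_of_real (std_normal_density x) * cis (- (s * t) * x)))"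
    by simp
  also have "\<dots> = (LINT x|lborel. complex_of_real (exp (- (x^2) / 2)) * cis (- (s * t) * x))"
    by (intro Bochner_Integration.integral_cong refl) (simp add: std_normal_density_def)
  also have "\<dots> = (1/s) *\<^sub>R (LINT x|lborel. gauss s x * cis (- (x * t)))"
    using s by (subst lborel_integral_real_affine[of "1/s" _ 0]) (auto simp: gauss_def mult_ac)
  finally have "ft (gauss s) t = s *\<^sub>R (complex_of_real (sqrt (2 * pi)) * complex_of_real (exp (- ((s * t)^2) / 2)))"
    using s by (simp add: ft_def)
  moreover have "2 * pi * s * std_normal_density (s * t) = s * (sqrt (2 * pi) * exp (- ((s * t)^2) / 2))"
  proof -
    have "2 * pi / sqrt (2 * pi) = sqrt (2 * pi)" by (rule real_div_sqrt) simp
    then show ?thesis unfolding std_normal_density_def by (simp add: field_simps del: real_sqrt_mult)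
  qed
  ultimately show ?thesis by (simp only: scaleR_conv_of_real of_real_mult)
qed

lemma ft_gauss_cis: assumes s: "s > 0"
  shows "ft (\<lambda>x. gauss s x * cis (a * x)) t = complex_of_real (2 * pi * s * std_normal_density (s * (t - a)))"
proof -
  have "ft (\<lambda>x. gauss s x * cis (a * x)) t = ft (gauss s) (t - a)"
    unfolding ft_def by (intro Bochner_Integration.integral_cong refl) (simp add: mult.assoc cis_mult algebra_simps)
  then show ?thesis by (simp add: ft_gauss[OF s])
qed

lemma nn_integral_std_normal: "(\<integral>\<^sup>+x. ennreal (std_normal_density x) \<partial>lborel) = 1"
  using prob_space_normal_density[of 1 0] by (simp add: prob_space_def prob_space_axioms_def emeasure_density)

text \<open>Both marginals of the kernel have mass 2\<pi> whatever the width; this is the input of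
  Schur's test.\<close>

lemma nn_integral_gauss_kernel: assumes s: "s > 0"
  shows "(\<integral>\<^sup>+y. ennreal (2 * pi * s * std_normal_density (s * (x - y))) \<partial>lborel) = ennreal (2 * pi)"
    and "(\<integral>\<^sup>+y. ennreal (2 * pi * s * std_normal_density (s * (y - x))) \<partial>lborel) = ennreal (2 * pi)"
proof -
  have *: "(\<integral>\<^sup>+y. ennreal (2 * pi * s * std_normal_density (c * y + t)) \<partial>lborel) = ennreal (2 * pi)"
    if "\<bar>c\<bar> = s" for c t
  proof -
    have "(\<integral>\<^sup>+y. ennreal (2 * pi * s * std_normal_density (c * y + t)) \<partial>lborel)
        = (\<integral>\<^sup>+y. ennreal (2 * pi) * (ennreal \<bar>c\<bar> * ennreal (std_normal_density (t + c * y))) \<partial>lborel)"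
      using s that by (intro nn_integral_cong) (auto simp: ennreal_mult[symmetric] mult.assoc add.commute)
    also have "\<dots> = ennreal (2 * pi) * (ennreal \<bar>c\<bar> * (\<integral>\<^sup>+y. ennreal (std_normal_density (t + c * y)) \<partial>lborel))"
      by (simp add: nn_integral_cmult)
    also have "(ennreal \<bar>c\<bar> * (\<integral>\<^sup>+y. ennreal (std_normal_density (t + c * y)) \<partial>lborel)) = 1"
      using s that by (subst nn_integral_real_affine[symmetric]) (auto simp: nn_integral_std_normal)
    finally show ?thesis by simp
  qed
  show "(\<integral>\<^sup>+y. ennreal (2 * pi * s * std_normal_density (s * (x - y))) \<partial>lborel) = ennreal (2 * pi)"
    using *[of "-s" "s * x"] s by (simp add: algebra_simps)
  show "(\<integral>\<^sup>+y. ennreal (2 * pi * s * std_normal_density (s * (y - x))) \<partial>lborel) = ennreal (2 * pi)"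
    using *[of "s" "- s * x"] s by (simp add: algebra_simps)
qed

lemma norm_integral_le_nn:
  fixes f :: "'a \<Rightarrow> 'b::{banach, second_countable_topology}"
  shows "ennreal (norm (integral\<^sup>L M f)) \<le> (\<integral>\<^sup>+x. ennreal (norm (f x)) \<partial>M)"
  by (cases "integrable M f") (auto simp: not_integrable_integral_eq intro: integral_norm_bound_ennreal)

text \<open>Schur's test for the Gaussian kernel. Only the inequality half of Plancherel is proved; it suffices
  for extending the transform to \<open>L\<^sup>2\<close>, and inversion comes from the duality with test functions.\<close>
lemma gauss_damped_bessel:
  assumes g: "integrable lborel g" "cL2 g" and s: "s > 0"
  shows "(\<integral>\<^sup>+\<xi>. ennreal ((cmod (ft g \<xi>))^2 * exp (- ((\<xi> / s)^2) / 2)) \<partial>lborel) \<le> ennreal (2 * pi * sqnorm g)"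
proof -
  have [measurable]: "g \<in> borel_measurable borel" using g by (simp add: cL2_def)
  \<comment> \<open>Chosen so that the pairing of \<open>ft g\<close> with h is the integral of its
    squared modulus against the Gaussian.\<close>
  define h where "h \<xi> = cnj (ft g \<xi>) * gauss s \<xi>" for \<xi>
  define K where "K z = 2 * pi * s * std_normal_density (s * z)" for z
  have K0: "K z \<ge> 0" for z using s by (simp add: K_def)
  have [measurable]: "K \<in> borel_measurable borel" unfolding K_def by measurable
  define B where "B = (LINT x|lborel. cmod (g x))"
  have B: "cmod (ft g \<xi>) \<le> B" for \<xi> unfolding B_def by (rule ft_norm_le)
  have hm[measurable]: "h \<in> borel_measurable borel" unfolding h_def by measurable
  have hi: "integrable lborel h"
  proof (rule Bochner_Integration.integrable_bound)
    show "integrable lborel (\<lambda>x. complex_of_real B * gauss s x)" using gauss_integrable[OF s] by auto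
    show "AE x in lborel. norm (h x) \<le> norm (complex_of_real B * gauss s x)"
      using B order_trans[OF norm_ge_zero B] by (auto simp: h_def norm_mult intro!: mult_right_mono AE_I2)
  qed auto
  \<comment> \<open>The transform of h is the convolution of the conjugate of g with K: duality
    moves the transform from g to a modulated Gaussian, whose transform is a translated one.\<close>
  have fth: "ft h x = (LINT y|lborel. cnj (g y) * complex_of_real (K (x - y)))" for x
  proof -
    define k where "k \<xi> = gauss s \<xi> * cis (- x * \<xi>)" for \<xi>
    have ki: "integrable lborel k" unfolding k_def
      by (intro integrable_cis_mult gauss_integrable s) auto
    have gi: "integrable lborel (\<lambda>y. cnj (g (- y)))"
      using lborel_integrable_real_affine[of "\<lambda>y. cnj (g y)" "-1" 0] g by simp
    have "ft h x = (LINT \<xi>|lborel. ft (\<lambda>y. cnj (g (- y))) \<xi> * k \<xi>)"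
      unfolding ft_def[of h] using ft_reflect[of "\<lambda>y. cnj (g y)"] ft_cnj[of g]
      by (intro Bochner_Integration.integral_cong refl) (simp add: h_def k_def mult_ac)
    also have "\<dots> = (LINT y|lborel. cnj (g (- y)) * ft k y)"
      by (rule ft_duality[OF gi ki])
    also have "\<dots> = (LINT y|lborel. cnj (g (- y)) * complex_of_real (K (x + y)))"
      using ft_gauss_cis[OF s, of "- x"] by (simp add: k_def[abs_def] K_def add.commute)
    also have "\<dots> = (LINT y|lborel. cnj (g y) * complex_of_real (K (x - y)))"
      by (subst lborel_integral_real_affine[of "-1" _ 0]) auto
    finally show ?thesis .
  qed
  have "(\<integral>\<^sup>+\<xi>. ennreal ((cmod (ft g \<xi>))^2 * exp (- ((\<xi> / s)^2) / 2)) \<partial>lborel)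
      = ennreal (LINT \<xi>|lborel. (cmod (ft g \<xi>))^2 * exp (- ((\<xi> / s)^2) / 2))"
  proof (rule nn_integral_eq_integral)
    show "integrable lborel (\<lambda>\<xi>. (cmod (ft g \<xi>))^2 * exp (- ((\<xi> / s)^2) / 2))"
    proof (rule Bochner_Integration.integrable_bound)
      show "integrable lborel (\<lambda>x. complex_of_real B * h x)" using hi by auto
      show "AE x in lborel. norm ((cmod (ft g x))\<^sup>2 * exp (- ((x / s)\<^sup>2) / 2)) \<le> norm (complex_of_real B * h x)"
      proof (intro AE_I2)
        fix x
        have "0 \<le> B" using order_trans[OF norm_ge_zero B] .
        then show "norm ((cmod (ft g x))\<^sup>2 * exp (- ((x / s)\<^sup>2) / 2)) \<le> norm (complex_of_real B * h x)"
          using mult_right_mono[OF B[of x], of "cmod (ft g x) * exp (- ((x / s)\<^sup>2) / 2)"]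
          by (simp add: h_def norm_mult gauss_def power2_eq_square mult.assoc)
      qed
    qed auto
  qed auto
  also have "(LINT \<xi>|lborel. (cmod (ft g \<xi>))^2 * exp (- ((\<xi> / s)^2) / 2)) = cmod (LINT \<xi>|lborel. ft g \<xi> * h \<xi>)"
  proof -
    have "ft g \<xi> * h \<xi> = complex_of_real ((cmod (ft g \<xi>))^2 * exp (- ((\<xi> / s)^2) / 2))" for \<xi>
      by (simp add: h_def gauss_def mult.assoc[symmetric] complex_norm_square[symmetric] del: of_real_power)
    then show ?thesis
      by (simp add: integral_nonneg_AE del: of_real_power of_real_mult)
  qed
  also have "(LINT \<xi>|lborel. ft g \<xi> * h \<xi>) = (LINT x|lborel. g x * ft h x)"
    by (rule ft_duality[OF g(1) hi])
  also have "ennreal (cmod (LINT x|lborel. g x * ft h x)) \<le> (\<integral>\<^sup>+x. ennreal (cmod (g x * ft h x)) \<partial>lborel)"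
    by (rule norm_integral_le_nn)
  \<comment> \<open>The bound |g(x)||g(y)| \<le> (|g(x)|^2 + |g(y)|^2)/2 leaves two terms in which K
    is integrated over one variable alone.\<close>
  also have "\<dots> \<le> (\<integral>\<^sup>+x. \<integral>\<^sup>+y. (ennreal ((cmod (g x))^2 / 2) * ennreal (K (x - y)) + ennreal ((cmod (g y))^2 / 2) * ennreal (K (x - y))) \<partial>lborel \<partial>lborel)"
  proof (rule nn_integral_mono)
    fix x
    have "ennreal (cmod (g x * ft h x)) \<le> ennreal (cmod (g x)) * (\<integral>\<^sup>+y. ennreal (cmod (cnj (g y) * complex_of_real (K (x - y)))) \<partial>lborel)"
      unfolding norm_mult[of "g x"] fth by (subst ennreal_mult) (auto intro!: mult_left_mono norm_integral_le_nn)
    also have "\<dots> = (\<integral>\<^sup>+y. ennreal (cmod (g x) * (cmod (g y) * K (x - y))) \<partial>lborel)"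
      using K0 by (subst nn_integral_cmult[symmetric]) (auto simp: norm_mult ennreal_mult)
    also have "\<dots> \<le> (\<integral>\<^sup>+y. (ennreal ((cmod (g x))^2 / 2) * ennreal (K (x - y)) + ennreal ((cmod (g y))^2 / 2) * ennreal (K (x - y))) \<partial>lborel)"
    proof (rule nn_integral_mono)
      fix y
      have "cmod (g x) * cmod (g y) \<le> (cmod (g x))^2 / 2 + (cmod (g y))^2 / 2"
        using sum_squares_bound[of "cmod (g x)" "cmod (g y)"] by simp
      from mult_right_mono[OF this K0[of "x - y"]]
      show "ennreal (cmod (g x) * (cmod (g y) * K (x - y)))
         \<le> ennreal ((cmod (g x))^2 / 2) * ennreal (K (x - y)) + ennreal ((cmod (g y))^2 / 2) * ennreal (K (x - y))"
        using K0 by (simp add: ennreal_mult[symmetric] ennreal_plus[symmetric] distrib_right mult.assoc del: ennreal_plus)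
    qed
    finally show "ennreal (cmod (g x * ft h x)) \<le> \<dots>" .
  qed
  also have "\<dots> = (\<integral>\<^sup>+x. \<integral>\<^sup>+y. ennreal ((cmod (g x))^2 / 2) * ennreal (K (x - y)) \<partial>lborel \<partial>lborel)
      + (\<integral>\<^sup>+x. \<integral>\<^sup>+y. ennreal ((cmod (g y))^2 / 2) * ennreal (K (x - y)) \<partial>lborel \<partial>lborel)"
    by (subst nn_integral_add[symmetric]) (auto simp: nn_integral_add)
  also have "(\<integral>\<^sup>+x. \<integral>\<^sup>+y. ennreal ((cmod (g y))^2 / 2) * ennreal (K (x - y)) \<partial>lborel \<partial>lborel)
     = (\<integral>\<^sup>+y. \<integral>\<^sup>+x. ennreal ((cmod (g y))^2 / 2) * ennreal (K (x - y)) \<partial>lborel \<partial>lborel)"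
    by (rule lborel_pair.Fubini') measurable
  also have "(\<integral>\<^sup>+x. \<integral>\<^sup>+y. ennreal ((cmod (g x))^2 / 2) * ennreal (K (x - y)) \<partial>lborel \<partial>lborel)
     = (\<integral>\<^sup>+x. ennreal ((cmod (g x))^2 / 2) * ennreal (2 * pi) \<partial>lborel)"
    using nn_integral_gauss_kernel(1)[OF s] by (simp add: nn_integral_cmult K_def)
  also have "(\<integral>\<^sup>+y. \<integral>\<^sup>+x. ennreal ((cmod (g y))^2 / 2) * ennreal (K (x - y)) \<partial>lborel \<partial>lborel)
     = (\<integral>\<^sup>+x. ennreal ((cmod (g x))^2 / 2) * ennreal (2 * pi) \<partial>lborel)"
    using nn_integral_gauss_kernel(2)[OF s] by (simp add: nn_integral_cmult K_def)
  also have "(\<integral>\<^sup>+x. ennreal ((cmod (g x))^2 / 2) * ennreal (2 * pi) \<partial>lborel) + (\<integral>\<^sup>+x. ennreal ((cmod (g x))^2 / 2) * ennreal (2 * pi) \<partial>lborel)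
     = (\<integral>\<^sup>+x. ennreal (2 * pi) * ennreal (cmod (g x))^2 \<partial>lborel)"
    by (subst nn_integral_add[symmetric])
       (auto intro!: nn_integral_cong simp: ennreal_power ennreal_mult[symmetric] ennreal_plus[symmetric] simp del: ennreal_plus)
  also have "\<dots> = ennreal (2 * pi * sqnorm g)"
    using g by (simp add: nn_integral_cmult nn_sqnorm ennreal_mult)
  finally show ?thesis .
qed

text \<open>The damped bound is uniform in s, so Fatou's lemma removes the damping as s tends to
  infinity.\<close>

lemma bessel_L1_L2:
  assumes g: "integrable lborel g" "cL2 g"
  shows "cL2 (ft g)" "sqnorm (ft g) \<le> 2 * pi * sqnorm g"
proof -
  have [measurable]: "g \<in> borel_measurable borel" using g by (simp add: cL2_def)
  have "(\<integral>\<^sup>+\<xi>. ennreal (cmod (ft g \<xi>))^2 \<partial>lborel)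
     = (\<integral>\<^sup>+\<xi>. liminf (\<lambda>n. ennreal ((cmod (ft g \<xi>))^2 * exp (- ((\<xi> / real (Suc n))^2) / 2))) \<partial>lborel)"
  proof (rule nn_integral_cong)
    fix \<xi>
    have "(\<lambda>n. \<xi> / real (Suc n)) \<longlonglongrightarrow> 0"
      by (rule LIMSEQ_Suc[OF lim_const_over_n])
    then have "(\<lambda>n. ennreal ((cmod (ft g \<xi>))^2 * exp (- ((\<xi> / real (Suc n))^2) / 2))) \<longlonglongrightarrow> ennreal ((cmod (ft g \<xi>))^2 * exp (- (0^2) / 2))"
      by (intro tendsto_intros) auto
    from lim_imp_Liminf[OF _ this]
    show "ennreal (cmod (ft g \<xi>))^2 = liminf (\<lambda>n. ennreal ((cmod (ft g \<xi>))^2 * exp (- ((\<xi> / real (Suc n))^2) / 2)))"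
      by (simp add: ennreal_power)
  qed
  also have "\<dots> \<le> liminf (\<lambda>n. \<integral>\<^sup>+\<xi>. ennreal ((cmod (ft g \<xi>))^2 * exp (- ((\<xi> / real (Suc n))^2) / 2)) \<partial>lborel)"
    by (rule nn_integral_liminf) measurable
  also have "\<dots> \<le> ennreal (2 * pi * sqnorm g)"
  proof (rule Liminf_le)
    show "\<forall>\<^sub>F n in sequentially. (\<integral>\<^sup>+\<xi>. ennreal ((cmod (ft g \<xi>))^2 * exp (- ((\<xi> / real (Suc n))^2) / 2)) \<partial>lborel)
        \<le> ennreal (2 * pi * sqnorm g)"
      by (intro always_eventually allI gauss_damped_bessel g) auto
  qed simp
  finally show "cL2 (ft g)" "sqnorm (ft g) \<le> 2 * pi * sqnorm g"
    by (auto intro!: cL2I_nn[of "ft g" "2 * pi * sqnorm g"])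
qed

text \<open>The damped inverse integral J is evaluated twice: removing the damping gives the double
  transform, while duality turns J into 2\<pi> times the mean of g under a normal law of width
  1/(n+1) around \<xi>, which tends to 2\<pi> g(\<xi>) by continuity.\<close>

lemma ft_inversion:
  assumes g: "integrable lborel g" "continuous_on UNIV g" "\<And>x. cmod (g x) \<le> C" "integrable lborel (ft g)"
  shows "ft (\<lambda>x. ft g (- x)) \<xi> = complex_of_real (2 * pi) * g \<xi>"
proof -
  have [measurable]: "g \<in> borel_measurable borel" using g by auto
  define J where "J n = (LINT x|lborel. ft g x * (gauss (real (Suc n)) x * cis (\<xi> * x)))" for n
  have "J \<longlonglongrightarrow> (LINT x|lborel. ft g x * (1 * cis (\<xi> * x)))"
    unfolding J_def
  proof (rule integral_dominated_convergence[where w="\<lambda>x. cmod (ft g x)"])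
    show "AE x in lborel. (\<lambda>n. ft g x * (gauss (real (Suc n)) x * cis (\<xi> * x))) \<longlonglongrightarrow> ft g x * (1 * cis (\<xi> * x))"
    proof (intro AE_I2 tendsto_intros)
      fix x :: real
      have "(\<lambda>n. x / real (Suc n)) \<longlonglongrightarrow> 0"
        by (rule LIMSEQ_Suc[OF lim_const_over_n])
      then have "(\<lambda>n. gauss (real (Suc n)) x) \<longlonglongrightarrow> complex_of_real (exp (- (0^2) / 2))"
        unfolding gauss_def by (intro tendsto_intros) auto
      then show "(\<lambda>n. gauss (real (Suc n)) x) \<longlonglongrightarrow> 1" by simp
    qed
    show "AE x in lborel. norm (ft g x * (gauss (real (Suc n)) x * cis (\<xi> * x))) \<le> cmod (ft g x)" for n
      by (auto simp: norm_mult gauss_def intro!: mult_left_le AE_I2)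
  qed (use g in auto)
  moreover have "J \<longlonglongrightarrow> complex_of_real (2 * pi) * g \<xi>"
  proof -
    have J: "J n = complex_of_real (2 * pi) * (LINT z|lborel. std_normal_density z *\<^sub>R g (\<xi> + (1 / real (Suc n)) * z))" for n
    proof -
      have "J n = (LINT y|lborel. g y * ft (\<lambda>x. gauss (real (Suc n)) x * cis (\<xi> * x)) y)"
        unfolding J_def by (intro ft_duality integrable_cis_mult gauss_integrable g) auto
      also have "\<dots> = (LINT y|lborel. g y * complex_of_real (2 * pi * real (Suc n) * std_normal_density (real (Suc n) * (y - \<xi>))))"
        by (subst ft_gauss_cis) auto
      also have "\<dots> = (1 / real (Suc n)) *\<^sub>R (LINT z|lborel. g (\<xi> + (1 / real (Suc n)) * z) *
          complex_of_real (2 * pi * real (Suc n) * std_normal_density z))"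
        by (subst lborel_integral_real_affine[of "1 / real (Suc n)" _ \<xi>]) (simp_all del: of_nat_Suc)
      also have "\<dots> = (LINT z|lborel. complex_of_real (2 * pi) * (std_normal_density z *\<^sub>R g (\<xi> + (1 / real (Suc n)) * z)))"
        by (subst integral_scaleR_right[symmetric], intro Bochner_Integration.integral_cong refl)
           (simp add: scaleR_conv_of_real field_simps del: of_nat_Suc)
      finally show ?thesis by (simp only: Bochner_Integration.integral_mult_right_zero)
    qed
    have "(\<lambda>n. LINT z|lborel. std_normal_density z *\<^sub>R g (\<xi> + (1 / real (Suc n)) * z)) \<longlonglongrightarrow> (LINT z|lborel. std_normal_density z *\<^sub>R g \<xi>)"
    proof (rule integral_dominated_convergence[where w="\<lambda>z. std_normal_density z * C"])
      show "AE z in lborel. (\<lambda>n. std_normal_density z *\<^sub>R g (\<xi> + 1 / real (Suc n) * z)) \<longlonglongrightarrow> std_normal_density z *\<^sub>R g \<xi>"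
      proof (intro AE_I2 tendsto_intros)
        fix z
        have "(\<lambda>n. \<xi> + 1 / real (Suc n) * z) \<longlonglongrightarrow> \<xi> + 0 * z"
          by (intro tendsto_intros LIMSEQ_Suc[OF lim_const_over_n])
        then have "(\<lambda>n. \<xi> + 1 / real (Suc n) * z) \<longlonglongrightarrow> \<xi>" by simp
        moreover have "isCont g \<xi>" using g(2) by (simp add: continuous_on_eq_continuous_at)
        ultimately show "(\<lambda>n. g (\<xi> + 1 / real (Suc n) * z)) \<longlonglongrightarrow> g \<xi>"
          by (rule isCont_tendsto_compose[rotated])
      qed
    qed (auto intro!: mult_left_mono g(3))
    moreover have "(LINT z|lborel. std_normal_density z *\<^sub>R g \<xi>) = g \<xi>"
      by simp
    ultimately show ?thesis unfolding J by (intro tendsto_mult tendsto_const) simp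
  qed
  ultimately have "(LINT x|lborel. ft g x * (1 * cis (\<xi> * x))) = complex_of_real (2 * pi) * g \<xi>"
    by (rule LIMSEQ_unique)
  moreover have "ft (\<lambda>x. ft g (- x)) \<xi> = (LINT x|lborel. ft g x * (1 * cis (\<xi> * x)))"
    unfolding ft_reflect by (simp add: ft_def[of "ft g"] mult.commute)
  ultimately show ?thesis by simp
qed

section \<open>Derivative, decay and inversion for transforms of test functions\<close>

lemma integral_derivative_compact_support:
  fixes F :: "real \<Rightarrow> 'a::euclidean_space"
  assumes F: "\<And>x. (F has_vector_derivative F' x) (at x)" "continuous_on UNIV F'"
    and supp: "\<And>x. R < \<bar>x\<bar> \<Longrightarrow> F x = 0" "\<And>x. R < \<bar>x\<bar> \<Longrightarrow> F' x = 0"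
  shows "(LINT x|lborel. F' x) = 0"
proof -
  \<comment> \<open>One unit beyond |R|, so that F vanishes at both ends.\<close>
  define S where "S = \<bar>R\<bar> + 1"
  have "(LINT x|lborel. indicator {-S..S} x *\<^sub>R F' x) = F S - F (- S)"
    by (rule integral_FTC_atLeastAtMost)
       (auto simp: S_def intro: F(1) has_vector_derivative_at_within continuous_on_subset[OF F(2)])
  also have "\<dots> = 0" using supp(1)[of S] supp(1)[of "- S"] by (simp add: S_def)
  also have "(LINT x|lborel. indicator {-S..S} x *\<^sub>R F' x) = (LINT x|lborel. F' x)"
    by (intro Bochner_Integration.integral_cong refl) (auto simp: indicator_def S_def intro!: supp(2))
  finally show ?thesis .
qed

lemma FT_deriv: assumes \<psi>: "test_fun \<psi>"
  shows "FT (deriv \<psi>) \<xi> = \<i> * complex_of_real \<xi> * FT \<psi> \<xi>"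
proof -
  obtain R1 where R1: "R1 > 0" "\<And>x. R1 < \<bar>x\<bar> \<Longrightarrow> \<psi> x = 0" using test_fun_support[OF \<psi>] by blast
  obtain R2 where R2: "R2 > 0" "\<And>x. R2 < \<bar>x\<bar> \<Longrightarrow> deriv \<psi> x = 0"
    using test_fun_support[OF test_fun_deriv[OF \<psi>]] by blast
  let ?F = "\<lambda>x. complex_of_real (\<psi> x) * cis (- (x * \<xi>))"
  let ?F' = "\<lambda>x. complex_of_real (deriv \<psi> x) * cis (- (x * \<xi>)) - \<i> * complex_of_real \<xi> * (complex_of_real (\<psi> x) * cis (- (x * \<xi>)))"
  have i: "integrable lborel (\<lambda>x. complex_of_real (\<psi> x) * cis (- (x * \<xi>)))"
     "integrable lborel (\<lambda>x. complex_of_real (deriv \<psi> x) * cis (- (x * \<xi>)))"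
    using test_fun_integrable[OF \<psi>] test_fun_integrable[OF test_fun_deriv[OF \<psi>]]
    by (auto intro!: integrable_cis_mult)
  have "(LINT x|lborel. ?F' x) = 0"
  proof (rule integral_derivative_compact_support)
    fix x
    have "((\<lambda>x. complex_of_real (\<psi> x)) has_vector_derivative complex_of_real (deriv \<psi> x)) (at x)"
      using smooth_DERIV[OF test_fun_smooth[OF \<psi>], of x]
      by (intro has_vector_derivative_of_real) (simp add: has_real_derivative_iff_has_vector_derivative)
    moreover have "((\<lambda>x. cis (- (x * \<xi>))) has_vector_derivative (- \<xi>) *\<^sub>R (\<i> * cis (- (x * \<xi>)))) (at x)"
    proof -
      have "((\<lambda>x. exp (of_real x * (- \<i> * complex_of_real \<xi>))) has_vector_derivative
         exp (of_real x * (- \<i> * complex_of_real \<xi>)) * (- \<i> * complex_of_real \<xi>)) (at x)"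
        by (auto intro!: derivative_eq_intros has_vector_derivative_real_field)
      then show ?thesis by (simp add: cis_conv_exp scaleR_conv_of_real mult_ac)
    qed
    ultimately have "(?F has_vector_derivative
       complex_of_real (\<psi> x) * ((- \<xi>) *\<^sub>R (\<i> * cis (- (x * \<xi>)))) + complex_of_real (deriv \<psi> x) * cis (- (x * \<xi>))) (at x)"
      by (rule has_vector_derivative_mult)
    then show "(?F has_vector_derivative ?F' x) (at x)"
      by (simp add: scaleR_conv_of_real mult_ac)
    show "continuous_on UNIV ?F'"
      by (intro continuous_intros smooth_continuous_on smooth_deriv test_fun_smooth \<psi>)
    show "?F x = 0" "?F' x = 0" if "max R1 R2 < \<bar>x\<bar>" for x
      using that R1 R2 by auto
  qed
  then have "FT (deriv \<psi>) \<xi> - \<i> * complex_of_real \<xi> * FT \<psi> \<xi> = 0"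
    unfolding FT_def using i by (subst (asm) Bochner_Integration.integral_diff) auto
  then show ?thesis by simp
qed

lemma FT_measurable [measurable_dest]: "test_fun \<psi> \<Longrightarrow> FT \<psi> \<in> borel_measurable borel"
  unfolding FT_eq_ft by (intro ft_measurable measurable_compose[OF test_fun_measurable borel_measurable_of_real]) simp_all

lemma FT_bounded: obtains C where "\<And>\<xi>. cmod (FT \<psi> \<xi>) \<le> C"
  using ft_norm_le unfolding FT_eq_ft by blast

text \<open>Two derivatives turn into the factor \<xi>^2, and transforms are bounded. The decay
  makes \<open>FT \<psi>\<close> integrable, as inversion requires.\<close>

lemma FT_decay: assumes \<psi>: "test_fun \<psi>"
  obtains C where "C > 0" "\<And>\<xi>. cmod (FT \<psi> \<xi>) \<le> C * inverse (1 + \<xi>^2)"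
proof -
  obtain C1 where C1: "\<And>\<xi>. cmod (FT \<psi> \<xi>) \<le> C1" using FT_bounded by blast
  obtain C2 where C2: "\<And>\<xi>. cmod (FT (deriv (deriv \<psi>)) \<xi>) \<le> C2" using FT_bounded by blast
  have *: "cmod (FT (deriv (deriv \<psi>)) \<xi>) = \<xi>^2 * cmod (FT \<psi> \<xi>)" for \<xi>
    using FT_deriv[OF \<psi>] FT_deriv[OF test_fun_deriv[OF \<psi>]] by (simp add: norm_mult power2_eq_square)
  have "(1 + \<xi>^2) * cmod (FT \<psi> \<xi>) \<le> \<bar>C1\<bar> + \<bar>C2\<bar> + 1" for \<xi>
    using C1[of \<xi>] C2[of \<xi>] * [of \<xi>] by (simp add: distrib_right)
  then have "cmod (FT \<psi> \<xi>) \<le> (\<bar>C1\<bar> + \<bar>C2\<bar> + 1) * inverse (1 + \<xi>^2)" for \<xi>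
    by (simp add: inverse_eq_divide pos_le_divide_eq mult.commute add_pos_nonneg)
  then show ?thesis by (intro that[of "\<bar>C1\<bar> + \<bar>C2\<bar> + 1"]) auto
qed

lemma integrable_inverse_square: "integrable lborel (\<lambda>x::real. inverse (1 + x^2))"
  using integrable_inverse_1_plus_square by (simp add: set_integrable_def einterval_def)

lemma FT_integrable: assumes \<psi>: "test_fun \<psi>" shows "integrable lborel (FT \<psi>)" "cL2 (FT \<psi>)"
proof -
  obtain C where C: "C > 0" "\<And>\<xi>. cmod (FT \<psi> \<xi>) \<le> C * inverse (1 + \<xi>^2)" using FT_decay[OF \<psi>] by blast
  have [measurable]: "FT \<psi> \<in> borel_measurable borel" using \<psi> by (rule FT_measurable)
  show "integrable lborel (FT \<psi>)"
  proof (rule Bochner_Integration.integrable_bound)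
    show "integrable lborel (\<lambda>x. C * inverse (1 + x^2))" using integrable_inverse_square by auto
    show "AE x in lborel. cmod (FT \<psi> x) \<le> norm (C * inverse (1 + x^2))"
      using C by (auto intro!: AE_I2 order_trans[OF C(2) abs_ge_self])
  qed auto
  show "cL2 (FT \<psi>)"
    unfolding FT_eq_ft using test_fun_integrable[OF \<psi>] by (intro bessel_L1_L2 cL2_test_fun \<psi>) auto
qed

lemma FT_reflect: "FT (\<lambda>x. \<psi> (- x)) \<xi> = FT \<psi> (- \<xi>)"
  using ft_reflect[of "\<lambda>x. complex_of_real (\<psi> x)"] by (simp add: FT_eq_ft)

lemma FT_cnj: "cnj (FT \<psi> \<xi>) = FT \<psi> (- \<xi>)"
  using ft_cnj[of "\<lambda>x. complex_of_real (\<psi> x)" "- \<xi>"] by (simp add: FT_eq_ft)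

lemma FT_inversion: assumes \<psi>: "test_fun \<psi>"
  shows "ft (\<lambda>x. FT \<psi> (- x)) \<xi> = complex_of_real (2 * pi * \<psi> \<xi>)"
proof -
  obtain C where C: "\<And>x. \<bar>\<psi> x\<bar> \<le> C" using test_fun_bounded[OF \<psi>] by blast
  have "ft (\<lambda>x. ft (\<lambda>x. complex_of_real (\<psi> x)) (- x)) \<xi> = complex_of_real (2 * pi) * complex_of_real (\<psi> \<xi>)"
  proof (rule ft_inversion)
    show "integrable lborel (\<lambda>x. complex_of_real (\<psi> x))" using test_fun_integrable[OF \<psi>] by simp
    show "continuous_on UNIV (\<lambda>x. complex_of_real (\<psi> x))"
      by (intro continuous_intros smooth_continuous_on test_fun_smooth \<psi>)
    show "cmod (complex_of_real (\<psi> x)) \<le> C" for x using C by simp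
    show "integrable lborel (ft (\<lambda>x. complex_of_real (\<psi> x)))" using FT_integrable(1)[OF \<psi>] by (simp add: FT_eq_ft)
  qed
  then show ?thesis by (simp add: FT_eq_ft)
qed

section \<open>Extension of the transform to L^2\<close>

text \<open>Truncations of u are in L^1 and L^2; \<open>bessel_L1_L2\<close> makes their transforms
  a Cauchy sequence, and duality passes to the limit. It then holds for all g in L^1 and L^2, not
  only for test functions, which later gives access to pairings with \<open>FT \<psi>\<close>. The
  constant is 4\<pi> instead of 2\<pi> because of the factor 2 in
  \<open>sqnorm_add_le\<close>.\<close>

lemma L2_fourier_exists:
  assumes u: "cL2 u"
  shows "\<exists>U. cL2 U \<and> sqnorm U \<le> 4 * pi * sqnorm u \<and>
    (\<forall>g. integrable lborel g \<longrightarrow> cL2 g \<longrightarrow> (LINT \<xi>|lborel. U \<xi> * g \<xi>) = (LINT x|lborel. u x * ft g x))"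
proof -
  define s where "s n = ft (trunc (real n) u)" for n
  have ti: "integrable lborel (trunc (real n) u)" for n by (rule trunc_integrable[OF u])
  have tc: "cL2 (trunc (real n) u)" for n by (rule cL2_trunc[OF u])
  have sc: "cL2 (s n)" for n unfolding s_def by (rule bessel_L1_L2[OF ti tc])
  have sdiff: "sqnorm (\<lambda>x. s m x - s n x) \<le> 2 * pi * sqnorm (\<lambda>x. trunc (real m) u x - trunc (real n) u x)" for m n
  proof -
    have "(\<lambda>x. s m x - s n x) = ft (\<lambda>x. trunc (real m) u x - trunc (real n) u x)"
      unfolding s_def by (rule ext) (simp add: ft_diff ti)
    then show ?thesis using bessel_L1_L2(2)[OF Bochner_Integration.integrable_diff[OF ti ti] cL2_diff[OF tc tc]] by simp
  qed
  have tr: "sqnorm (\<lambda>x. trunc (real m) u x - trunc (real n) u x)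
      \<le> 2 * sqnorm (\<lambda>x. trunc (real m) u x - u x) + 2 * sqnorm (\<lambda>x. trunc (real n) u x - u x)" for m n
    using sqnorm_add_le[OF cL2_diff[OF tc[of m] u] cL2_diff[OF u tc[of n]]] sqnorm_diff_commute[of u "trunc (real n) u"] by simp
  have "\<exists>U. cL2 U \<and> (\<lambda>n. sqnorm (\<lambda>x. s n x - U x)) \<longlonglongrightarrow> 0"
  proof (rule cL2_complete)
    fix e :: real assume e: "e > 0"
    \<comment> \<open>The constant 8\<pi> is fixed by 2\<pi> (2 + 2) e/(8\<pi>) = e.\<close>
    from LIMSEQ_D[OF trunc_tendsto[OF u], of "e / (8 * pi)"] e
    obtain N where N: "\<And>n. n \<ge> N \<Longrightarrow> sqnorm (\<lambda>x. trunc (real n) u x - u x) < e / (8 * pi)" by auto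
    show "\<exists>N. \<forall>m\<ge>N. \<forall>n\<ge>N. sqnorm (\<lambda>x. s m x - s n x) < e"
    proof (intro exI allI impI)
      fix m n assume mn: "m \<ge> N" "n \<ge> N"
      have "sqnorm (\<lambda>x. s m x - s n x) \<le> 2 * pi * (2 * sqnorm (\<lambda>x. trunc (real m) u x - u x) + 2 * sqnorm (\<lambda>x. trunc (real n) u x - u x))"
        by (rule order_trans[OF sdiff mult_left_mono[OF tr]]) simp
      also have "\<dots> < 2 * pi * (2 * (e / (8 * pi)) + 2 * (e / (8 * pi)))"
        using N[OF mn(1)] N[OF mn(2)] by (intro mult_strict_left_mono) auto
      finally show "sqnorm (\<lambda>x. s m x - s n x) < e" by simp
    qed
  qed (rule sc)
  then obtain U where U: "cL2 U" "(\<lambda>n. sqnorm (\<lambda>x. s n x - U x)) \<longlonglongrightarrow> 0" by blast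
  have "sqnorm U \<le> 4 * pi * sqnorm u"
  proof (rule LIMSEQ_le_const)
    have "(\<lambda>n. 2 * sqnorm (\<lambda>x. s n x - U x) + 4 * pi * sqnorm u) \<longlonglongrightarrow> 2 * 0 + 4 * pi * sqnorm u"
      by (intro tendsto_intros U)
    then show "(\<lambda>n. 2 * sqnorm (\<lambda>x. s n x - U x) + 4 * pi * sqnorm u) \<longlonglongrightarrow> 4 * pi * sqnorm u" by simp
    have "sqnorm U \<le> 2 * sqnorm (\<lambda>x. s n x - U x) + 4 * pi * sqnorm u" for n
    proof -
      have "sqnorm U \<le> 2 * sqnorm (\<lambda>x. U x - s n x) + 2 * sqnorm (s n)"
        using sqnorm_add_le[OF cL2_diff[OF U(1) sc[of n]] sc[of n]] by simp
      moreover have "sqnorm (s n) \<le> 2 * pi * sqnorm (trunc (real n) u)"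
        unfolding s_def by (rule bessel_L1_L2[OF ti tc])
      moreover have "sqnorm (trunc (real n) u) \<le> sqnorm u"
        unfolding sqnorm_def using u tc[of n] by (intro integral_mono) (auto simp: cL2_def trunc_def)
      then have "2 * pi * sqnorm (trunc (real n) u) \<le> 2 * pi * sqnorm u" by simp
      ultimately show ?thesis using sqnorm_diff_commute[of U "s n"] by linarith
    qed
    then show "\<exists>N. \<forall>n\<ge>N. sqnorm U \<le> 2 * sqnorm (\<lambda>x. s n x - U x) + 4 * pi * sqnorm u" by blast
  qed
  moreover have "(LINT \<xi>|lborel. U \<xi> * g \<xi>) = (LINT x|lborel. u x * ft g x)"
    if g: "integrable lborel g" "cL2 g" for g
  proof (rule LIMSEQ_unique)
    show "(\<lambda>n. LINT \<xi>|lborel. s n \<xi> * g \<xi>) \<longlonglongrightarrow> (LINT \<xi>|lborel. U \<xi> * g \<xi>)"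
      by (rule cL2_pairing_tendsto[OF sc U(1) g(2) U(2)])
    have "(LINT \<xi>|lborel. s n \<xi> * g \<xi>) = (LINT x|lborel. trunc (real n) u x * ft g x)" for n
      unfolding s_def by (rule ft_duality[OF ti g(1)])
    then show "(\<lambda>n. LINT \<xi>|lborel. s n \<xi> * g \<xi>) \<longlonglongrightarrow> (LINT x|lborel. u x * ft g x)"
      using cL2_pairing_tendsto[OF tc u bessel_L1_L2(1)[OF g] trunc_tendsto[OF u]] by simp
  qed
  ultimately show ?thesis using U(1) by blast
qed

section \<open>The Plancherel transform by duality\<close>

abbreviation cx :: "(real \<Rightarrow> real) \<Rightarrow> real \<Rightarrow> complex" where
  "cx u \<equiv> (\<lambda>x. complex_of_real (u x))"

lemma cL2_cx_iff: "cL2 (cx u) \<longleftrightarrow> L2 u"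
  by (auto simp: cL2_def L2_def borel_measurable_complex_iff)

lemma is_fourier_iff: "is_fourier u U \<longleftrightarrow> cL2 (cx u) \<and> cL2 U \<and>
    (\<forall>\<psi>. test_fun \<psi> \<longrightarrow> (LINT \<xi>|lborel. U \<xi> * cx \<psi> \<xi>) = (LINT x|lborel. cx u x * FT \<psi> x))"
  unfolding is_fourier_def cL2_cx_iff by (auto simp: cL2_def)

lemma is_fourierD:
  assumes "is_fourier u U" shows "cL2 (cx u)" "cL2 U" "L2 u" "U \<in> borel_measurable borel" "u \<in> borel_measurable borel"
    "test_fun \<psi> \<Longrightarrow> (LINT \<xi>|lborel. U \<xi> * cx \<psi> \<xi>) = (LINT x|lborel. cx u x * FT \<psi> x)"
  using assms cL2_cx_iff[of u] unfolding is_fourier_iff by (auto simp: cL2_def L2_def)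

lemma sqnorm_cong_AE:
  assumes "U \<in> borel_measurable borel" "V \<in> borel_measurable borel" "AE x in lborel. U x = V x"
  shows "sqnorm U = sqnorm V"
  unfolding sqnorm_def using assms by (intro integral_cong_AE) auto

lemma cL2_cong_AE:
  assumes "cL2 U" "V \<in> borel_measurable borel" "AE x in lborel. U x = V x"
  shows "cL2 V"
  using assms unfolding cL2_def
  by (auto elim!: Bochner_Integration.integrable_cong_AE[THEN iffD1, rotated 3] intro: AE_mp)

lemma is_fourier_exists: assumes "L2 u"
  shows "\<exists>U. is_fourier u U"
proof -
  have u: "cL2 (cx u)" using assms cL2_cx_iff by blast
  from L2_fourier_exists[OF u] obtain U where U: "cL2 U"
    "\<And>g. integrable lborel g \<Longrightarrow> cL2 g \<Longrightarrow> (LINT \<xi>|lborel. U \<xi> * g \<xi>) = (LINT x|lborel. cx u x * ft g x)" by blast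
  then show ?thesis unfolding is_fourier_iff using u
    by (auto simp: FT_eq_ft intro!: exI[of _ U] U(2) test_fun_integrable cL2_test_fun)
qed

lemma is_fourier_unique: assumes "is_fourier u U" "is_fourier u V"
  shows "AE \<xi> in lborel. U \<xi> = V \<xi>"
proof -
  have "AE \<xi> in lborel. U \<xi> - V \<xi> = 0"
  proof (rule cL2_test_zero)
    fix \<psi> assume \<psi>: "test_fun \<psi>"
    have "(LINT x|lborel. (U x - V x) * cx \<psi> x) = (LINT x|lborel. U x * cx \<psi> x) - (LINT x|lborel. V x * cx \<psi> x)"
      unfolding left_diff_distrib
      by (intro Bochner_Integration.integral_diff cL2_mult_integrable cL2_test_fun \<psi> is_fourierD(2)[OF assms(1)] is_fourierD(2)[OF assms(2)])
    then show "(LINT x|lborel. (U x - V x) * cx \<psi> x) = 0"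
      using is_fourierD(6)[OF assms(1) \<psi>] is_fourierD(6)[OF assms(2) \<psi>] by simp
  qed (intro cL2_diff is_fourierD(2)[OF assms(1)] is_fourierD(2)[OF assms(2)])
  then show ?thesis by simp
qed

lemma is_fourier_cong_AE:
  assumes "is_fourier u U" "AE \<xi> in lborel. U \<xi> = V \<xi>" "V \<in> borel_measurable borel"
  shows "is_fourier u V"
proof -
  note [measurable] = is_fourierD(4)[OF assms(1)] assms(3)
  have "(LINT \<xi>|lborel. V \<xi> * cx \<psi> \<xi>) = (LINT \<xi>|lborel. U \<xi> * cx \<psi> \<xi>)" if "test_fun \<psi>" for \<psi>
  proof -
    have [measurable]: "\<psi> \<in> borel_measurable borel" using that by (rule test_fun_measurable)
    show ?thesis by (intro integral_cong_AE) (use assms(2) in \<open>auto elim: AE_mp\<close>)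
  qed
  then show ?thesis
    using assms cL2_cong_AE[OF is_fourierD(2)[OF assms(1)] assms(3,2)] unfolding is_fourier_iff by simp
qed

lemma is_fourier_cong_AE_fst:
  assumes "is_fourier u U" "AE x in lborel. u x = v x" "v \<in> borel_measurable borel"
  shows "is_fourier v U"
proof -
  note [measurable] = is_fourierD(5)[OF assms(1)] assms(3)
  have "(LINT x|lborel. cx v x * FT \<psi> x) = (LINT x|lborel. cx u x * FT \<psi> x)" if "test_fun \<psi>" for \<psi>
  proof -
    have [measurable]: "FT \<psi> \<in> borel_measurable borel" using that by (rule FT_measurable)
    show ?thesis by (intro integral_cong_AE) (use assms(2) in \<open>auto elim: AE_mp\<close>)
  qed
  moreover have "cL2 (cx v)"
    by (rule cL2_cong_AE[OF is_fourierD(1)[OF assms(1)]]) (use assms in \<open>auto elim: AE_mp\<close>)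
  ultimately show ?thesis
    using assms(1) unfolding is_fourier_iff by simp
qed

lemma FT_reflected_L1_L2: assumes "test_fun \<psi>"
  shows "integrable lborel (\<lambda>\<xi>. FT \<psi> (- \<xi>))" "cL2 (\<lambda>\<xi>. FT \<psi> (- \<xi>))"
  using FT_integrable[OF test_fun_reflect[OF assms]] unfolding FT_reflect[abs_def] by auto

text \<open>Injectivity, obtained by applying the transform twice: the hypothesis says that the
  transform K of H annihilates test functions, so K = 0; pairing K with the reflected
  \<open>FT \<psi>\<close>, whose transform is 2\<pi>\<psi>, returns the pairings of H with test
  functions.\<close>

lemma cL2_FT_zero:
  assumes H: "cL2 H" and 0: "\<And>\<psi>. test_fun \<psi> \<Longrightarrow> (LINT x|lborel. H x * FT \<psi> x) = 0"
  shows "AE x in lborel. H x = 0"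
proof -
  from L2_fourier_exists[OF H] obtain K where K: "cL2 K"
    "\<And>g. integrable lborel g \<Longrightarrow> cL2 g \<Longrightarrow> (LINT \<xi>|lborel. K \<xi> * g \<xi>) = (LINT x|lborel. H x * ft g x)" by blast
  have [measurable]: "K \<in> borel_measurable borel" using K by (simp add: cL2_def)
  have K0: "AE x in lborel. K x = 0"
    by (rule cL2_test_zero[OF K(1)])
       (use 0 K(2)[OF _ cL2_test_fun] test_fun_integrable in \<open>auto simp: FT_eq_ft\<close>)
  show ?thesis
  proof (rule cL2_test_zero[OF H])
    fix \<psi> assume \<psi>: "test_fun \<psi>"
    note [measurable] = FT_measurable[OF \<psi>]
    have "complex_of_real (2 * pi) * (LINT x|lborel. H x * cx \<psi> x) = (LINT x|lborel. complex_of_real (2 * pi) * (H x * cx \<psi> x))"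
      by simp
    also have "\<dots> = (LINT x|lborel. H x * ft (\<lambda>\<xi>. FT \<psi> (- \<xi>)) x)"
      by (intro Bochner_Integration.integral_cong refl) (simp add: FT_inversion[OF \<psi>])
    also have "\<dots> = (LINT \<xi>|lborel. K \<xi> * FT \<psi> (- \<xi>))"
      by (rule K(2)[symmetric]) (intro FT_reflected_L1_L2 \<psi>)+
    also have "\<dots> = (LINT \<xi>::real|lborel. 0)"
      by (intro integral_cong_AE) (use K0 in \<open>auto elim: AE_mp\<close>)
    finally show "(LINT x|lborel. H x * cx \<psi> x) = 0" by simp
  qed
qed

lemma is_fourier_unique_fst: assumes "is_fourier u U" "is_fourier v U"
  shows "AE x in lborel. u x = v x"
proof -
  have "AE x in lborel. cx u x - cx v x = 0"
  proof (rule cL2_FT_zero)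
    fix \<psi> assume \<psi>: "test_fun \<psi>"
    have "(LINT x|lborel. (cx u x - cx v x) * FT \<psi> x) = (LINT x|lborel. cx u x * FT \<psi> x) - (LINT x|lborel. cx v x * FT \<psi> x)"
      unfolding left_diff_distrib
      by (intro Bochner_Integration.integral_diff cL2_mult_integrable FT_integrable \<psi> is_fourierD(1)[OF assms(1)] is_fourierD(1)[OF assms(2)])
    then show "(LINT x|lborel. (cx u x - cx v x) * FT \<psi> x) = 0"
      using is_fourierD(6)[OF assms(1) \<psi>] is_fourierD(6)[OF assms(2) \<psi>] by simp
  qed (intro cL2_diff is_fourierD(1)[OF assms(1)] is_fourierD(1)[OF assms(2)])
  then show ?thesis by simp
qed

lemma integral_reflect: fixes f :: "real \<Rightarrow> complex" shows "(LINT x|lborel. f (- x)) = (LINT x|lborel. f x)"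
  using lborel_integral_real_affine[of "-1" f 0] by simp

section \<open>Parseval's identity, inversion and the Plancherel bound\<close>

text \<open>\<open>FT \<psi>\<close> is in general no test function, so the defining duality does
  not reach it. But U agrees almost everywhere with the limit from \<open>L2_fourier_exists\<close>,
  which may be paired with it.\<close>

lemma is_fourier_parseval: assumes u: "is_fourier u U" and \<psi>: "test_fun \<psi>"
  shows "(LINT \<xi>|lborel. U \<xi> * FT \<psi> (- \<xi>)) = complex_of_real (2 * pi * (LINT x|lborel. u x * \<psi> x))"
proof -
  from L2_fourier_exists[OF is_fourierD(1)[OF u]] obtain K where K: "cL2 K"
    "\<And>g. integrable lborel g \<Longrightarrow> cL2 g \<Longrightarrow> (LINT \<xi>|lborel. K \<xi> * g \<xi>) = (LINT x|lborel. cx u x * ft g x)" by blast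
  have "is_fourier u K"
    unfolding is_fourier_iff using K is_fourierD(1)[OF u]
    by (auto simp: FT_eq_ft intro!: K(2) test_fun_integrable cL2_test_fun)
  from is_fourier_unique[OF u this] have UK: "AE \<xi> in lborel. U \<xi> = K \<xi>" .
  note [measurable] = is_fourierD(4)[OF u] cL2_meas[OF K(1)] FT_measurable[OF \<psi>]
  have "(LINT \<xi>|lborel. U \<xi> * FT \<psi> (- \<xi>)) = (LINT \<xi>|lborel. K \<xi> * FT \<psi> (- \<xi>))"
    by (intro integral_cong_AE) (use UK in \<open>auto elim: AE_mp\<close>)
  also have "\<dots> = (LINT x|lborel. cx u x * ft (\<lambda>\<xi>. FT \<psi> (- \<xi>)) x)"
    by (rule K(2)) (intro FT_reflected_L1_L2 \<psi>)+
  also have "\<dots> = (LINT x|lborel. complex_of_real (2 * pi * (u x * \<psi> x)))"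
    by (intro Bochner_Integration.integral_cong refl) (simp add: FT_inversion[OF \<psi>])
  also have "\<dots> = complex_of_real (LINT x|lborel. 2 * pi * (u x * \<psi> x))"
    by (rule integral_complex_of_real)
  finally show ?thesis by simp
qed

text \<open>The reflected conjugate of U satisfies the same duality because u is real. The symmetry
  matters because \<open>is_fourier\<close> speaks of real functions: only Hermitian data can be
  transformed back.\<close>

lemma is_fourier_hermitian: assumes "is_fourier u U"
  shows "AE \<xi> in lborel. U (- \<xi>) = cnj (U \<xi>)"
proof -
  have "is_fourier u (\<lambda>\<xi>. cnj (U (- \<xi>)))"
    unfolding is_fourier_iff
  proof (intro conjI allI impI)
    fix \<psi> assume \<psi>: "test_fun \<psi>"
    have "(LINT \<xi>|lborel. cnj (U (- \<xi>)) * cx \<psi> \<xi>) = (LINT \<xi>|lborel. cnj (U \<xi> * cx \<psi> (- \<xi>)))"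
      by (subst integral_reflect[symmetric]) simp
    also have "\<dots> = cnj (LINT \<xi>|lborel. U \<xi> * cx (\<lambda>x. \<psi> (- x)) \<xi>)"
      by (rule Bochner_Integration.integral_cnj)
    also have "\<dots> = cnj (LINT x|lborel. cx u x * FT (\<lambda>x. \<psi> (- x)) x)"
      using is_fourierD(6)[OF assms test_fun_reflect[OF \<psi>]] by simp
    also have "\<dots> = (LINT x|lborel. cnj (cx u x * FT (\<lambda>x. \<psi> (- x)) x))"
      by (rule Bochner_Integration.integral_cnj[symmetric])
    also have "\<dots> = (LINT x|lborel. cx u x * FT \<psi> x)"
      by (simp add: FT_reflect FT_cnj)
    finally show "(LINT \<xi>|lborel. cnj (U (- \<xi>)) * cx \<psi> \<xi>) = (LINT x|lborel. cx u x * FT \<psi> x)" .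
  qed (intro cL2_cnj cL2_reflect is_fourierD[OF assms])+
  from is_fourier_unique[OF assms this] show ?thesis by eventually_elim simp
qed

text \<open>The inverse is the reflected forward transform divided by 2\<pi>. Hermitian symmetry
  makes its pairings with test functions equal to those of its conjugate, so it is real almost
  everywhere and its real part is the function sought.\<close>

lemma is_fourier_inverse:
  assumes H: "cL2 H" and herm: "AE \<xi> in lborel. H (- \<xi>) = cnj (H \<xi>)"
  shows "\<exists>h. is_fourier h H \<and> sqnorm (cx h) \<le> sqnorm H"
proof -
  from L2_fourier_exists[OF H] obtain K where K: "cL2 K" "sqnorm K \<le> 4 * pi * sqnorm H"
    "\<And>g. integrable lborel g \<Longrightarrow> cL2 g \<Longrightarrow> (LINT \<xi>|lborel. K \<xi> * g \<xi>) = (LINT x|lborel. H x * ft g x)" by blast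
  define h0 where "h0 x = complex_of_real (1 / (2 * pi)) * K (- x)" for x
  have h0: "cL2 h0" unfolding h0_def by (intro cL2_cmult cL2_reflect K)
  note [measurable] = cL2_meas[OF H] cL2_meas[OF K(1)] cL2_meas[OF h0]
  have dual: "(LINT x|lborel. h0 x * g x) = complex_of_real (1 / (2 * pi)) * (LINT x|lborel. H x * ft (\<lambda>x. g (- x)) x)"
    if "integrable lborel (\<lambda>x. g (- x))" "cL2 (\<lambda>x. g (- x))" for g
  proof -
    have "(LINT x|lborel. h0 x * g x) = (LINT x|lborel. complex_of_real (1 / (2 * pi)) * (K x * g (- x)))"
      by (subst integral_reflect[symmetric]) (simp add: h0_def mult.assoc)
    also have "\<dots> = complex_of_real (1 / (2 * pi)) * (LINT x|lborel. K x * g (- x))"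
      by (rule Bochner_Integration.integral_mult_right_zero)
    finally show ?thesis using K(3)[OF that] by simp
  qed
  have "AE x in lborel. h0 x - cnj (h0 x) = 0"
  proof (rule cL2_test_zero)
    fix \<psi> assume \<psi>: "test_fun \<psi>"
    note [measurable] = FT_measurable[OF \<psi>]
    have 1: "(LINT x|lborel. h0 x * cx \<psi> x) = complex_of_real (1 / (2 * pi)) * (LINT x|lborel. H x * FT \<psi> (- x))"
      using test_fun_integrable[OF test_fun_reflect[OF \<psi>]] cL2_test_fun[OF test_fun_reflect[OF \<psi>]]
      by (subst dual) (auto simp: FT_eq_ft ft_reflect[of "cx \<psi>"])
    have "(LINT x|lborel. cnj (h0 x) * cx \<psi> x) = cnj (LINT x|lborel. h0 x * cx \<psi> x)"
      by (subst Bochner_Integration.integral_cnj[symmetric]) simp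
    also have "\<dots> = complex_of_real (1 / (2 * pi)) * cnj (LINT x|lborel. H x * FT \<psi> (- x))"
      unfolding 1 by simp
    also have "cnj (LINT x|lborel. H x * FT \<psi> (- x)) = (LINT x|lborel. cnj (H x) * FT \<psi> x)"
      by (subst Bochner_Integration.integral_cnj[symmetric]) (simp add: FT_cnj)
    also have "\<dots> = (LINT x|lborel. H (- x) * FT \<psi> x)"
      by (intro integral_cong_AE) (use herm in \<open>auto elim: AE_mp\<close>)
    also have "\<dots> = (LINT x|lborel. H x * FT \<psi> (- x))"
      by (subst integral_reflect[symmetric]) simp
    finally have "(LINT x|lborel. cnj (h0 x) * cx \<psi> x) = (LINT x|lborel. h0 x * cx \<psi> x)"
      unfolding 1 .
    then show "(LINT x|lborel. (h0 x - cnj (h0 x)) * cx \<psi> x) = 0"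
      unfolding left_diff_distrib
      by (subst Bochner_Integration.integral_diff) (auto intro!: cL2_mult_integrable cL2_test_fun \<psi> h0 cL2_cnj)
  qed (intro cL2_diff cL2_cnj h0)
  then have real: "AE x in lborel. h0 x = cx (\<lambda>x. Re (h0 x)) x"
    by eventually_elim (simp add: complex_eq_iff)
  have cs: "cL2 (cx (\<lambda>x. Re (h0 x)))"
    by (rule cL2_cong_AE[OF h0 _ real]) simp
  have "is_fourier (\<lambda>x. Re (h0 x)) H"
    unfolding is_fourier_iff
  proof (intro conjI allI impI cs H)
    fix \<psi> assume \<psi>: "test_fun \<psi>"
    note [measurable] = FT_measurable[OF \<psi>]
    have "(LINT x|lborel. cx (\<lambda>x. Re (h0 x)) x * FT \<psi> x) = (LINT x|lborel. h0 x * FT \<psi> x)"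
      by (intro integral_cong_AE) (use real in \<open>auto elim: AE_mp\<close>)
    also have "\<dots> = complex_of_real (1 / (2 * pi)) * (LINT x|lborel. H x * ft (\<lambda>x. FT \<psi> (- x)) x)"
      by (rule dual[OF FT_reflected_L1_L2[OF \<psi>]])
    also have "\<dots> = (LINT x|lborel. complex_of_real (1 / (2 * pi)) * (H x * ft (\<lambda>x. FT \<psi> (- x)) x))"
      by simp
    also have "\<dots> = (LINT x|lborel. H x * cx \<psi> x)"
      by (intro Bochner_Integration.integral_cong refl) (simp add: FT_inversion[OF \<psi>])
    finally show "(LINT x|lborel. H x * cx \<psi> x) = (LINT x|lborel. cx (\<lambda>x. Re (h0 x)) x * FT \<psi> x)" ..
  qed
  moreover have "sqnorm (cx (\<lambda>x. Re (h0 x))) \<le> sqnorm H"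
  proof -
    have "sqnorm (cx (\<lambda>x. Re (h0 x))) = sqnorm h0"
      by (rule sqnorm_cong_AE) (use real in \<open>auto elim: AE_mp\<close>)
    also have "\<dots> = (1 / (2 * pi))^2 * sqnorm (\<lambda>x. K (- x))"
      unfolding sqnorm_def h0_def by (simp add: norm_mult norm_divide power_mult_distrib power_divide)
    also have "\<dots> \<le> (1 / (2 * pi))^2 * (4 * pi * sqnorm H)"
      unfolding sqnorm_reflect by (intro mult_left_mono K) auto
    \<comment> \<open>Here (1/(2\<pi>))^2 4\<pi> = 1/\<pi>, which is then rounded up to 1.\<close>
    also have "\<dots> = sqnorm H / pi" by (simp add: power2_eq_square)
    also have "\<dots> \<le> sqnorm H" using pi_ge_two mult_left_mono[of 1 pi "sqnorm H"] by (simp add: divide_le_eq)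
    finally show ?thesis .
  qed
  ultimately show ?thesis by blast
qed

text \<open>The bound that comes with the construction of the inverse passes to u, which coincides
  with that inverse almost everywhere.\<close>

lemma is_fourier_plancherel_le: assumes "is_fourier u U" shows "sqnorm (cx u) \<le> sqnorm U"
proof -
  obtain h where h: "is_fourier h U" "sqnorm (cx h) \<le> sqnorm U"
    using is_fourier_inverse[OF is_fourierD(2)[OF assms] is_fourier_hermitian[OF assms]] by blast
  have "sqnorm (cx u) = sqnorm (cx h)"
    using is_fourier_unique_fst[OF assms h(1)] is_fourierD(5)[OF assms] is_fourierD(5)[OF h(1)]
    by (intro sqnorm_cong_AE) (auto elim: AE_mp)
  with h(2) show ?thesis by simp
qed

lemma is_fourier_lincomb: assumes u: "is_fourier u U" and v: "is_fourier v V"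
  shows "is_fourier (\<lambda>x. a * u x + b * v x) (\<lambda>\<xi>. complex_of_real a * U \<xi> + complex_of_real b * V \<xi>)"
  unfolding is_fourier_iff
proof (intro conjI allI impI)
  show "cL2 (cx (\<lambda>x. a * u x + b * v x))"
    using cL2_add[OF cL2_cmult[OF is_fourierD(1)[OF u], of "of_real a"] cL2_cmult[OF is_fourierD(1)[OF v], of "of_real b"]] by simp
  show "cL2 (\<lambda>\<xi>. complex_of_real a * U \<xi> + complex_of_real b * V \<xi>)"
    by (intro cL2_add cL2_cmult is_fourierD(2)[OF u] is_fourierD(2)[OF v])
  fix \<psi> assume \<psi>: "test_fun \<psi>"
  have iU: "integrable lborel (\<lambda>\<xi>. U \<xi> * cx \<psi> \<xi>)" "integrable lborel (\<lambda>\<xi>. V \<xi> * cx \<psi> \<xi>)"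
     "integrable lborel (\<lambda>x. cx u x * FT \<psi> x)" "integrable lborel (\<lambda>x. cx v x * FT \<psi> x)"
    by (intro cL2_mult_integrable cL2_test_fun \<psi> FT_integrable is_fourierD(1,2)[OF u] is_fourierD(1,2)[OF v])+
  have "(LINT \<xi>|lborel. (complex_of_real a * U \<xi> + complex_of_real b * V \<xi>) * cx \<psi> \<xi>)
     = (LINT \<xi>|lborel. complex_of_real a * (U \<xi> * cx \<psi> \<xi>) + complex_of_real b * (V \<xi> * cx \<psi> \<xi>))"
    by (simp add: algebra_simps)
  also have "\<dots> = complex_of_real a * (LINT x|lborel. cx u x * FT \<psi> x) + complex_of_real b * (LINT x|lborel. cx v x * FT \<psi> x)"
    using iU is_fourierD(6)[OF u \<psi>] is_fourierD(6)[OF v \<psi>] by simp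
  also have "\<dots> = (LINT x|lborel. complex_of_real a * (cx u x * FT \<psi> x) + complex_of_real b * (cx v x * FT \<psi> x))"
    using iU by simp
  also have "\<dots> = (LINT x|lborel. cx (\<lambda>x. a * u x + b * v x) x * FT \<psi> x)"
    by (simp add: algebra_simps)
  finally show "(LINT \<xi>|lborel. (complex_of_real a * U \<xi> + complex_of_real b * V \<xi>) * cx \<psi> \<xi>)
    = (LINT x|lborel. cx (\<lambda>x. a * u x + b * v x) x * FT \<psi> x)" .
qed

lemma is_fourier_diff: assumes u: "is_fourier u U" and v: "is_fourier v V"
  shows "is_fourier (\<lambda>x. u x - v x) (\<lambda>\<xi>. U \<xi> - V \<xi>)"
  using is_fourier_lincomb[OF u v, of 1 "-1"] by simp

section \<open>Uniqueness for functions that are in L^2 up to quadratic growth\<close>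

lemma smooth_from_derivative:
  assumes "\<And>x. (f has_real_derivative f' x) (at x)" "smooth f'" shows "smooth f"
proof (rule smooth_coinduct[where P="\<lambda>g. g = f \<or> smooth g"])
  fix g assume "g = f \<or> smooth g"
  then show "\<exists>f'. (\<forall>x. (g has_real_derivative f' x) (at x)) \<and> (f' = f \<or> smooth f')"
    using assms smooth_DERIV smooth_deriv by blast
qed simp

text \<open>Convolving a test function with the indicator of \<open>[-1, 1]\<close> multiplies its Fourier
  transform by \<open>2 sin \<xi> / \<xi>\<close>.\<close>
lemma box_smoothing:
  assumes \<psi>: "test_fun \<psi>"
  shows "\<exists>\<eta>. test_fun \<eta> \<and> (\<forall>\<xi>. complex_of_real \<xi> * FT \<eta> \<xi> = complex_of_real (2 * sin \<xi>) * FT \<psi> \<xi>)"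
proof -
  obtain P where P: "\<And>x. (P has_real_derivative \<psi> x) (at x)"
    using einterval_antiderivative[of "-\<infinity>" "\<infinity>" \<psi>] smooth_isCont[OF test_fun_smooth[OF \<psi>]]
    by (auto simp: has_real_derivative_iff_has_vector_derivative)
  obtain R where R: "R > 0" "\<And>x. R < \<bar>x\<bar> \<Longrightarrow> \<psi> x = 0" using test_fun_support[OF \<psi>] by blast
  define \<eta> where "\<eta> x = P (x + 1) - P (x - 1)" for x
  have d: "(\<eta> has_real_derivative \<psi> (x + 1) - \<psi> (x - 1)) (at x)" for x
    unfolding \<eta>_def by (auto intro!: derivative_eq_intros DERIV_chain2[OF P])
  have sh: "test_fun (\<lambda>x. \<psi> (x + 1))" "test_fun (\<lambda>x. \<psi> (x - 1))"
    using test_fun_shift[OF \<psi>, of 1] test_fun_shift[OF \<psi>, of "-1"] by auto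
  have "\<eta> x = 0" if "R + 1 < \<bar>x\<bar>" for x
  proof -
    \<comment> \<open>By the mean value theorem \<eta>(x) is twice a value of \<psi> at distance
      less than 1 from x; this gives compact support.\<close>
    obtain z where "z > x - 1" "z < x + 1" "P (x + 1) - P (x - 1) = (x + 1 - (x - 1)) * \<psi> z"
      using MVT2[of "x - 1" "x + 1" P \<psi>] P by auto
    moreover have "\<psi> z = 0" using calculation that by (intro R) auto
    ultimately show ?thesis by (simp add: \<eta>_def)
  qed
  moreover have "smooth \<eta>"
    by (rule smooth_from_derivative[OF d]) (intro test_fun_smooth test_fun_diff sh)
  ultimately have t: "test_fun \<eta>" unfolding test_fun_iff by blast
  have "complex_of_real \<xi> * FT \<eta> \<xi> = complex_of_real (2 * sin \<xi>) * FT \<psi> \<xi>" for \<xi>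
  proof -
    have "\<i> * complex_of_real \<xi> * FT \<eta> \<xi> = FT (\<lambda>x. \<psi> (x + 1) - \<psi> (x - 1)) \<xi>"
    proof -
      have "deriv \<eta> = (\<lambda>x. \<psi> (x + 1) - \<psi> (x - 1))" using DERIV_imp_deriv[OF d] by (rule ext)
      then show ?thesis using FT_deriv[OF t, of \<xi>] by simp
    qed
    also have "\<dots> = FT (\<lambda>x. \<psi> (x + 1)) \<xi> - FT (\<lambda>x. \<psi> (x - 1)) \<xi>"
      unfolding FT_eq_ft using sh[THEN test_fun_integrable] by (simp add: ft_diff)
    also have "\<dots> = (cis \<xi> - cis (- \<xi>)) * FT \<psi> \<xi>"
      using ft_shift[of "cx \<psi>" 1 \<xi>] ft_shift[of "cx \<psi>" "-1" \<xi>] by (simp add: FT_eq_ft left_diff_distrib)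
    also have "cis \<xi> - cis (- \<xi>) = \<i> * complex_of_real (2 * sin \<xi>)"
      by (simp add: complex_eq_iff)
    finally have "\<i> * (complex_of_real \<xi> * FT \<eta> \<xi>) = \<i> * (complex_of_real (2 * sin \<xi>) * FT \<psi> \<xi>)"
      by (simp only: mult.assoc)
    then show ?thesis by simp
  qed
  with t show ?thesis by blast
qed

text \<open>The smoothing multiplier vanishes, away from 0, only where sin does, so cancelling it
  loses nothing.\<close>

lemma AE_sin_nonzero: "AE x::real in lborel. sin x \<noteq> 0"
proof -
  have "{x::real. sin x = 0} = range (\<lambda>n::int. of_int n * pi)"
    by (auto simp: sin_zero_iff_int2)
  then have "countable {x::real. sin x = 0}" by simp
  then have "{x::real. sin x = 0} \<in> null_sets lborel"
    by (rule countable_imp_null_set_lborel)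
  from AE_not_in[OF this] show ?thesis by simp
qed

text \<open>Testing with twice-smoothed functions replaces \<open>G\<close> by \<open>(2 sin \<xi> / \<xi>)\<^sup>2 G\<close>, which is square
  integrable.\<close>
lemma weighted_cL2_FT_zero:
  assumes G: "cL2 (\<lambda>\<xi>. G \<xi> / complex_of_real (1 + \<xi>^2))"
    and 0: "\<And>\<psi>. test_fun \<psi> \<Longrightarrow> (LINT \<xi>|lborel. G \<xi> * FT \<psi> (- \<xi>)) = 0"
  shows "AE \<xi> in lborel. G \<xi> = 0"
proof -
  have nz: "1 + \<xi>^2 \<noteq> (0::real)" for \<xi> by (smt (verit) zero_le_power2)
  have "(\<lambda>\<xi>. (G \<xi> / complex_of_real (1 + \<xi>^2)) * complex_of_real (1 + \<xi>^2)) \<in> borel_measurable borel"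
    by (intro borel_measurable_times cL2_meas[OF G]) auto
  then have [measurable]: "G \<in> borel_measurable borel" using nz by (simp del: of_real_add of_real_power)
  define m where "m \<xi> = (2 * sin \<xi> / \<xi>)^2" for \<xi> :: real
  have [measurable]: "m \<in> borel_measurable borel" unfolding m_def by measurable
  \<comment> \<open>In sin^2 \<le> \<xi>^2 and sin^2 \<le> 1, the first handles the summand 1 of the
    weight and the second the summand \<xi>^2. One smoothing would decay only like 1/|\<xi>|, which
    is why there are two.\<close>
  have mb: "\<bar>m \<xi> * (1 + \<xi>^2)\<bar> \<le> 8" for \<xi>
  proof (cases "\<xi> = 0")
    case False
    have 1: "(sin \<xi>)^2 \<le> \<xi>^2" using abs_sin_x_le_abs_x[of \<xi>] by (simp add: abs_le_square_iff)
    have 2: "(sin \<xi>)^2 \<le> 1" using abs_sin_le_one[of \<xi>] by (simp add: abs_square_le_1)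
    have "m \<xi> * (1 + \<xi>^2) = 4 * ((sin \<xi>)^2 / \<xi>^2) + 4 * (sin \<xi>)^2"
      using False by (simp add: m_def power_divide power_mult_distrib distrib_left)
    also have "\<dots> \<le> 4 * 1 + 4 * 1" using 1 2 False by (intro add_mono mult_left_mono) (auto simp: divide_le_eq)
    finally show ?thesis by (simp add: m_def)
  qed (simp add: m_def)
  have "AE \<xi> in lborel. complex_of_real (m \<xi>) * G \<xi> = 0"
  proof (rule cL2_FT_zero)
    have "cL2 (\<lambda>\<xi>. complex_of_real (m \<xi> * (1 + \<xi>^2)) * (G \<xi> / complex_of_real (1 + \<xi>^2)))"
      by (rule cL2_mult_bounded[OF G, where C=8]) (use mb in \<open>auto simp del: of_real_mult\<close>)
    then show "cL2 (\<lambda>\<xi>. complex_of_real (m \<xi>) * G \<xi>)"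
      using nz by (simp del: of_real_add of_real_power)
    fix \<psi> assume \<psi>: "test_fun \<psi>"
    \<comment> \<open>The hypothesis pairs with \<open>FT\<close> at -\<xi>, so \<psi> is reflected
      first; m is even.\<close>
    obtain \<eta> where \<eta>: "test_fun \<eta>" "\<And>\<xi>. complex_of_real \<xi> * FT \<eta> \<xi> = complex_of_real (2 * sin \<xi>) * FT (\<lambda>x. \<psi> (- x)) \<xi>"
      using box_smoothing[OF test_fun_reflect[OF \<psi>]] by blast
    obtain \<theta> where \<theta>: "test_fun \<theta>" "\<And>\<xi>. complex_of_real \<xi> * FT \<theta> \<xi> = complex_of_real (2 * sin \<xi>) * FT \<eta> \<xi>"
      using box_smoothing[OF \<eta>(1)] by blast
    note [measurable] = FT_measurable[OF \<theta>(1)] FT_measurable[OF \<psi>]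
    have eq: "FT \<theta> \<xi> = complex_of_real (m \<xi>) * FT \<psi> (- \<xi>)" if "\<xi> \<noteq> 0" for \<xi>
    proof -
      have "complex_of_real \<xi> * (complex_of_real \<xi> * FT \<theta> \<xi>) = complex_of_real (2 * sin \<xi>) * (complex_of_real \<xi> * FT \<eta> \<xi>)"
        unfolding \<theta>(2) by simp
      then have "complex_of_real \<xi>^2 * FT \<theta> \<xi> = complex_of_real (2 * sin \<xi>)^2 * FT \<psi> (- \<xi>)"
        unfolding \<eta>(2) FT_reflect by (simp add: power2_eq_square mult.assoc)
      then show ?thesis using that by (simp add: m_def power_divide field_simps)
    qed
    have "(LINT x|lborel. complex_of_real (m x) * G x * FT \<psi> x) = (LINT x|lborel. G x * FT \<theta> (- x))"
    proof (rule integral_cong_AE)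
      show "AE x in lborel. complex_of_real (m x) * G x * FT \<psi> x = G x * FT \<theta> (- x)"
        using AE_lborel_singleton[of "0::real"]
      proof eventually_elim
        case (elim x)
        then show ?case using eq[of "- x"] by (simp add: m_def)
      qed
    qed auto
    also have "\<dots> = 0" by (rule 0[OF \<theta>(1)])
    finally show "(LINT x|lborel. complex_of_real (m x) * G x * FT \<psi> x) = 0" .
  qed
  then show ?thesis using AE_sin_nonzero AE_lborel_singleton[of "0::real"]
    by eventually_elim (auto simp: m_def)
qed

section \<open>Weak derivatives and the chain rule\<close>

lemma one_plus_square_pos: "(0::real) < 1 + x^2"
  by (simp add: add_pos_nonneg)

lemma abs_le_one_plus_square: "\<bar>x\<bar> \<le> 1 + (x::real)^2"
proof (cases "\<bar>x\<bar> \<le> 1")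
  case False
  then have "\<bar>x\<bar> * 1 \<le> \<bar>x\<bar> * \<bar>x\<bar>" by (intro mult_left_mono) auto
  then show ?thesis by (simp add: power2_eq_square)
qed (auto intro: order_trans[of _ 1])

text \<open>i\<xi>U is not known to lie in L^2 beforehand, so uniqueness is used in its weighted
  form; Parseval and \<open>FT_deriv\<close> turn the tested identity into pairings with
  \<open>FT \<psi>\<close>.\<close>

lemma is_fourier_weak_derivative:
  assumes u: "is_fourier u U" and v: "is_fourier v V"
    and w: "\<And>\<psi>. test_fun \<psi> \<Longrightarrow> (LINT x|lborel. u x * deriv \<psi> x) = - (LINT x|lborel. v x * \<psi> x)"
  shows "AE \<xi> in lborel. V \<xi> = \<i> * complex_of_real \<xi> * U \<xi>"
proof -
  note [measurable] = is_fourierD(4)[OF u] is_fourierD(4)[OF v]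
  have "AE \<xi> in lborel. \<i> * complex_of_real \<xi> * U \<xi> - V \<xi> = 0"
  proof (rule weighted_cL2_FT_zero)
    have "cL2 (\<lambda>\<xi>. (\<i> * complex_of_real \<xi> / complex_of_real (1 + \<xi>^2)) * U \<xi> - (1 / complex_of_real (1 + \<xi>^2)) * V \<xi>)"
    proof (intro cL2_diff cL2_mult_bounded[where C=1] is_fourierD(2)[OF u] is_fourierD(2)[OF v])
      show "cmod (\<i> * complex_of_real \<xi> / complex_of_real (1 + \<xi>\<^sup>2)) \<le> 1" for \<xi>
        using abs_le_one_plus_square[of \<xi>] one_plus_square_pos[of \<xi>]
        by (simp add: norm_divide norm_mult del: of_real_add of_real_power)
      show "cmod (1 / complex_of_real (1 + \<xi>\<^sup>2)) \<le> 1" for \<xi>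
        using one_plus_square_pos[of \<xi>] by (simp add: norm_divide del: of_real_add of_real_power)
    qed auto
    then show "cL2 (\<lambda>\<xi>. (\<i> * complex_of_real \<xi> * U \<xi> - V \<xi>) / complex_of_real (1 + \<xi>\<^sup>2))"
      by (simp add: diff_divide_distrib)
    fix \<psi> assume \<psi>: "test_fun \<psi>"
    have i: "integrable lborel (\<lambda>\<xi>. U \<xi> * FT (deriv \<psi>) (- \<xi>))" "integrable lborel (\<lambda>\<xi>. V \<xi> * FT \<psi> (- \<xi>))"
      by (intro cL2_mult_integrable is_fourierD(2)[OF u] is_fourierD(2)[OF v] FT_reflected_L1_L2 test_fun_deriv \<psi>)+
    have "(LINT \<xi>|lborel. (\<i> * complex_of_real \<xi> * U \<xi> - V \<xi>) * FT \<psi> (- \<xi>))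
        = (LINT \<xi>|lborel. - (U \<xi> * FT (deriv \<psi>) (- \<xi>)) - V \<xi> * FT \<psi> (- \<xi>))"
      by (simp add: FT_deriv[OF \<psi>] algebra_simps)
    also have "\<dots> = - (LINT \<xi>|lborel. U \<xi> * FT (deriv \<psi>) (- \<xi>)) - (LINT \<xi>|lborel. V \<xi> * FT \<psi> (- \<xi>))"
      using i by simp
    also have "\<dots> = 0"
      unfolding is_fourier_parseval[OF u test_fun_deriv[OF \<psi>]] is_fourier_parseval[OF v \<psi>] w[OF \<psi>] by simp
    finally show "(LINT \<xi>|lborel. (\<i> * complex_of_real \<xi> * U \<xi> - V \<xi>) * FT \<psi> (- \<xi>)) = 0" .
  qed
  then show ?thesis by eventually_elim simp
qed

section \<open>Pointwise inverse transform of integrable functions\<close>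

text \<open>In contrast to \<open>is_fourier_inverse\<close> this gives bounds at every point and,
  when \<xi>H is integrable, a classical derivative. For Hermitian H taking the real part changes
  nothing (\<open>cx_ift\<close>).\<close>

definition ift :: "(real \<Rightarrow> complex) \<Rightarrow> real \<Rightarrow> real" where
  "ift H x = Re (complex_of_real (1 / (2 * pi)) * ft H (- x))"

lemma ift_bound: "\<bar>ift H x\<bar> \<le> (LINT \<xi>|lborel. cmod (H \<xi>))"
proof -
  have "\<bar>ift H x\<bar> \<le> cmod (complex_of_real (1 / (2 * pi)) * ft H (- x))"
    unfolding ift_def by (rule abs_Re_le_cmod)
  also have "\<dots> = (1 / (2 * pi)) * cmod (ft H (- x))" by (simp add: norm_mult norm_divide)
  also have "\<dots> \<le> 1 * cmod (ft H (- x))"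
    using pi_ge_two by (intro mult_right_mono) auto
  also have "\<dots> \<le> (LINT \<xi>|lborel. cmod (H \<xi>))" using ft_norm_le by simp
  finally show ?thesis .
qed

lemma ift_measurable [measurable]:
  assumes [measurable]: "H \<in> borel_measurable borel" shows "ift H \<in> borel_measurable borel"
proof -
  have [measurable]: "(\<lambda>x. ft H (- x)) \<in> borel_measurable borel"
    by (rule measurable_compose[OF _ ft_measurable]) measurable
  show ?thesis unfolding ift_def[abs_def] by measurable
qed

lemma cx_ift: assumes "H \<in> borel_measurable borel" "AE \<xi> in lborel. H (- \<xi>) = cnj (H \<xi>)"
  shows "cx (ift H) x = complex_of_real (1 / (2 * pi)) * ft H (- x)"
proof -
  note [measurable] = assms(1)
  have "cnj (ft H (- x)) = ft (\<lambda>\<xi>. cnj (H \<xi>)) x" by (simp add: ft_cnj)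
  also have "\<dots> = ft (\<lambda>\<xi>. H (- \<xi>)) x"
    unfolding ft_def by (intro integral_cong_AE) (use assms(2) in \<open>auto elim: AE_mp\<close>)
  also have "\<dots> = ft H (- x)" by (rule ft_reflect)
  finally show ?thesis unfolding ift_def by (simp add: complex_eq_iff)
qed

lemma is_fourier_ift:
  assumes H: "cL2 H" "integrable lborel H" and herm: "AE \<xi> in lborel. H (- \<xi>) = cnj (H \<xi>)"
  shows "is_fourier (ift H) H"
  unfolding is_fourier_iff
proof (intro conjI allI impI H)
  note c = cx_ift[OF cL2_meas[OF H(1)] herm]
  show "cL2 (cx (ift H))" unfolding c by (intro cL2_cmult cL2_reflect bessel_L1_L2 H)
  fix \<psi> assume \<psi>: "test_fun \<psi>"
  have "(LINT x|lborel. cx (ift H) x * FT \<psi> x) = (LINT x|lborel. complex_of_real (1 / (2 * pi)) * (ft H x * FT \<psi> (- x)))"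
    unfolding c by (subst integral_reflect[symmetric]) (simp add: mult.assoc)
  also have "\<dots> = complex_of_real (1 / (2 * pi)) * (LINT x|lborel. ft H x * FT \<psi> (- x))"
    by (rule Bochner_Integration.integral_mult_right_zero)
  also have "(LINT x|lborel. ft H x * FT \<psi> (- x)) = (LINT x|lborel. H x * ft (\<lambda>x. FT \<psi> (- x)) x)"
    by (intro ft_duality H FT_reflected_L1_L2 \<psi>)
  also have "complex_of_real (1 / (2 * pi)) * \<dots> = (LINT x|lborel. complex_of_real (1 / (2 * pi)) * (H x * ft (\<lambda>x. FT \<psi> (- x)) x))"
    by (rule Bochner_Integration.integral_mult_right_zero[symmetric])
  also have "\<dots> = (LINT x|lborel. H x * cx \<psi> x)"
    by (intro Bochner_Integration.integral_cong refl) (simp add: FT_inversion[OF \<psi>])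
  finally show "(LINT x|lborel. H x * cx \<psi> x) = (LINT x|lborel. cx (ift H) x * FT \<psi> x)" ..
qed

lemma cmod_cis_minus_one: "cmod (cis t - 1) \<le> \<bar>t\<bar>"
  using iexp_approx1[of t 0] by (simp add: cis_conv_exp)

text \<open>Differentiation under the integral sign: |cis t - 1| \<le> |t| bounds the difference
  quotients by |\<xi>H(\<xi>)|.\<close>

lemma ift_DERIV:
  assumes H: "integrable lborel H" and xH: "integrable lborel (\<lambda>\<xi>. \<i> * complex_of_real \<xi> * H \<xi>)"
  shows "(ift H has_real_derivative ift (\<lambda>\<xi>. \<i> * complex_of_real \<xi> * H \<xi>) x) (at x)"
  unfolding DERIV_def tendsto_at_iff_sequentially
proof (intro allI impI)
  fix X :: "nat \<Rightarrow> real" assume X: "\<forall>i. X i \<in> UNIV - {0}" "X \<longlonglongrightarrow> 0"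
  have Hm[measurable]: "H \<in> borel_measurable borel" using H by auto
  define Q where "Q n \<xi> = H \<xi> * cis (\<xi> * x) * ((cis (\<xi> * X n) - 1) / complex_of_real (X n))" for n \<xi>
  have e: "ift H y = Re (complex_of_real (1 / (2 * pi)) * (LINT \<xi>|lborel. H \<xi> * cis (\<xi> * y)))" for H y
    unfolding ift_def ft_def by simp
  have ii: "integrable lborel (\<lambda>\<xi>. H \<xi> * cis (\<xi> * y))" for y
    by (intro integrable_cis_mult H) simp
  have Q: "(ift H (x + X n) - ift H x) / X n = Re (complex_of_real (1 / (2 * pi)) * (LINT \<xi>|lborel. Q n \<xi>))" for n
  proof -
    have "(LINT \<xi>|lborel. Q n \<xi>) = (LINT \<xi>|lborel. (H \<xi> * cis (\<xi> * (x + X n)) - H \<xi> * cis (\<xi> * x)) / complex_of_real (X n))"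
      by (intro Bochner_Integration.integral_cong refl)
         (simp add: Q_def distrib_left cis_mult[symmetric] algebra_simps diff_divide_distrib)
    also have "\<dots> = ((LINT \<xi>|lborel. H \<xi> * cis (\<xi> * (x + X n))) - (LINT \<xi>|lborel. H \<xi> * cis (\<xi> * x))) / complex_of_real (X n)"
      using ii by simp
    finally show ?thesis unfolding e by (simp add: diff_divide_distrib Re_divide_of_real right_diff_distrib)
  qed
  have "(\<lambda>n. LINT \<xi>|lborel. Q n \<xi>) \<longlonglongrightarrow> (LINT \<xi>|lborel. H \<xi> * cis (\<xi> * x) * (\<i> * complex_of_real \<xi>))"
  proof (rule integral_dominated_convergence[where w="\<lambda>\<xi>. cmod (\<i> * complex_of_real \<xi> * H \<xi>)"])
    show "integrable lborel (\<lambda>\<xi>. cmod (\<i> * complex_of_real \<xi> * H \<xi>))" using xH by (rule integrable_norm)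
    show "AE \<xi> in lborel. (\<lambda>n. Q n \<xi>) \<longlonglongrightarrow> H \<xi> * cis (\<xi> * x) * (\<i> * complex_of_real \<xi>)"
    proof (intro AE_I2)
      fix \<xi>
      have "((\<lambda>z. exp (\<i> * complex_of_real \<xi> * z)) has_field_derivative \<i> * complex_of_real \<xi>) (at 0)"
        by (auto intro!: derivative_eq_intros)
      then have "((\<lambda>h. (exp (\<i> * complex_of_real \<xi> * h) - 1) / h) \<longlongrightarrow> \<i> * complex_of_real \<xi>) (at 0)"
        by (simp add: DERIV_def)
      moreover have "(\<lambda>n. complex_of_real (X n)) \<longlonglongrightarrow> 0" using tendsto_of_real[OF X(2)] by simp
      ultimately have "(\<lambda>n. (exp (\<i> * complex_of_real \<xi> * complex_of_real (X n)) - 1) / complex_of_real (X n)) \<longlonglongrightarrow> \<i> * complex_of_real \<xi>"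
        using X(1) unfolding tendsto_at_iff_sequentially by (auto simp: comp_def dest!: spec[of _ "\<lambda>n. complex_of_real (X n)"])
      then have "(\<lambda>n. (cis (\<xi> * X n) - 1) / complex_of_real (X n)) \<longlonglongrightarrow> \<i> * complex_of_real \<xi>"
        by (simp add: cis_conv_exp mult.assoc)
      then show "(\<lambda>n. Q n \<xi>) \<longlonglongrightarrow> H \<xi> * cis (\<xi> * x) * (\<i> * complex_of_real \<xi>)"
        unfolding Q_def by (rule tendsto_mult_left)
    qed
    show "AE \<xi> in lborel. norm (Q n \<xi>) \<le> cmod (\<i> * complex_of_real \<xi> * H \<xi>)" for n
    proof (intro AE_I2)
      fix \<xi>
      have "cmod (cis (\<xi> * X n) - 1) / \<bar>X n\<bar> \<le> \<bar>\<xi>\<bar>"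
        using cmod_cis_minus_one[of "\<xi> * X n"] X(1) by (simp add: divide_le_eq abs_mult)
      from mult_left_mono[OF this norm_ge_zero[of "H \<xi>"]]
      show "norm (Q n \<xi>) \<le> cmod (\<i> * complex_of_real \<xi> * H \<xi>)"
        by (simp add: Q_def norm_mult norm_divide mult.commute)
    qed
  qed (auto simp: Q_def)
  then have "(\<lambda>n. Re (complex_of_real (1 / (2 * pi)) * (LINT \<xi>|lborel. Q n \<xi>)))
     \<longlonglongrightarrow> Re (complex_of_real (1 / (2 * pi)) * (LINT \<xi>|lborel. H \<xi> * cis (\<xi> * x) * (\<i> * complex_of_real \<xi>)))"
    by (intro tendsto_intros)
  then show "((\<lambda>h. (ift H (x + h) - ift H x) / h) \<circ> X) \<longlonglongrightarrow> ift (\<lambda>\<xi>. \<i> * complex_of_real \<xi> * H \<xi>) x"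
    unfolding comp_def Q e[of "\<lambda>\<xi>. \<i> * complex_of_real \<xi> * H \<xi>"] by (simp add: mult_ac)
qed

text \<open>Write st = (s - U)(t - V) + tU + sV - UV: the first product is small by Cauchy-Schwarz,
  and the next two have one fixed factor.\<close>

lemma cL2_pairing_tendsto2:
  assumes a: "\<And>n. cL2 (s n)" "cL2 U" "(\<lambda>n. sqnorm (\<lambda>x. s n x - U x)) \<longlonglongrightarrow> 0"
    and b: "\<And>n. cL2 (t n)" "cL2 V" "(\<lambda>n. sqnorm (\<lambda>x. t n x - V x)) \<longlonglongrightarrow> 0"
  shows "(\<lambda>n. LINT x|lborel. s n x * t n x) \<longlonglongrightarrow> (LINT x|lborel. U x * V x)"
proof -
  have "(\<lambda>n. LINT x|lborel. (s n x - U x) * (t n x - V x)) \<longlonglongrightarrow> 0"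
  proof (rule Lim_null_comparison)
    show "\<forall>\<^sub>F n in sequentially. norm (LINT x|lborel. (s n x - U x) * (t n x - V x))
       \<le> sqrt (sqnorm (\<lambda>x. s n x - U x) * sqnorm (\<lambda>x. t n x - V x))"
      by (intro always_eventually allI cL2_CS cL2_diff a b)
    have "(\<lambda>n. sqrt (sqnorm (\<lambda>x. s n x - U x) * sqnorm (\<lambda>x. t n x - V x))) \<longlonglongrightarrow> sqrt (0 * 0)"
      by (intro tendsto_intros a b)
    then show "(\<lambda>n. sqrt (sqnorm (\<lambda>x. s n x - U x) * sqnorm (\<lambda>x. t n x - V x))) \<longlonglongrightarrow> 0" by simp
  qed
  moreover have "(\<lambda>n. LINT x|lborel. t n x * U x) \<longlonglongrightarrow> (LINT x|lborel. V x * U x)"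
    by (rule cL2_pairing_tendsto[OF b(1,2) a(2) b(3)])
  moreover have "(\<lambda>n. LINT x|lborel. s n x * V x) \<longlonglongrightarrow> (LINT x|lborel. U x * V x)"
    by (rule cL2_pairing_tendsto[OF a(1,2) b(2) a(3)])
  ultimately have "(\<lambda>n. (LINT x|lborel. (s n x - U x) * (t n x - V x)) + (LINT x|lborel. t n x * U x)
      + (LINT x|lborel. s n x * V x) - (LINT x|lborel. U x * V x))
     \<longlonglongrightarrow> 0 + (LINT x|lborel. V x * U x) + (LINT x|lborel. U x * V x) - (LINT x|lborel. U x * V x)"
    by (intro tendsto_intros)
  moreover have "(LINT x|lborel. (s n x - U x) * (t n x - V x)) + (LINT x|lborel. t n x * U x)
      + (LINT x|lborel. s n x * V x) - (LINT x|lborel. U x * V x) = (LINT x|lborel. s n x * t n x)" for n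
  proof -
    have i: "integrable lborel (\<lambda>x. (s n x - U x) * (t n x - V x))" "integrable lborel (\<lambda>x. t n x * U x)"
      "integrable lborel (\<lambda>x. s n x * V x)" "integrable lborel (\<lambda>x. U x * V x)"
      by (intro cL2_mult_integrable cL2_diff a b)+
    have "(LINT x|lborel. s n x * t n x)
       = (LINT x|lborel. (s n x - U x) * (t n x - V x) + t n x * U x + s n x * V x - U x * V x)"
      by (simp add: algebra_simps)
    then show ?thesis using i by simp
  qed
  ultimately show ?thesis by (simp add: mult.commute)
qed

section \<open>Weak derivatives in L^2\<close>

text \<open>Expresses that u is in H^1 with derivative v; square integrability of both is part of
  \<open>is_fourier\<close>.\<close>

definition fourier_deriv :: "(real \<Rightarrow> real) \<Rightarrow> (real \<Rightarrow> real) \<Rightarrow> bool" where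
  "fourier_deriv u v \<longleftrightarrow> (\<exists>U. is_fourier u U \<and> is_fourier v (\<lambda>\<xi>. \<i> * complex_of_real \<xi> * U \<xi>))"

lemma fourier_deriv_lincomb:
  assumes "fourier_deriv u u'" "fourier_deriv v v'"
  shows "fourier_deriv (\<lambda>x. a * u x + b * v x) (\<lambda>x. a * u' x + b * v' x)"
proof -
  obtain U V where U: "is_fourier u U" "is_fourier u' (\<lambda>\<xi>. \<i> * complex_of_real \<xi> * U \<xi>)"
    and V: "is_fourier v V" "is_fourier v' (\<lambda>\<xi>. \<i> * complex_of_real \<xi> * V \<xi>)"
    using assms unfolding fourier_deriv_def by blast
  show ?thesis unfolding fourier_deriv_def
    using is_fourier_lincomb[OF U(1) V(1), of a b] is_fourier_lincomb[OF U(2) V(2), of a b]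
    by (intro exI[of _ "\<lambda>\<xi>. complex_of_real a * U \<xi> + complex_of_real b * V \<xi>"]) (auto simp: algebra_simps)
qed

lemma fourier_deriv_cong_AE:
  assumes "fourier_deriv u v" "AE x in lborel. u x = u' x" "u' \<in> borel_measurable borel"
    "AE x in lborel. v x = v' x" "v' \<in> borel_measurable borel"
  shows "fourier_deriv u' v'"
  using assms is_fourier_cong_AE_fst unfolding fourier_deriv_def by blast

lemma fourier_derivI_weak:
  assumes "L2 u" "L2 v"
    and w: "\<And>\<psi>. test_fun \<psi> \<Longrightarrow> (LINT x|lborel. u x * deriv \<psi> x) = - (LINT x|lborel. v x * \<psi> x)"
  shows "fourier_deriv u v"
proof -
  obtain U V where U: "is_fourier u U" and V: "is_fourier v V" using is_fourier_exists[OF assms(1)] is_fourier_exists[OF assms(2)] by blast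
  note [measurable] = is_fourierD(4)[OF U]
  have "is_fourier v (\<lambda>\<xi>. \<i> * complex_of_real \<xi> * U \<xi>)"
    by (rule is_fourier_cong_AE[OF V is_fourier_weak_derivative[OF U V w]]) auto
  with U show ?thesis unfolding fourier_deriv_def by blast
qed

text \<open>U is the product of (1 + \<xi>^2)^(-1/2) and (1 + \<xi>^2)^(1/2) U, both in L^2. This is
  the source of the embedding of H^1 into bounded functions.\<close>

lemma integrable_of_weighted_cL2:
  assumes U: "cL2 U" and xU: "cL2 (\<lambda>\<xi>. \<i> * complex_of_real \<xi> * U \<xi>)"
  shows "integrable lborel U"
proof -
  note [measurable] = cL2_meas[OF U]
  have 1: "cL2 (\<lambda>\<xi>. complex_of_real (1 / sqrt (1 + \<xi>^2)))"
    by (rule cL2I_bound[OF _ integrable_inverse_square])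
       (auto simp: power_divide inverse_eq_divide one_plus_square_pos less_imp_le simp del: of_real_divide)
  have 2: "cL2 (\<lambda>\<xi>. complex_of_real (sqrt (1 + \<xi>^2)) * U \<xi>)"
  proof (rule cL2I_bound)
    show "integrable lborel (\<lambda>\<xi>. (cmod (U \<xi>))^2 + (cmod (\<i> * complex_of_real \<xi> * U \<xi>))^2)"
      using U xU by (intro Bochner_Integration.integrable_add cL2_integrable)
    show "(cmod (complex_of_real (sqrt (1 + \<xi>\<^sup>2)) * U \<xi>))\<^sup>2 \<le> (cmod (U \<xi>))\<^sup>2 + (cmod (\<i> * complex_of_real \<xi> * U \<xi>))\<^sup>2" for \<xi>
      using one_plus_square_pos[of \<xi>] by (simp add: norm_mult power_mult_distrib distrib_right del: of_real_add of_real_power)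
    show "(\<lambda>\<xi>. complex_of_real (sqrt (1 + \<xi>\<^sup>2)) * U \<xi>) \<in> borel_measurable lborel" by measurable
  qed
  have nz: "sqrt (1 + \<xi>^2) \<noteq> 0" for \<xi> :: real using one_plus_square_pos[of \<xi>] by simp
  have cancel: "complex_of_real (1 / r) * (complex_of_real r * z) = z" if "r \<noteq> 0" for r z
    using that by simp
  show ?thesis using cL2_mult_integrable[OF 1 2] unfolding cancel[OF nz] .
qed

lemma continuous_bounded_on_interval:
  fixes g :: "real \<Rightarrow> real" assumes "continuous_on UNIV g"
  obtains C where "C > 0" "\<And>s. \<bar>s\<bar> \<le> B \<Longrightarrow> \<bar>g s\<bar> \<le> C"
proof -
  have "compact (g ` {-B..B})"
    by (intro compact_continuous_image continuous_on_subset[OF assms]) auto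
  then obtain C where C: "\<And>y. y \<in> g ` {-B..B} \<Longrightarrow> norm y \<le> C"
    using compact_imp_bounded bounded_iff by metis
  show ?thesis
  proof (rule that[of "max C 1"])
    fix s assume "\<bar>s\<bar> \<le> B"
    then have "g s \<in> g ` {-B..B}" by (intro imageI) (auto simp: abs_le_iff)
    from C[OF this] show "\<bar>g s\<bar> \<le> max C 1" by simp
  qed simp
qed

lemma continuous_compact_support_integrable:
  fixes g :: "real \<Rightarrow> real"
  assumes g: "continuous_on UNIV g" and R: "\<And>x. R < \<bar>x\<bar> \<Longrightarrow> g x = 0"
  shows "integrable lborel g"
proof -
  obtain C where "\<And>s. \<bar>s\<bar> \<le> R \<Longrightarrow> \<bar>g s\<bar> \<le> C" "C > 0"
    using continuous_bounded_on_interval[OF g, of R] by metis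
  then have "norm (g x) \<le> C" for x using R[of x] by (cases "R < \<bar>x\<bar>") auto
  then show ?thesis using R g by (intro bounded_support_integrable[of g C R]) (auto intro: borel_measurable_continuous_onI)
qed

lemma trunc_hermitian: assumes "AE \<xi> in lborel. H (- \<xi>) = cnj (H \<xi>)"
  shows "AE \<xi> in lborel. trunc A H (- \<xi>) = cnj (trunc A H \<xi>)"
  using assms by eventually_elim (auto simp: trunc_def)

lemma integrable_trunc_mult: assumes "cL2 V"
  shows "integrable lborel (\<lambda>\<xi>. \<i> * complex_of_real \<xi> * trunc A V \<xi>)"
proof (rule Bochner_Integration.integrable_bound)
  note [measurable] = cL2_meas[OF assms]
  show "integrable lborel (\<lambda>\<xi>. complex_of_real A * trunc A V \<xi>)" using trunc_integrable[OF assms] by auto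
  show "AE \<xi> in lborel. norm (\<i> * complex_of_real \<xi> * trunc A V \<xi>) \<le> norm (complex_of_real A * trunc A V \<xi>)"
    by (auto simp: trunc_def norm_mult intro!: AE_I2 mult_right_mono)
qed (use cL2_meas[OF assms] in measurable)

lemma trunc_norm_le: "cmod (trunc A U x) \<le> cmod (U x)"
  by (simp add: trunc_def)

lemma L2_mult_bounded_AE:
  assumes "L2 v" "g \<in> borel_measurable borel" "AE x in lborel. \<bar>g x\<bar> \<le> C"
  shows "L2 (\<lambda>x. g x * v x)"
  unfolding L2_def
proof
  have [measurable]: "v \<in> borel_measurable borel" using assms by (simp add: L2_def)
  note [measurable] = assms(2)
  show "integrable lborel (\<lambda>x. (g x * v x)^2)"
  proof (rule Bochner_Integration.integrable_bound)
    show "integrable lborel (\<lambda>x. C^2 * (v x)^2)" using assms(1) by (simp add: L2_def)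
    show "AE x in lborel. norm ((g x * v x)^2) \<le> norm (C^2 * (v x)^2)"
      using assms(3)
    proof eventually_elim
      case (elim x)
      then have "(g x)^2 \<le> C^2" by (rule abs_le_square_iff[THEN iffD1, OF order_trans[OF _ abs_ge_self]])
      then show ?case by (simp add: power_mult_distrib mult_right_mono)
    qed
  qed measurable
qed (use assms in \<open>auto simp: L2_def\<close>)

lemma fourier_deriv_bounded: assumes "fourier_deriv u v"
  obtains B where "AE x in lborel. \<bar>u x\<bar> \<le> B"
proof -
  obtain U where U: "is_fourier u U" "is_fourier v (\<lambda>\<xi>. \<i> * complex_of_real \<xi> * U \<xi>)"
    using assms unfolding fourier_deriv_def by blast
  have Ui: "integrable lborel U"
    using integrable_of_weighted_cL2 is_fourierD(2) U by blast
  have "is_fourier (ift U) U"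
    by (rule is_fourier_ift[OF is_fourierD(2)[OF U(1)] Ui is_fourier_hermitian[OF U(1)]])
  from is_fourier_unique_fst[OF U(1) this] have "AE x in lborel. \<bar>u x\<bar> \<le> (LINT \<xi>|lborel. cmod (U \<xi>))"
    by eventually_elim (simp add: ift_bound)
  then show ?thesis by (rule that)
qed

text \<open>The chain rule is classical for the low-frequency truncations of \<open>u\<close>, which converge
  pointwise with uniform bounds, while their derivatives converge in \<open>L\<^sup>2\<close>.\<close>
lemma fourier_deriv_chain:
  assumes uv: "fourier_deriv u v"
    and F: "\<And>s. (F has_real_derivative F' s) (at s)" "continuous_on UNIV F'" "F 0 = 0"
  shows "fourier_deriv (\<lambda>x. F (u x)) (\<lambda>x. F' (u x) * v x)"
proof -
  obtain U where U: "is_fourier u U" and V: "is_fourier v (\<lambda>\<xi>. \<i> * complex_of_real \<xi> * U \<xi>)"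
    using uv unfolding fourier_deriv_def by blast
  define V where "V \<xi> = \<i> * complex_of_real \<xi> * U \<xi>" for \<xi>
  have V': "is_fourier v V" using V by (simp add: V_def[abs_def])
  note Uc = is_fourierD(2)[OF U] and Vc = is_fourierD(2)[OF V']
  note [measurable] = cL2_meas[OF Uc] cL2_meas[OF Vc] is_fourierD(5)[OF U] is_fourierD(5)[OF V]
  have Ui: "integrable lborel U"
    using integrable_of_weighted_cL2 Uc Vc unfolding V_def[abs_def] by blast
  \<comment> \<open>The representative of u that is bounded by B at every point, so bounds for F and
    F' on [-B, B] apply to it everywhere.\<close>
  define w where "w = ift U"
  have wU: "is_fourier w U"
    unfolding w_def by (rule is_fourier_ift[OF Uc Ui is_fourier_hermitian[OF U]])
  have uw: "AE x in lborel. u x = w x" by (rule is_fourier_unique_fst[OF U wU])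
  define B where "B = (LINT \<xi>|lborel. cmod (U \<xi>))"
  have wB: "\<bar>w x\<bar> \<le> B" for x unfolding w_def B_def by (rule ift_bound)
  \<comment> \<open>The cutoff commutes with multiplication by i\<xi>, so \<open>vn n\<close> will
    be the classical derivative of \<open>un n\<close>; it tends to v only in L^2, whereas
    \<open>un n\<close> tends to w pointwise.\<close>
  define un where "un n = ift (trunc (real n) U)" for n
  define vn where "vn n = ift (trunc (real n) V)" for n
  have trV: "trunc (real n) V = (\<lambda>\<xi>. \<i> * complex_of_real \<xi> * trunc (real n) U \<xi>)" for n
    by (auto simp: trunc_def V_def)
  have unB: "\<bar>un n x\<bar> \<le> B" for n x
  proof -
    have "\<bar>un n x\<bar> \<le> (LINT \<xi>|lborel. cmod (trunc (real n) U \<xi>))" unfolding un_def by (rule ift_bound)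
    also have "\<dots> \<le> B" unfolding B_def
      using Ui trunc_integrable[OF Uc] by (intro integral_mono trunc_norm_le integrable_norm)
    finally show ?thesis .
  qed
  have un_lim: "(\<lambda>n. un n x) \<longlonglongrightarrow> w x" for x
    unfolding un_def w_def ift_def ft_def
  proof (intro tendsto_intros integral_dominated_convergence[where w="\<lambda>\<xi>. cmod (U \<xi>)"])
    show "AE \<xi> in lborel. (\<lambda>n. trunc (real n) U \<xi> * cis (- (\<xi> * - x))) \<longlonglongrightarrow> U \<xi> * cis (- (\<xi> * - x))"
    proof (intro AE_I2 tendsto_intros)
      fix \<xi>
      obtain N where "\<bar>\<xi>\<bar> \<le> real N" using real_arch_simple by blast
      then have "\<forall>n\<ge>N. trunc (real n) U \<xi> = U \<xi>" by (auto simp: trunc_def abs_le_iff)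
      then show "(\<lambda>n. trunc (real n) U \<xi>) \<longlonglongrightarrow> U \<xi>"
        by (intro tendsto_eventually) (auto simp: eventually_sequentially)
    qed
  qed (use Ui trunc_norm_le in \<open>auto simp: norm_mult\<close>)
  have un_deriv: "(un n has_real_derivative vn n x) (at x)" for n x
    unfolding un_def vn_def trV
    by (rule ift_DERIV[OF trunc_integrable[OF Uc]]) (use trunc_integrable[OF Vc, of "real n"] trV in simp)
  have vn_deriv: "\<exists>D. (vn n has_real_derivative D) (at x)" for n x
    using ift_DERIV[OF trunc_integrable[OF Vc, of "real n"]] integrable_trunc_mult[OF Vc] unfolding vn_def by blast
  have un_cont: "continuous_on UNIV (un n)" and vn_cont: "continuous_on UNIV (vn n)" for n
    using un_deriv vn_deriv DERIV_isCont by (metis continuous_at_imp_continuous_on)+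
  have vnV: "is_fourier (vn n) (trunc (real n) V)" for n
    unfolding vn_def by (rule is_fourier_ift[OF cL2_trunc[OF Vc] trunc_integrable[OF Vc] trunc_hermitian[OF is_fourier_hermitian[OF V']]])
  have vn_lim: "(\<lambda>n. sqnorm (\<lambda>x. cx (vn n) x - cx v x)) \<longlonglongrightarrow> 0"
  proof (rule Lim_null_comparison[OF _ trunc_tendsto[OF Vc]])
    show "\<forall>\<^sub>F n in sequentially. norm (sqnorm (\<lambda>x. cx (vn n) x - cx v x)) \<le> sqnorm (\<lambda>x. trunc (real n) V x - V x)"
      using is_fourier_plancherel_le[OF is_fourier_diff[OF vnV V']] by (intro always_eventually) simp
  qed
  obtain C where C: "C > 0" "\<And>s. \<bar>s\<bar> \<le> B \<Longrightarrow> \<bar>F' s\<bar> \<le> C"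
    using continuous_bounded_on_interval[OF F(2)] by blast
  have Fc: "continuous_on UNIV F"
    using F(1) DERIV_isCont continuous_at_imp_continuous_on by blast
  obtain M where M: "M > 0" "\<And>s. \<bar>s\<bar> \<le> B \<Longrightarrow> \<bar>F s\<bar> \<le> M"
    using continuous_bounded_on_interval[OF Fc] by blast
  have [measurable]: "F \<in> borel_measurable borel" "F' \<in> borel_measurable borel"
    using Fc F(2) by (auto intro: borel_measurable_continuous_onI)
  have [measurable]: "w \<in> borel_measurable borel" by (rule is_fourierD(5)[OF wU])
  have [measurable]: "un n \<in> borel_measurable borel" "vn n \<in> borel_measurable borel" for n
    using un_cont vn_cont by (auto intro: borel_measurable_continuous_onI)
  \<comment> \<open>F(0) = 0 and the bound on F' give |F(s)| \<le> C|s|, which places F(w) in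
    L^2.\<close>
  have lip: "\<bar>F s\<bar> \<le> C * \<bar>s\<bar>" if "\<bar>s\<bar> \<le> B" for s
  proof -
    have "norm (F s - F 0) \<le> C * norm (s - 0)"
    proof (rule field_differentiable_bound[of "{-B..B}" F F'])
      show "(F has_field_derivative F' z) (at z within {-B..B})" for z
        using F(1) has_field_derivative_at_within by blast
    qed (use C that in auto)
    then show ?thesis using F(3) by simp
  qed
  have L2F: "L2 (\<lambda>x. F (w x))" unfolding L2_def
  proof
    show "integrable lborel (\<lambda>x. (F (w x))\<^sup>2)"
    proof (rule Bochner_Integration.integrable_bound)
      show "integrable lborel (\<lambda>x. C^2 * (w x)^2)" using is_fourierD(3)[OF wU] by (simp add: L2_def)
      show "AE x in lborel. norm ((F (w x))\<^sup>2) \<le> norm (C\<^sup>2 * (w x)\<^sup>2)"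
      proof (intro AE_I2)
        fix x
        have "\<bar>F (w x)\<bar>^2 \<le> (C * \<bar>w x\<bar>)^2" using lip[OF wB[of x]] by (intro power_mono) auto
        then show "norm ((F (w x))\<^sup>2) \<le> norm (C\<^sup>2 * (w x)\<^sup>2)" by (simp add: power_mult_distrib)
      qed
    qed measurable
  qed measurable
  have L2F': "L2 (\<lambda>x. F' (w x) * v x)"
    by (rule L2_mult_bounded_AE[OF is_fourierD(3)[OF V']]) (use C wB in auto)
  have "fourier_deriv (\<lambda>x. F (w x)) (\<lambda>x. F' (w x) * v x)"
  proof (rule fourier_derivI_weak[OF L2F L2F'])
    fix \<psi> assume \<psi>: "test_fun \<psi>"
    note [measurable] = test_fun_measurable[OF \<psi>] test_fun_measurable[OF test_fun_deriv[OF \<psi>]]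
    obtain R1 where R1: "\<And>x. R1 < \<bar>x\<bar> \<Longrightarrow> \<psi> x = 0" using test_fun_support[OF \<psi>] by blast
    obtain R2 where R2: "\<And>x. R2 < \<bar>x\<bar> \<Longrightarrow> deriv \<psi> x = 0"
      using test_fun_support[OF test_fun_deriv[OF \<psi>]] by blast
    have ip: "(LINT x|lborel. F (un n x) * deriv \<psi> x) = - (LINT x|lborel. (F' (un n x) * \<psi> x) * vn n x)" for n
    proof -
      have cc: "continuous_on UNIV (\<lambda>x. F (un n x))" "continuous_on UNIV (\<lambda>x. F' (un n x))"
        by (rule continuous_on_compose2[OF Fc un_cont] continuous_on_compose2[OF F(2) un_cont]; simp)+
      have c1: "continuous_on UNIV (\<lambda>x. F (un n x) * deriv \<psi> x)"
        by (intro continuous_intros cc smooth_continuous_on smooth_deriv test_fun_smooth \<psi>)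
      have c2: "continuous_on UNIV (\<lambda>x. (F' (un n x) * \<psi> x) * vn n x)"
        by (intro continuous_intros cc vn_cont smooth_continuous_on test_fun_smooth \<psi>)
      have i1: "integrable lborel (\<lambda>x. F (un n x) * deriv \<psi> x)"
        by (rule continuous_compact_support_integrable[OF c1, of R2]) (use R2 in auto)
      have i2: "integrable lborel (\<lambda>x. (F' (un n x) * \<psi> x) * vn n x)"
        by (rule continuous_compact_support_integrable[OF c2, of R1]) (use R1 in auto)
      have "(LINT x|lborel. F (un n x) * deriv \<psi> x + (F' (un n x) * \<psi> x) * vn n x) = 0"
      proof (rule integral_derivative_compact_support[where F="\<lambda>x. F (un n x) * \<psi> x" and R="max R1 R2"])
        fix x
        have "((\<lambda>x. F (un n x) * \<psi> x) has_real_derivative F (un n x) * deriv \<psi> x + (F' (un n x) * vn n x) * \<psi> x) (at x)"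
          by (intro DERIV_mult' DERIV_chain2[OF F(1) un_deriv] smooth_DERIV test_fun_smooth \<psi>)
        then show "((\<lambda>x. F (un n x) * \<psi> x) has_vector_derivative F (un n x) * deriv \<psi> x + (F' (un n x) * \<psi> x) * vn n x) (at x)"
          by (simp add: has_real_derivative_iff_has_vector_derivative mult_ac)
        show "continuous_on UNIV (\<lambda>x. F (un n x) * deriv \<psi> x + (F' (un n x) * \<psi> x) * vn n x)"
          by (intro continuous_on_add c1 c2)
      qed (use R1 R2 in auto)
      then show ?thesis using i1 i2 by simp
    qed
    have lim1: "(\<lambda>n. LINT x|lborel. F (un n x) * deriv \<psi> x) \<longlonglongrightarrow> (LINT x|lborel. F (w x) * deriv \<psi> x)"
    proof (rule integral_dominated_convergence[where w="\<lambda>x. M * \<bar>deriv \<psi> x\<bar>"])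
      show "AE x in lborel. (\<lambda>n. F (un n x) * deriv \<psi> x) \<longlonglongrightarrow> F (w x) * deriv \<psi> x"
        using Fc un_lim by (intro AE_I2 tendsto_intros)
          (auto simp: continuous_on_eq_continuous_at intro: isCont_tendsto_compose)
      show "AE x in lborel. norm (F (un n x) * deriv \<psi> x) \<le> M * \<bar>deriv \<psi> x\<bar>" for n
        using M(2)[OF unB] by (auto simp: abs_mult intro!: mult_right_mono AE_I2)
      show "integrable lborel (\<lambda>x. M * \<bar>deriv \<psi> x\<bar>)"
        using test_fun_integrable[OF test_fun_deriv[OF \<psi>]] by auto
    qed measurable
    have bc: "cL2 (cx (\<lambda>x. F' (g x) * \<psi> x))" if "g \<in> borel_measurable borel" "\<And>x. \<bar>g x\<bar> \<le> B" for g
      using cL2_mult_bounded[OF cL2_test_fun[OF \<psi>], of "cx (\<lambda>x. F' (g x))" C] that C(2) by simp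
    \<comment> \<open>Both factors move: F'(un)\<psi> converges in L^2 by dominated convergence with
      majorant (2C)^2 \<psi>^2, and \<open>vn n\<close> by the Plancherel bound.\<close>
    have lim2: "(\<lambda>n. LINT x|lborel. cx (\<lambda>x. F' (un n x) * \<psi> x) x * cx (vn n) x) \<longlonglongrightarrow>
        (LINT x|lborel. cx (\<lambda>x. F' (w x) * \<psi> x) x * cx v x)"
    proof (rule cL2_pairing_tendsto2)
      have "(\<lambda>n. LINT x|lborel. (cmod (cx (\<lambda>x. F' (un n x) * \<psi> x) x - cx (\<lambda>x. F' (w x) * \<psi> x) x))^2) \<longlonglongrightarrow> integral\<^sup>L lborel (\<lambda>x::real. 0::real)"
      proof (rule integral_dominated_convergence[where w="\<lambda>x. 4 * C^2 * (cmod (cx \<psi> x))^2"])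
        show "integrable lborel (\<lambda>x. 4 * C^2 * (cmod (cx \<psi> x))^2)"
          using cL2_test_fun[OF \<psi>] by (auto simp: cL2_def)
        show "AE x in lborel. (\<lambda>n. (cmod (cx (\<lambda>x. F' (un n x) * \<psi> x) x - cx (\<lambda>x. F' (w x) * \<psi> x) x))^2) \<longlonglongrightarrow> 0"
        proof (intro AE_I2)
          fix x
          have "(\<lambda>n. F' (un n x)) \<longlonglongrightarrow> F' (w x)"
            using F(2) un_lim by (auto simp: continuous_on_eq_continuous_at intro: isCont_tendsto_compose)
          then have "(\<lambda>n. (cmod (cx (\<lambda>x. F' (un n x) * \<psi> x) x - cx (\<lambda>x. F' (w x) * \<psi> x) x))^2)
            \<longlonglongrightarrow> (cmod (cx (\<lambda>x. F' (w x) * \<psi> x) x - cx (\<lambda>x. F' (w x) * \<psi> x) x))^2"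
            by (intro tendsto_intros)
          then show "(\<lambda>n. (cmod (cx (\<lambda>x. F' (un n x) * \<psi> x) x - cx (\<lambda>x. F' (w x) * \<psi> x) x))^2) \<longlonglongrightarrow> 0" by simp
        qed
        show "AE x in lborel. norm ((cmod (cx (\<lambda>x. F' (un n x) * \<psi> x) x - cx (\<lambda>x. F' (w x) * \<psi> x) x))^2) \<le> 4 * C^2 * (cmod (cx \<psi> x))^2" for n
        proof (intro AE_I2)
          fix x
          have "\<bar>F' (un n x) - F' (w x)\<bar> \<le> 2 * C" using C(2)[OF unB[of n x]] C(2)[OF wB[of x]] by linarith
          then have "(F' (un n x) - F' (w x))^2 \<le> (2 * C)^2" using C(1) abs_le_square_iff[of "F' (un n x) - F' (w x)" "2 * C"] by simp
          from mult_right_mono[OF this zero_le_power2[of "\<psi> x"]]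
          have "((F' (un n x) - F' (w x)) * \<psi> x)^2 \<le> 4 * C^2 * (\<psi> x)^2" by (simp add: power_mult_distrib)
          then show "norm ((cmod (cx (\<lambda>x. F' (un n x) * \<psi> x) x - cx (\<lambda>x. F' (w x) * \<psi> x) x))^2) \<le> 4 * C^2 * (cmod (cx \<psi> x))^2"
            by (simp add: of_real_diff[symmetric] left_diff_distrib[symmetric] del: of_real_diff of_real_mult)
        qed
      qed measurable
      then show "(\<lambda>n. sqnorm (\<lambda>x. cx (\<lambda>x. F' (un n x) * \<psi> x) x - cx (\<lambda>x. F' (w x) * \<psi> x) x)) \<longlonglongrightarrow> 0"
        by (simp add: sqnorm_def)
      show "cL2 (cx (\<lambda>x. F' (un n x) * \<psi> x))" for n by (rule bc) (use unB in auto)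
      show "cL2 (cx (\<lambda>x. F' (w x) * \<psi> x))" by (rule bc) (use wB in auto)
      show "cL2 (cx (vn n))" for n by (rule is_fourierD(1)[OF vnV])
      show "cL2 (cx v)" by (rule is_fourierD(1)[OF V'])
    qed (rule vn_lim)
    have "complex_of_real (LINT x|lborel. F (un n x) * deriv \<psi> x) = - (LINT x|lborel. cx (\<lambda>x. F' (un n x) * \<psi> x) x * cx (vn n) x)" for n
      unfolding ip of_real_minus integral_complex_of_real[symmetric] by simp
    with tendsto_minus[OF lim2] have "(\<lambda>n. complex_of_real (LINT x|lborel. F (un n x) * deriv \<psi> x))
        \<longlonglongrightarrow> - (LINT x|lborel. cx (\<lambda>x. F' (w x) * \<psi> x) x * cx v x)" by simp
    moreover have "(\<lambda>n. complex_of_real (LINT x|lborel. F (un n x) * deriv \<psi> x)) \<longlonglongrightarrow> complex_of_real (LINT x|lborel. F (w x) * deriv \<psi> x)"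
      by (intro tendsto_of_real lim1)
    ultimately have "complex_of_real (LINT x|lborel. F (w x) * deriv \<psi> x) = - (LINT x|lborel. complex_of_real ((F' (w x) * \<psi> x) * v x))"
      using LIMSEQ_unique by simp
    also have "\<dots> = complex_of_real (- (LINT x|lborel. (F' (w x) * v x) * \<psi> x))"
      unfolding integral_complex_of_real by (simp add: mult_ac)
    finally show "(LINT x|lborel. F (w x) * deriv \<psi> x) = - (LINT x|lborel. (F' (w x) * v x) * \<psi> x)"
      unfolding of_real_eq_iff .
  qed
  then show ?thesis
    by (rule fourier_deriv_cong_AE) (use uw in \<open>auto elim: AE_mp\<close>)
qed

section \<open>Sobolev spaces of integer order\<close>

text \<open>Integer order is described by iterated derivatives because product and chain rules
  induct on them; agreement with the Fourier weights is shown in \<open>sobolev_imp_Hk\<close> and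
  \<open>Hk_imp_sobolev\<close>.\<close>

primrec Hk :: "nat \<Rightarrow> (real \<Rightarrow> real) \<Rightarrow> bool" where
  "Hk 0 u \<longleftrightarrow> L2 u"
| "Hk (Suc k) u \<longleftrightarrow> (\<exists>v. fourier_deriv u v \<and> Hk k v)"

lemma Hk_mono: "Hk (Suc k) u \<Longrightarrow> Hk k u"
proof (induction k arbitrary: u)
  case 0 then show ?case by (auto simp: fourier_deriv_def dest: is_fourierD(3))
next
  case (Suc k)
  obtain v where v: "fourier_deriv u v" "Hk (Suc k) v" using Suc.prems by auto
  have "Hk k v" by (rule Suc.IH[OF v(2)])
  with v(1) show ?case by auto
qed

lemma Hk_lincomb: "Hk k u \<Longrightarrow> Hk k v \<Longrightarrow> Hk k (\<lambda>x. a * u x + b * v x)"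
proof (induction k arbitrary: u v)
  case 0
  then show ?case
    using cL2_add[OF cL2_cmult[of "cx u" "of_real a"] cL2_cmult[of "cx v" "of_real b"]] cL2_cx_iff[of "\<lambda>x. a * u x + b * v x"]
    by (simp add: cL2_cx_iff)
next
  case (Suc k)
  obtain u' v' where "fourier_deriv u u'" "Hk k u'" "fourier_deriv v v'" "Hk k v'" using Suc.prems by auto
  then have "fourier_deriv (\<lambda>x. a * u x + b * v x) (\<lambda>x. a * u' x + b * v' x)" "Hk k (\<lambda>x. a * u' x + b * v' x)"
    by (auto intro: fourier_deriv_lincomb Suc.IH)
  then show ?case by auto
qed

lemma Hk_add: "Hk k u \<Longrightarrow> Hk k v \<Longrightarrow> Hk k (\<lambda>x. u x + v x)"
  using Hk_lincomb[of k u v 1 1] by simp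

text \<open>Polarisation, uv = ((u + v)^2 - (u - v)^2)/4, reduces the product rule to the chain rule
  for the square.\<close>

lemma fourier_deriv_mult:
  assumes u: "fourier_deriv u u'" and v: "fourier_deriv v v'"
  shows "fourier_deriv (\<lambda>x. u x * v x) (\<lambda>x. u' x * v x + u x * v' x)"
proof -
  have sq: "fourier_deriv (\<lambda>x. (w x)^2) (\<lambda>x. (2 * w x) * w' x)" if "fourier_deriv w w'" for w w'
    by (rule fourier_deriv_chain[OF that]) (auto intro!: derivative_eq_intros continuous_intros)
  have s: "fourier_deriv (\<lambda>x. (u x + v x)^2) (\<lambda>x. (2 * (u x + v x)) * (u' x + v' x))"
    using sq[OF fourier_deriv_lincomb[OF u v, of 1 1]] by simp
  have d: "fourier_deriv (\<lambda>x. (u x - v x)^2) (\<lambda>x. (2 * (u x - v x)) * (u' x - v' x))"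
    using sq[OF fourier_deriv_lincomb[OF u v, of 1 "-1"]] by simp
  have "(\<lambda>x. 1/4 * (u x + v x)^2 + (- 1/4) * (u x - v x)^2) = (\<lambda>x. u x * v x)"
    by (auto simp: fun_eq_iff power2_eq_square algebra_simps)
  moreover have "(\<lambda>x. 1/4 * ((2 * (u x + v x)) * (u' x + v' x)) + (- 1/4) * ((2 * (u x - v x)) * (u' x - v' x)))
      = (\<lambda>x. u' x * v x + u x * v' x)"
    by (auto simp: fun_eq_iff algebra_simps)
  ultimately show ?thesis using fourier_deriv_lincomb[OF s d, of "1/4" "-1/4"] by simp
qed

text \<open>The extra derivative of v supplies its boundedness at the bottom of the induction. In
  the second Leibniz term the roles are exchanged: v' is the rougher factor and u the smoother
  one.\<close>

lemma Hk_mult_Suc: "Hk j u \<Longrightarrow> Hk (Suc j) v \<Longrightarrow> Hk j (\<lambda>x. u x * v x)"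
proof (induction j arbitrary: u v)
  case 0
  obtain v' where "fourier_deriv v v'" using 0 by auto
  then obtain B where B: "AE x in lborel. \<bar>v x\<bar> \<le> B" using fourier_deriv_bounded by blast
  have "v \<in> borel_measurable borel" using Hk_mono[OF 0(2)] by (simp add: L2_def)
  from L2_mult_bounded_AE[OF _ this B, of u] 0 show ?case by (simp add: mult.commute)
next
  case (Suc j)
  obtain u' v' where d: "fourier_deriv u u'" "Hk j u'" "fourier_deriv v v'" "Hk (Suc j) v'" using Suc.prems by auto
  have "Hk j (\<lambda>x. u' x * v x)" by (rule Suc.IH[OF d(2) Hk_mono[OF Suc.prems(2)]])
  moreover have "Hk j (\<lambda>x. v' x * u x)" by (rule Suc.IH[OF Hk_mono[OF d(4)] Suc.prems(1)])
  ultimately have "Hk j (\<lambda>x. u' x * v x + u x * v' x)"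
    using Hk_add by (simp add: mult.commute[of "v' _"])
  with fourier_deriv_mult[OF d(1,3)] show ?case by auto
qed

text \<open>Each Leibniz term has one factor in H^k and one in H^(k+1), so
  \<open>Hk_mult_Suc\<close> covers both.\<close>

lemma Hk_algebra: assumes "Hk (Suc k) u" "Hk (Suc k) v" shows "Hk (Suc k) (\<lambda>x. u x * v x)"
proof -
  obtain u' v' where d: "fourier_deriv u u'" "Hk k u'" "fourier_deriv v v'" "Hk k v'" using assms by auto
  have "Hk k (\<lambda>x. u' x * v x)" "Hk k (\<lambda>x. v' x * u x)"
    by (rule Hk_mult_Suc[OF d(2) assms(2)] Hk_mult_Suc[OF d(4) assms(1)])+
  then have "Hk k (\<lambda>x. u' x * v x + u x * v' x)"
    using Hk_add by (simp add: mult.commute[of "v' _"])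
  with fourier_deriv_mult[OF d(1,3)] show ?thesis by auto
qed

section \<open>Composition with C^k functions\<close>

lemma Ck_mono: "Ck k f \<Longrightarrow> j \<le> k \<Longrightarrow> Ck j f"
  unfolding Ck_def by (elim exE, rule_tac x=D in exI) auto

lemma Ck_SucE: assumes "Ck (Suc k) f"
  obtains f' where "\<And>x. (f has_real_derivative f' x) (at x)" "continuous_on UNIV f'" "Ck k f'"
proof -
  obtain D where D: "D 0 = f" "\<And>j x. j < Suc k \<Longrightarrow> (D j has_real_derivative D (Suc j) x) (at x)"
    "\<And>j. j \<le> Suc k \<Longrightarrow> continuous_on UNIV (D j)"
    using assms unfolding Ck_def by blast
  show ?thesis
  proof (rule that[of "D 1"])
    show "(f has_real_derivative D 1 x) (at x)" for x using D(2)[of 0 x] D(1) by simp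
    show "continuous_on UNIV (D 1)" using D(3)[of 1] by simp
    show "Ck k (D 1)" unfolding Ck_def
      using D by (intro exI[of _ "\<lambda>j. D (Suc j)"]) simp
  qed
qed

lemma Ck_minus_const: assumes "Ck k f" shows "Ck k (\<lambda>x. f x - c)"
proof -
  obtain D where D: "D 0 = f" "\<And>j x. j < k \<Longrightarrow> (D j has_real_derivative D (Suc j) x) (at x)"
    "\<And>j. j \<le> k \<Longrightarrow> continuous_on UNIV (D j)"
    using assms unfolding Ck_def by blast
  show ?thesis unfolding Ck_def
  proof (intro exI[of _ "\<lambda>j. if j = 0 then (\<lambda>x. f x - c) else D j"] conjI allI impI)
    fix j x assume "j < k"
    from D(2)[OF this] show "((if j = 0 then \<lambda>x. f x - c else D j) has_real_derivative
       (if Suc j = 0 then \<lambda>x. f x - c else D (Suc j)) x) (at x)"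
      using D(1) by (auto intro!: derivative_eq_intros)
  next
    fix j assume "j \<le> k"
    from D(3)[OF this] show "continuous_on UNIV (if j = 0 then \<lambda>x. f x - c else D j)"
      using D(1) by (auto intro!: continuous_intros)
  qed simp
qed

text \<open>In (f(u))' = f'(u)u' the function f' need not vanish at 0, so f'(0) is subtracted: f'(u)
  - f'(0) falls under the induction hypothesis, the algebra property handles its product with u',
  and f'(0)u' is added back.\<close>

lemma Hk_compose: "Ck (Suc k) f \<Longrightarrow> f 0 = 0 \<Longrightarrow> Hk (Suc k) u \<Longrightarrow> Hk (Suc k) (\<lambda>x. f (u x))"
proof (induction k arbitrary: f)
  case 0
  obtain f' where f': "\<And>x. (f has_real_derivative f' x) (at x)" "continuous_on UNIV f'" using Ck_SucE[OF 0(1)] by blast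
  obtain u' where u': "fourier_deriv u u'" using 0 by auto
  have d: "fourier_deriv (\<lambda>x. f (u x)) (\<lambda>x. f' (u x) * u' x)"
    by (rule fourier_deriv_chain[OF u' f' 0(2)])
  then have "L2 (\<lambda>x. f' (u x) * u' x)" unfolding fourier_deriv_def using is_fourierD(3) by blast
  with d show ?case by auto
next
  case (Suc k)
  obtain f' where f': "\<And>x. (f has_real_derivative f' x) (at x)" "continuous_on UNIV f'" "Ck (Suc k) f'"
    using Ck_SucE[OF Suc.prems(1)] by blast
  obtain u' where u': "fourier_deriv u u'" "Hk (Suc k) u'" using Suc.prems by auto
  have d: "fourier_deriv (\<lambda>x. f (u x)) (\<lambda>x. f' (u x) * u' x)"
    by (rule fourier_deriv_chain[OF u'(1) f'(1,2) Suc.prems(2)])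
  have "Hk (Suc k) (\<lambda>x. f' (u x) - f' 0)"
    using Suc.IH[OF Ck_minus_const[OF f'(3)] _ Hk_mono[OF Suc.prems(3)], of "f' 0"] by simp
  from Hk_lincomb[OF Hk_algebra[OF this u'(2)] u'(2), of 1 "f' 0"]
  have "Hk (Suc k) (\<lambda>x. f' (u x) * u' x)" by (simp add: left_diff_distrib)
  with d show ?case by auto
qed

section \<open>Sobolev regularity as a weight on the Fourier side\<close>

definition weighted_L2 :: "real \<Rightarrow> (real \<Rightarrow> complex) \<Rightarrow> bool" where
  "weighted_L2 s U \<longleftrightarrow> integrable lborel (\<lambda>\<xi>. (1 + \<xi>^2) powr s * (cmod (U \<xi>))^2)"

lemma weighted_L2_bound:
  assumes "weighted_L2 s U" "V \<in> borel_measurable borel"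
    "\<And>\<xi>. (1 + \<xi>^2) powr t * (cmod (V \<xi>))^2 \<le> C * ((1 + \<xi>^2) powr s * (cmod (U \<xi>))^2)"
  shows "weighted_L2 t V"
  unfolding weighted_L2_def
proof (rule Bochner_Integration.integrable_bound)
  note [measurable] = assms(2)
  show "integrable lborel (\<lambda>\<xi>. C * ((1 + \<xi>^2) powr s * (cmod (U \<xi>))^2))"
    using assms(1) unfolding weighted_L2_def by (rule integrable_mult_right)
  show "(\<lambda>\<xi>. (1 + \<xi>^2) powr t * (cmod (V \<xi>))^2) \<in> borel_measurable lborel" by measurable
  show "AE \<xi> in lborel. norm ((1 + \<xi>^2) powr t * (cmod (V \<xi>))^2) \<le> norm (C * ((1 + \<xi>^2) powr s * (cmod (U \<xi>))^2))"
  proof (intro AE_I2)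
    fix \<xi>
    have "norm ((1 + \<xi>^2) powr t * (cmod (V \<xi>))^2) = (1 + \<xi>^2) powr t * (cmod (V \<xi>))^2" by simp
    also have "\<dots> \<le> norm (C * ((1 + \<xi>^2) powr s * (cmod (U \<xi>))^2))"
      using order_trans[OF assms(3)[of \<xi>] abs_ge_self] by simp
    finally show "norm ((1 + \<xi>^2) powr t * (cmod (V \<xi>))^2) \<le> norm (C * ((1 + \<xi>^2) powr s * (cmod (U \<xi>))^2))" .
  qed
qed

text \<open>Transforms are unique almost everywhere, so the existential quantifier in
  \<open>sobolev\<close> may be evaluated at any transform at hand.\<close>

lemma sobolev_iff: assumes U: "is_fourier u U" shows "sobolev s u \<longleftrightarrow> weighted_L2 s U"
proof
  assume "sobolev s u"
  then obtain V where V: "is_fourier u V" "weighted_L2 s V" unfolding sobolev_def weighted_L2_def by blast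
  note [measurable] = is_fourierD(4)[OF U] is_fourierD(4)[OF V(1)]
  have "integrable lborel (\<lambda>\<xi>. (1 + \<xi>^2) powr s * (cmod (U \<xi>))^2) \<longleftrightarrow> integrable lborel (\<lambda>\<xi>. (1 + \<xi>^2) powr s * (cmod (V \<xi>))^2)"
    by (rule Bochner_Integration.integrable_cong_AE) (use is_fourier_unique[OF U V(1)] in \<open>auto elim: AE_mp\<close>)
  then show "weighted_L2 s U" using V(2) by (simp add: weighted_L2_def)
qed (use U in \<open>auto simp: sobolev_def weighted_L2_def\<close>)

lemma weighted_L2_cL2: assumes "weighted_L2 s U" "0 \<le> s" "U \<in> borel_measurable borel" shows "cL2 U"
proof (rule cL2I_bound)
  show "integrable lborel (\<lambda>\<xi>. (1 + \<xi>^2) powr s * (cmod (U \<xi>))^2)" using assms(1) by (simp add: weighted_L2_def)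
  show "(cmod (U \<xi>))^2 \<le> (1 + \<xi>^2) powr s * (cmod (U \<xi>))^2" for \<xi>
    using mult_right_mono[OF ge_one_powr_ge_zero[of "1 + \<xi>^2" s] zero_le_power2[of "cmod (U \<xi>)"]] assms(2) by simp
qed (use assms in simp)

lemma weighted_L2_deriv: assumes "weighted_L2 (s + 1) U" "U \<in> borel_measurable borel"
  shows "weighted_L2 s (\<lambda>\<xi>. \<i> * complex_of_real \<xi> * U \<xi>)"
proof (rule weighted_L2_bound[OF assms(1), where C=1])
  show "(1 + \<xi>^2) powr s * (cmod (\<i> * complex_of_real \<xi> * U \<xi>))^2 \<le> 1 * ((1 + \<xi>^2) powr (s + 1) * (cmod (U \<xi>))^2)" for \<xi>
  proof -
    have "(1 + \<xi>^2) powr s * (cmod (\<i> * complex_of_real \<xi> * U \<xi>))^2 = (1 + \<xi>^2) powr s * (\<xi>^2 * (cmod (U \<xi>))^2)"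
      by (simp add: norm_mult power_mult_distrib)
    also have "\<dots> \<le> (1 + \<xi>^2) powr s * ((1 + \<xi>^2) * (cmod (U \<xi>))^2)"
      by (intro mult_left_mono mult_right_mono) auto
    also have "\<dots> = (1 + \<xi>^2) powr (s + 1) * (cmod (U \<xi>))^2"
      using one_plus_square_pos[of \<xi>] by (simp add: powr_add)
    finally show ?thesis by simp
  qed
qed (use assms(2) in measurable)

lemma deriv_hermitian: assumes "AE \<xi> in lborel. U (- \<xi>) = cnj (U \<xi>)"
  shows "AE \<xi> in lborel. \<i> * complex_of_real (- \<xi>) * U (- \<xi>) = cnj (\<i> * complex_of_real \<xi> * U \<xi>)"
  using assms by eventually_elim simp

lemma sobolev_imp_Hk: "sobolev (real k) u \<Longrightarrow> Hk k u"
proof (induction k arbitrary: u)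
  case 0 then show ?case by (auto simp: sobolev_def dest: is_fourierD(3))
next
  case (Suc k)
  obtain U where U: "is_fourier u U" using Suc.prems unfolding sobolev_def by blast
  note [measurable] = is_fourierD(4)[OF U]
  have "weighted_L2 (real k + 1) U" using Suc.prems sobolev_iff[OF U] by (simp add: add.commute)
  then have wV: "weighted_L2 (real k) (\<lambda>\<xi>. \<i> * complex_of_real \<xi> * U \<xi>)" by (rule weighted_L2_deriv) measurable
  have "cL2 (\<lambda>\<xi>. \<i> * complex_of_real \<xi> * U \<xi>)" by (rule weighted_L2_cL2[OF wV]) auto
  from is_fourier_inverse[OF this deriv_hermitian[OF is_fourier_hermitian[OF U]]]
  obtain v where v: "is_fourier v (\<lambda>\<xi>. \<i> * complex_of_real \<xi> * U \<xi>)" by blast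
  have "sobolev (real k) v" using sobolev_iff[OF v] wV by simp
  then have "Hk k v" by (rule Suc.IH)
  moreover have "fourier_deriv u v" unfolding fourier_deriv_def using U v by blast
  ultimately show ?case by auto
qed

lemma Hk_cL2_power: "Hk k u \<Longrightarrow> is_fourier u U \<Longrightarrow> cL2 (\<lambda>\<xi>. complex_of_real \<xi> ^ k * U \<xi>)"
proof (induction k arbitrary: u U)
  case 0 then show ?case by (simp add: is_fourierD(2))
next
  case (Suc k)
  obtain v where v: "fourier_deriv u v" "Hk k v" using Suc.prems by auto
  obtain V where V: "is_fourier u V" "is_fourier v (\<lambda>\<xi>. \<i> * complex_of_real \<xi> * V \<xi>)"
    using v(1) unfolding fourier_deriv_def by blast
  note [measurable] = is_fourierD(4)[OF Suc.prems(2)] is_fourierD(4)[OF V(1)]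
  from cL2_cmult[OF Suc.IH[OF v(2) V(2)], of "- \<i>"]
  have c: "cL2 (\<lambda>\<xi>. complex_of_real \<xi> ^ Suc k * V \<xi>)" by (simp add: mult_ac)
  show ?case
    by (rule cL2_cong_AE[OF c]) (use is_fourier_unique[OF V(1) Suc.prems(2)] in \<open>auto elim: AE_mp\<close>)
qed

lemma Hk_imp_sobolev: assumes "Hk k u" shows "sobolev (real k) u"
proof -
  have "L2 u" using assms by (cases k) (auto simp: fourier_deriv_def dest: is_fourierD(3))
  then obtain U where U: "is_fourier u U" using is_fourier_exists by blast
  note [measurable] = is_fourierD(4)[OF U]
  have "integrable lborel (\<lambda>\<xi>. 2^k * ((cmod (U \<xi>))^2 + (cmod (complex_of_real \<xi> ^ k * U \<xi>))^2))"
    using Hk_cL2_power[OF assms U] is_fourierD(2)[OF U] by (auto simp: cL2_def)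
  then have "weighted_L2 (real k) U"
    unfolding weighted_L2_def
  proof (rule Bochner_Integration.integrable_bound)
    show "AE \<xi> in lborel. norm ((1 + \<xi>^2) powr real k * (cmod (U \<xi>))^2)
       \<le> norm (2^k * ((cmod (U \<xi>))^2 + (cmod (complex_of_real \<xi> ^ k * U \<xi>))^2))"
    proof (intro AE_I2)
      fix \<xi> :: real
      \<comment> \<open>(1 + \<xi>^2)^k is at most 2^k where \<xi>^2 \<le> 1 and at most 2^k
        \<xi>^(2k) elsewhere.\<close>
      have "(1 + \<xi>^2) ^ k \<le> 2^k * (1 + (\<xi>^2)^k)"
      proof (cases "\<xi>^2 \<le> 1")
        case True
        have "(1 + \<xi>^2) ^ k \<le> (2::real)^k" using True by (intro power_mono) auto
        also have "\<dots> \<le> 2^k * (1 + (\<xi>^2)^k)" by simp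
        finally show ?thesis .
      next
        case False
        have "(1 + \<xi>^2) ^ k \<le> (2 * \<xi>^2)^k" using False by (intro power_mono) auto
        also have "\<dots> \<le> 2^k * (1 + (\<xi>^2)^k)" by (simp add: power_mult_distrib)
        finally show ?thesis .
      qed
      from mult_right_mono[OF this zero_le_power2[of "cmod (U \<xi>)"]]
      have "(1 + \<xi>^2) powr real k * (cmod (U \<xi>))^2 \<le> 2^k * ((cmod (U \<xi>))^2 + (cmod (complex_of_real \<xi> ^ k * U \<xi>))^2)"
        using one_plus_square_pos[of \<xi>] power_even_abs[of "2 * k" \<xi>]
        by (simp add: powr_realpow norm_mult norm_power power_mult_distrib distrib_right distrib_left power_mult[symmetric] mult.commute[of k] mult.assoc)
      then show "norm ((1 + \<xi>^2) powr real k * (cmod (U \<xi>))^2)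
       \<le> norm (2^k * ((cmod (U \<xi>))^2 + (cmod (complex_of_real \<xi> ^ k * U \<xi>))^2))" by simp
    qed
  qed measurable
  then show ?thesis using sobolev_iff[OF U] by simp
qed

section \<open>The embedding of \<open>H\<^sup>1\<^sup>/\<^sup>2\<close>\<close>

text \<open>A single term of the exponential series. It lets e^t, comparable to the frequency,
  absorb powers of its logarithm t.\<close>

lemma power_le_fact_exp: assumes "0 \<le> (x::real)" shows "x ^ n \<le> fact n * exp x"
proof -
  have "(\<Sum>i\<in>{n}. inverse (fact i) * x ^ i) \<le> (\<Sum>i. inverse (fact i) * x ^ i)"
    using summable_exp[of x] assms by (intro sum_le_suminf) auto
  also have "\<dots> = exp x" by (simp add: exp_def divide_inverse_commute scaleR_conv_of_real divide_inverse mult.commute)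
  finally show ?thesis by (simp add: field_simps)
qed

text \<open>Cauchy-Schwarz with the factors (1 + \<xi>^2)^(-1/4) and (1 + \<xi>^2)^(1/4). The
  integral of (1 + \<xi>^2)^(-1/2) over [-A, A] is 2 arsinh A, and its logarithmic growth reflects
  the borderline failure of the embedding into L^\<infinity>.\<close>

lemma low_frequency_bound:
  assumes \<Phi>: "cL2 \<Phi>" and w: "weighted_L2 (1/2) \<Phi>" and A: "0 \<le> A"
  shows "(LINT \<xi>|lborel. cmod (trunc A \<Phi> \<xi>)) \<le> sqrt (2 * arsinh A * (LINT \<xi>|lborel. (1 + \<xi>^2) powr (1/2) * (cmod (\<Phi> \<xi>))^2))"
proof -
  note [measurable] = cL2_meas[OF \<Phi>]
  define r where "r \<xi> = sqrt (sqrt (1 + \<xi>^2))" for \<xi> :: real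
  have r0: "r \<xi> > 0" for \<xi> unfolding r_def using one_plus_square_pos[of \<xi>] by simp
  have r2: "(r \<xi>)^2 = sqrt (1 + \<xi>^2)" for \<xi> unfolding r_def by simp
  have [measurable]: "r \<in> borel_measurable borel" unfolding r_def by measurable
  define a where "a = trunc A (\<lambda>\<xi>. complex_of_real (1 / r \<xi>))"
  define b where "b \<xi> = complex_of_real (r \<xi>) * \<Phi> \<xi>" for \<xi>
  have [measurable]: "a \<in> borel_measurable borel" unfolding a_def by (intro trunc_measurable) measurable
  have asq: "(cmod (a \<xi>))^2 = indicator {-A..A} \<xi> *\<^sub>R (1 / sqrt (\<xi>^2 + 1))" for \<xi>
    using r2[of \<xi>] r0[of \<xi>] by (simp add: a_def trunc_def norm_divide power_divide add.commute)
  have "(LINT \<xi>|lborel. indicator {-A..A} \<xi> *\<^sub>R (1 / sqrt (\<xi>^2 + 1))) = arsinh A - arsinh (- A)"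
  proof (rule integral_FTC_atLeastAtMost)
    show "(arsinh has_vector_derivative 1 / sqrt (x\<^sup>2 + 1)) (at x within {- A..A})" for x
      using arsinh_real_has_field_derivative[of x] by (simp add: has_real_derivative_iff_has_vector_derivative)
    have "x^2 + 1 \<noteq> 0" for x :: real using one_plus_square_pos[of x] by linarith
    then show "continuous_on {- A..A} (\<lambda>x. 1 / sqrt (x\<^sup>2 + 1))" by (intro continuous_intros) auto
  qed (use A in simp)
  then have na: "sqnorm a = 2 * arsinh A" unfolding sqnorm_def asq by simp
  have ac: "cL2 a" unfolding cL2_def
  proof
    show "integrable lborel (\<lambda>\<xi>. (cmod (a \<xi>))^2)"
    proof (rule bounded_support_integrable[where C=1 and R=A])
      show "norm ((cmod (a \<xi>))^2) \<le> 1" for \<xi>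
        using one_plus_square_pos[of \<xi>] unfolding asq by (auto simp: indicator_def divide_le_eq add.commute)
    qed (auto simp: asq indicator_def)
  qed simp
  have bsq: "(cmod (b \<xi>))^2 = (1 + \<xi>^2) powr (1/2) * (cmod (\<Phi> \<xi>))^2" for \<xi>
    by (simp add: b_def norm_mult power_mult_distrib r2 powr_half_sqrt)
  have bc: "cL2 b" using w unfolding cL2_def bsq weighted_L2_def by (simp add: b_def[abs_def])
  have "a \<xi> * b \<xi> = trunc A \<Phi> \<xi>" for \<xi>
    using r0[of \<xi>] by (simp add: a_def b_def trunc_def)
  then have "(LINT \<xi>|lborel. cmod (trunc A \<Phi> \<xi>))^2 \<le> sqnorm a * sqnorm b"
    using cL2_CS_norm[OF ac bc] by simp
  moreover have "sqnorm b = (LINT \<xi>|lborel. (1 + \<xi>^2) powr (1/2) * (cmod (\<Phi> \<xi>))^2)"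
    unfolding sqnorm_def bsq ..
  ultimately show ?thesis unfolding na by (intro real_le_rsqrt) simp
qed

text \<open>The level-set argument of Chemin and Xu: at height \<open>j\<close> the function is split at a frequency
  whose low part is bounded by \<open>j / 2\<close>, so the level set is controlled by the high part in \<open>L\<^sup>2\<close>.\<close>
lemma half_sobolev_level_set:
  assumes \<phi>: "is_fourier \<phi> \<Phi>" and A: "0 \<le> A"
    and low: "(LINT \<xi>|lborel. cmod (trunc A \<Phi> \<xi>)) \<le> j / 2" and j: "1 \<le> j"
  shows "(\<integral>\<^sup>+x. indicator {x. j < \<bar>\<phi> x\<bar>} x \<partial>lborel) \<le> 4 * (\<integral>\<^sup>+\<xi>. indicator {\<xi>. A < \<bar>\<xi>\<bar>} \<xi> * ennreal ((cmod (\<Phi> \<xi>))^2) \<partial>lborel)"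
proof -
  note \<Phi> = is_fourierD(2)[OF \<phi>]
  note [measurable] = is_fourierD(4,5)[OF \<phi>]
  define l where "l = ift (trunc A \<Phi>)"
  have l: "is_fourier l (trunc A \<Phi>)" unfolding l_def
    by (rule is_fourier_ift[OF cL2_trunc[OF \<Phi>] trunc_integrable[OF \<Phi>] trunc_hermitian[OF is_fourier_hermitian[OF \<phi>]]])
  note [measurable] = is_fourierD(5)[OF l]
  have lb: "\<bar>l x\<bar> \<le> j / 2" for x unfolding l_def using ift_bound low by (rule order_trans)
  note h = is_fourier_diff[OF \<phi> l]
  have "(\<integral>\<^sup>+x. indicator {x. j < \<bar>\<phi> x\<bar>} x \<partial>lborel) \<le> (\<integral>\<^sup>+x. 4 * ennreal (cmod (cx (\<lambda>x. \<phi> x - l x) x))^2 \<partial>lborel)"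
  proof (rule nn_integral_mono)
    fix x
    show "indicator {x. j < \<bar>\<phi> x\<bar>} x \<le> 4 * ennreal (cmod (cx (\<lambda>x. \<phi> x - l x) x))^2"
    proof (cases "j < \<bar>\<phi> x\<bar>")
      case True
      \<comment> \<open>Of the lower bound j/2 for |\<phi> - l| only 1/2 is kept, whence the
        constant 4. The lost powers of j are harmless because the cutoffs chosen later grow faster
        than any power of j.\<close>
      then have "1 / 2 \<le> \<bar>\<phi> x - l x\<bar>" using lb[of x] j by linarith
      then have "(1/2)^2 \<le> \<bar>\<phi> x - l x\<bar>^2" by (intro power_mono) auto
      then have "ennreal 1 \<le> ennreal (4 * \<bar>\<phi> x - l x\<bar>^2)" by (intro ennreal_leI) (simp add: power2_eq_square)
      also have "\<dots> = 4 * ennreal (cmod (cx (\<lambda>x. \<phi> x - l x) x))^2"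
        by (simp only: norm_of_real ennreal_power abs_ge_zero) (simp add: ennreal_mult)
      finally show ?thesis using True by simp
    qed simp
  qed
  also have "\<dots> = 4 * ennreal (sqnorm (cx (\<lambda>x. \<phi> x - l x)))"
    unfolding nn_sqnorm[OF is_fourierD(1)[OF h], symmetric] by (rule nn_integral_cmult) measurable
  also have "\<dots> \<le> 4 * ennreal (sqnorm (\<lambda>\<xi>. \<Phi> \<xi> - trunc A \<Phi> \<xi>))"
    by (intro mult_left_mono ennreal_leI is_fourier_plancherel_le[OF h]) auto
  also have "ennreal (sqnorm (\<lambda>\<xi>. \<Phi> \<xi> - trunc A \<Phi> \<xi>)) = (\<integral>\<^sup>+\<xi>. indicator {\<xi>. A < \<bar>\<xi>\<bar>} \<xi> * ennreal ((cmod (\<Phi> \<xi>))^2) \<partial>lborel)"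
    unfolding nn_sqnorm[OF is_fourierD(2)[OF h], symmetric]
    by (intro nn_integral_cong) (auto simp: trunc_def indicator_def ennreal_power)
  finally show ?thesis .
qed

text \<open>The cutoffs grow like exp(j^2/D), so at most Dt + 1 of them lie below |\<xi>|, where t =
  arsinh |\<xi>|. The sum is therefore bounded by a power of 1 + t, and every power of this
  logarithm is dominated by sqrt(1 + \<xi>^2), the weight of H^(1/2).\<close>

lemma half_sobolev_weight_sum:
  assumes D: "D > 0"
  shows "\<exists>C\<ge>0. \<forall>\<xi>. (\<Sum>j. ennreal (real (j + 2) ^ N) * indicator {\<xi>. sinh (real (Suc j)^2 / D) < \<bar>\<xi>\<bar>} \<xi>) \<le> ennreal (C * sqrt (1 + \<xi>^2))"
proof (intro exI conjI allI)
  \<comment> \<open>(D + 2)^(N+1) arises from bounding both j + 2 and the number of terms by (D +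
    2)(1 + t), the factorial and e from (1 + t)^(N+1) \<le> (N+1)! e^(1+t), and 2 from e^t \<le> 2
    cosh t = 2 sqrt(1 + \<xi>^2).\<close>
  let ?C = "(D + 2)^Suc N * fact (Suc N) * (exp 1 * 2)"
  show "0 \<le> ?C" using D by simp
  fix \<xi> :: real
  define t where "t = arsinh \<bar>\<xi>\<bar>"
  have t0: "0 \<le> t" unfolding t_def using arsinh_real_pos_iff[of "\<bar>\<xi>\<bar>"] by (cases "\<xi> = 0") (auto simp: less_imp_le)
  \<comment> \<open>Terms with j \<ge> m vanish, since Dt < m \<le> j + 1 \<le> (j + 1)^2; counting
    with j + 1 instead of its square is wasteful but suffices.\<close>
  define m where "m = nat \<lfloor>D * t\<rfloor> + 1"
  have mb: "real m \<le> D * t + 1" using D t0 by (simp add: m_def)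
  have zero: "ennreal (real (j + 2) ^ N) * indicator {\<xi>. sinh (real (Suc j)^2 / D) < \<bar>\<xi>\<bar>} \<xi> = 0" if "j \<notin> {..<m}" for j
  proof -
    have "D * t < real m" using D t0 by (simp add: m_def) linarith
    also have "real m \<le> real (Suc j)" using that by simp
    also have "real (Suc j) * 1 \<le> real (Suc j) * real (Suc j)" by (intro mult_left_mono) auto
    finally have "t \<le> real (Suc j)^2 / D" using D by (simp add: field_simps power2_eq_square)
    then have "\<not> arsinh (sinh (real (Suc j)^2 / D)) < t" unfolding arsinh_sinh_real by simp
    then have "\<not> sinh (real (Suc j)^2 / D) < \<bar>\<xi>\<bar>" unfolding t_def by simp
    then show ?thesis by simp
  qed
  have "(\<Sum>j. ennreal (real (j + 2) ^ N) * indicator {\<xi>. sinh (real (Suc j)^2 / D) < \<bar>\<xi>\<bar>} \<xi>)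
     = (\<Sum>j<m. ennreal (real (j + 2) ^ N) * indicator {\<xi>. sinh (real (Suc j)^2 / D) < \<bar>\<xi>\<bar>} \<xi>)"
    by (rule suminf_finite) (use zero in auto)
  also have "\<dots> \<le> (\<Sum>j<m. ennreal (((D + 2) * (1 + t)) ^ N))"
  proof (rule sum_mono)
    fix j assume j: "j \<in> {..<m}"
    have "ennreal (real (j + 2) ^ N) * indicator {\<xi>. sinh (real (Suc j)^2 / D) < \<bar>\<xi>\<bar>} \<xi> \<le> ennreal (real (j + 2) ^ N)"
      by (auto simp: indicator_def)
    also have "\<dots> \<le> ennreal (((D + 2) * (1 + t)) ^ N)"
    proof (intro ennreal_leI power_mono)
      have "real (j + 2) \<le> real m + 1" using j by simp
      also have "\<dots> \<le> D * t + 2" using mb by simp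
      also have "\<dots> \<le> (D + 2) * (1 + t)" using D t0 by (simp add: algebra_simps)
      finally show "real (j + 2) \<le> (D + 2) * (1 + t)" .
    qed simp
    finally show "ennreal (real (j + 2) ^ N) * indicator {\<xi>. sinh (real (Suc j)^2 / D) < \<bar>\<xi>\<bar>} \<xi> \<le> ennreal (((D + 2) * (1 + t)) ^ N)" .
  qed
  also have "\<dots> = ennreal (real m * ((D + 2) * (1 + t)) ^ N)"
    by (simp add: ennreal_mult' ennreal_of_nat_eq_real_of_nat)
  also have "\<dots> \<le> ennreal (?C * sqrt (1 + \<xi>^2))"
  proof (rule ennreal_leI)
    have "real m \<le> (D + 2) * (1 + t)" using mb D t0 by (simp add: algebra_simps)
    then have "real m * ((D + 2) * (1 + t)) ^ N \<le> ((D + 2) * (1 + t)) * ((D + 2) * (1 + t)) ^ N"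
      using D t0 by (intro mult_right_mono) auto
    also have "\<dots> = (D + 2)^Suc N * (1 + t) ^ Suc N" by (simp add: power_mult_distrib)
    also have "\<dots> \<le> (D + 2)^Suc N * (fact (Suc N) * exp (1 + t))"
      using D t0 by (intro mult_left_mono power_le_fact_exp) auto
    also have "\<dots> = (D + 2)^Suc N * fact (Suc N) * exp 1 * exp t" by (simp add: exp_add)
    also have "\<dots> \<le> (D + 2)^Suc N * fact (Suc N) * exp 1 * (2 * sqrt (1 + \<xi>^2))"
    proof (rule mult_left_mono)
      have "exp t \<le> 2 * cosh t" by (simp add: cosh_def)
      then show "exp t \<le> 2 * sqrt (1 + \<xi>^2)" unfolding t_def cosh_arsinh_real by (simp add: add.commute)
    qed (use D in simp)
    finally show "real m * ((D + 2) * (1 + t)) ^ N \<le> ?C * sqrt (1 + \<xi>^2)" by (simp add: mult_ac)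
  qed
  finally show "(\<Sum>j. ennreal (real (j + 2) ^ N) * indicator {\<xi>. sinh (real (Suc j)^2 / D) < \<bar>\<xi>\<bar>} \<xi>) \<le> ennreal (?C * sqrt (1 + \<xi>^2))" .
qed

text \<open>Integer layers: |\<phi>|^N is at most \<phi>^2 plus the sum of (j + 2)^N over the levels
  j + 1 that |\<phi>| exceeds. Each level set is estimated with its own cutoff, and exchanging sum
  and integral leaves a frequency weight bounded by that of H^(1/2).\<close>

lemma half_sobolev_embedding:
  assumes "sobolev (1/2) \<phi>" and N: "2 \<le> N"
  shows "integrable lborel (\<lambda>x. \<bar>\<phi> x\<bar> ^ N)"
proof -
  obtain \<Phi> where \<phi>: "is_fourier \<phi> \<Phi>" using assms unfolding sobolev_def by blast
  have w: "weighted_L2 (1/2) \<Phi>" using sobolev_iff[OF \<phi>] assms by blast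
  note [measurable] = is_fourierD(4,5)[OF \<phi>]
  define K where "K = (LINT \<xi>|lborel. (1 + \<xi>^2) powr (1/2) * (cmod (\<Phi> \<xi>))^2)"
  have K: "0 \<le> K" unfolding K_def by (intro integral_nonneg_AE) auto
  \<comment> \<open>Chosen so that 2 arsinh(\<open>A j\<close>) K = ((j+1)/2)^2 K/(K+1), which keeps
    the low part at level j + 1 below half that level; K + 1 instead of K keeps D positive when K =
    0.\<close>
  define D where "D = 8 * (K + 1)"
  have D: "D > 0" using K by (simp add: D_def)
  define A where "A j = sinh (real (Suc j)^2 / D)" for j
  have A0: "0 \<le> A j" for j using D by (simp add: A_def)
  obtain C where C: "C \<ge> 0" "\<And>\<xi>. (\<Sum>j. ennreal (real (j + 2) ^ N) * indicator {\<xi>. A j < \<bar>\<xi>\<bar>} \<xi>) \<le> ennreal (C * sqrt (1 + \<xi>^2))"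
    using half_sobolev_weight_sum[OF D, of N] unfolding A_def by blast
  have low: "(LINT \<xi>|lborel. cmod (trunc (A j) \<Phi> \<xi>)) \<le> real (Suc j) / 2" for j
  proof -
    have "(LINT \<xi>|lborel. cmod (trunc (A j) \<Phi> \<xi>)) \<le> sqrt (2 * arsinh (A j) * K)"
      unfolding K_def by (rule low_frequency_bound[OF is_fourierD(2)[OF \<phi>] w A0])
    also have "2 * arsinh (A j) * K = (real (Suc j) / 2)^2 * (K / (K + 1))"
      using K by (simp add: A_def arsinh_sinh_real D_def power_divide field_simps)
    also have "sqrt \<dots> \<le> sqrt ((real (Suc j) / 2)^2 * 1)"
      using K by (intro real_sqrt_le_mono mult_left_mono) auto
    also have "\<dots> = real (Suc j) / 2" by simp
    finally show ?thesis .
  qed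
  have point: "ennreal (\<bar>\<phi> x\<bar> ^ N) \<le> ennreal ((\<phi> x)^2) + (\<Sum>j. ennreal (real (j + 2) ^ N) * indicator {x. real (Suc j) < \<bar>\<phi> x\<bar>} x)" for x
  proof (cases "\<bar>\<phi> x\<bar> \<le> 1")
    case True
    then have "\<bar>\<phi> x\<bar> ^ N \<le> \<bar>\<phi> x\<bar> ^ 2" using N by (intro power_decreasing) auto
    then have "ennreal (\<bar>\<phi> x\<bar> ^ N) \<le> ennreal ((\<phi> x)^2)" by (intro ennreal_leI) simp
    then show ?thesis by (rule order_trans) simp
  next
    case False
    \<comment> \<open>The index with j + 1 < |\<phi>| \<le> j + 2; it is natural because |\<phi>| >
      1 makes the ceiling at least 2.\<close>
    define j where "j = nat (\<lceil>\<bar>\<phi> x\<bar>\<rceil> - 2)"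
    have ge: "2 \<le> \<lceil>\<bar>\<phi> x\<bar>\<rceil>" using False by linarith
    have j1: "real (Suc j) < \<bar>\<phi> x\<bar>" using ge unfolding j_def by linarith
    have j2: "\<bar>\<phi> x\<bar> \<le> real (j + 2)" using ge unfolding j_def by linarith
    have "ennreal (\<bar>\<phi> x\<bar> ^ N) \<le> (\<Sum>j\<in>{j}. ennreal (real (j + 2) ^ N) * indicator {x. real (Suc j) < \<bar>\<phi> x\<bar>} x)"
      using j1 j2 by (simp add: ennreal_leI power_mono)
    also have "\<dots> \<le> (\<Sum>j. ennreal (real (j + 2) ^ N) * indicator {x. real (Suc j) < \<bar>\<phi> x\<bar>} x)"
      by (intro sum_le_suminf) auto
    finally show ?thesis by (rule order_trans) simp
  qed
  have "(\<integral>\<^sup>+x. ennreal (\<bar>\<phi> x\<bar> ^ N) \<partial>lborel)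
     \<le> (\<integral>\<^sup>+x. ennreal ((\<phi> x)^2) + (\<Sum>j. ennreal (real (j + 2) ^ N) * indicator {x. real (Suc j) < \<bar>\<phi> x\<bar>} x) \<partial>lborel)"
    by (intro nn_integral_mono point)
  also have "\<dots> = (\<integral>\<^sup>+x. ennreal ((\<phi> x)^2) \<partial>lborel) + (\<Sum>j. ennreal (real (j + 2) ^ N) * (\<integral>\<^sup>+x. indicator {x. real (Suc j) < \<bar>\<phi> x\<bar>} x \<partial>lborel))"
    by (subst nn_integral_add) (auto simp: nn_integral_suminf nn_integral_cmult)
  also have "\<dots> \<le> (\<integral>\<^sup>+x. ennreal ((\<phi> x)^2) \<partial>lborel) + (\<Sum>j. ennreal (real (j + 2) ^ N) *
      (4 * (\<integral>\<^sup>+\<xi>. indicator {\<xi>. A j < \<bar>\<xi>\<bar>} \<xi> * ennreal ((cmod (\<Phi> \<xi>))^2) \<partial>lborel)))"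
    by (intro add_left_mono suminf_le mult_left_mono half_sobolev_level_set[OF \<phi> A0 low]) auto
  also have "(\<Sum>j. ennreal (real (j + 2) ^ N) * (4 * (\<integral>\<^sup>+\<xi>. indicator {\<xi>. A j < \<bar>\<xi>\<bar>} \<xi> * ennreal ((cmod (\<Phi> \<xi>))^2) \<partial>lborel)))
     = (\<integral>\<^sup>+\<xi>. (\<Sum>j. ennreal (real (j + 2) ^ N) * (4 * (indicator {\<xi>. A j < \<bar>\<xi>\<bar>} \<xi> * ennreal ((cmod (\<Phi> \<xi>))^2)))) \<partial>lborel)"
    by (subst nn_integral_suminf) (auto simp: nn_integral_cmult)
  also have "\<dots> = (\<integral>\<^sup>+\<xi>. 4 * ennreal ((cmod (\<Phi> \<xi>))^2) * (\<Sum>j. ennreal (real (j + 2) ^ N) * indicator {\<xi>. A j < \<bar>\<xi>\<bar>} \<xi>) \<partial>lborel)"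
    by (rule nn_integral_cong, subst ennreal_suminf_cmult[symmetric], rule suminf_cong) (simp add: mult_ac)
  also have "\<dots> \<le> (\<integral>\<^sup>+\<xi>. 4 * ennreal ((cmod (\<Phi> \<xi>))^2) * ennreal (C * sqrt (1 + \<xi>^2)) \<partial>lborel)"
    by (intro nn_integral_mono mult_left_mono C(2)) auto
  also have "\<dots> = (\<integral>\<^sup>+\<xi>. ennreal (4 * C * ((1 + \<xi>^2) powr (1/2) * (cmod (\<Phi> \<xi>))^2)) \<partial>lborel)"
  proof (rule nn_integral_cong)
    fix \<xi> :: real
    have "4 * ennreal a * ennreal b = ennreal (4 * a * b)" if "0 \<le> a" "0 \<le> b" for a b
      using that by (simp add: ennreal_mult)
    from this[of "(cmod (\<Phi> \<xi>))^2" "C * sqrt (1 + \<xi>^2)"]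
    show "4 * ennreal ((cmod (\<Phi> \<xi>))^2) * ennreal (C * sqrt (1 + \<xi>^2)) = ennreal (4 * C * ((1 + \<xi>^2) powr (1/2) * (cmod (\<Phi> \<xi>))^2))"
      using C(1) by (simp add: powr_half_sqrt mult_ac)
  qed
  finally have "(\<integral>\<^sup>+x. ennreal (\<bar>\<phi> x\<bar> ^ N) \<partial>lborel) \<le> (\<integral>\<^sup>+x. ennreal ((\<phi> x)^2) \<partial>lborel)
     + (\<integral>\<^sup>+\<xi>. ennreal (4 * C * ((1 + \<xi>^2) powr (1/2) * (cmod (\<Phi> \<xi>))^2)) \<partial>lborel)" by (auto intro: add_left_mono)
  also have "\<dots> < \<infinity>"
  proof -
    have "integrable lborel (\<lambda>\<xi>. 4 * C * ((1 + \<xi>^2) powr (1/2) * (cmod (\<Phi> \<xi>))^2))"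
      using w unfolding weighted_L2_def by (intro integrable_mult_right) auto
    then have "(\<integral>\<^sup>+\<xi>. ennreal (4 * C * ((1 + \<xi>^2) powr (1/2) * (cmod (\<Phi> \<xi>))^2)) \<partial>lborel) < \<infinity>"
      using C(1) by (subst nn_integral_eq_integral) auto
    moreover have "(\<integral>\<^sup>+x. ennreal ((\<phi> x)^2) \<partial>lborel) < \<infinity>"
      using is_fourierD(3)[OF \<phi>] unfolding L2_def by (subst nn_integral_eq_integral) auto
    ultimately show ?thesis by (simp add: ennreal_add_less_top)
  qed
  finally show ?thesis by (intro integrableI_bounded) auto
qed

section \<open>Regularity of solitary waves\<close>

text \<open>With 3a = c_* one has 4a^3 = \<beta>^2 \<gamma>, and \<beta>^2 (\<beta>t^3 + \<gamma> -
  3at^2) factors as (\<beta>t - 2a)^2 (\<beta>t + a): the mean inequality as an identity, with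
  equality at t = 2a/\<beta>.\<close>

lemma dispersion_positive:
  fixes \<beta> \<gamma> c :: real
  assumes b: "\<beta> > 0" and g: "\<gamma> > 0" and c: "c < 3 * (\<beta>^2 * \<gamma> / 4) powr (1/3)"
  shows "\<exists>\<kappa>>0. \<forall>t\<ge>0. \<kappa> * (1 + t^2) powr (3/2) \<le> \<beta> * t^3 - c * t^2 + \<gamma>"
proof -
  define a where "a = (\<beta>^2 * \<gamma> / 4) powr (1/3)"
  have a0: "a > 0" using b g by (simp add: a_def)
  have "a^3 = ((\<beta>^2 * \<gamma> / 4) powr (1/3)) powr 3" unfolding a_def using b g by (simp add: powr_numeral)
  also have "\<dots> = \<beta>^2 * \<gamma> / 4" using b g by (simp add: powr_powr)
  finally have a3: "4 * a^3 = \<beta>^2 * \<gamma>" by simp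
  have amgm: "3 * a * t^2 \<le> \<beta> * t^3 + \<gamma>" if "t \<ge> 0" for t
  proof -
    have "0 \<le> (\<beta> * t - 2 * a)^2 * (\<beta> * t + a)" using that b a0 by simp
    also have "\<dots> = \<beta>^2 * (\<beta> * t^3) - 3 * a * (\<beta>^2 * t^2) + 4 * a^3"
      by (simp add: power2_eq_square power3_eq_cube algebra_simps)
    also have "\<dots> = \<beta>^2 * (\<beta> * t^3 + \<gamma> - 3 * a * t^2)"
      unfolding a3 by (simp add: algebra_simps)
    finally show ?thesis using b by (simp add: zero_le_mult_iff)
  qed
  \<comment> \<open>As c < 3a, a fraction 1 - \<theta> of \<beta>t^3 + \<gamma> survives the
    subtraction of ct^2. The maximum covers negative c, where nothing has to be absorbed.\<close>
  define \<theta> where "\<theta> = max c 0 / (3 * a)"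
  have \<theta>: "0 \<le> \<theta>" "\<theta> < 1" using c a0 unfolding \<theta>_def a_def[symmetric] by (auto simp: divide_less_eq)
  define \<mu> where "\<mu> = min \<beta> \<gamma>"
  have mu: "\<mu> > 0" using b g by (simp add: \<mu>_def)
  show ?thesis
  proof (intro exI[of _ "(1 - \<theta>) * \<mu> / 4"] conjI allI impI)
    show "0 < (1 - \<theta>) * \<mu> / 4" using \<theta> mu by simp
    fix t :: real assume t: "0 \<le> t"
    have "(1 + t^2) powr (3/2) = (sqrt (1 + t^2))^3"
    proof -
      have "(sqrt (1 + t^2))^3 = ((1 + t^2) powr (1/2)) powr 3"
        using one_plus_square_pos[of t] by (simp add: powr_half_sqrt powr_numeral)
      then show ?thesis by (simp add: powr_powr)
    qed
    also have "\<dots> \<le> (1 + t)^3"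
      using t by (intro power_mono real_le_lsqrt) (auto simp: power2_sum)
    also have "\<dots> \<le> 4 * (1 + t^3)"
    proof -
      \<comment> \<open>Exactly, 4(1 + t^3) - (1 + t)^3 = 3(1 - t)^2 (1 + t).\<close>
      have "0 \<le> 3 * ((1 - t)^2 * (1 + t))" using t by simp
      then show ?thesis by (simp add: power2_eq_square power3_eq_cube algebra_simps)
    qed
    finally have 1: "(1 + t^2) powr (3/2) \<le> 4 * (1 + t^3)" .
    have "(1 - \<theta>) * \<mu> / 4 * (1 + t^2) powr (3/2) \<le> (1 - \<theta>) * \<mu> / 4 * (4 * (1 + t^3))"
      using \<theta> mu by (intro mult_left_mono 1) auto
    also have "\<dots> = (1 - \<theta>) * (\<mu> * t^3 + \<mu>)" by (simp add: field_simps)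
    also have "\<dots> \<le> (1 - \<theta>) * (\<beta> * t^3 + \<gamma>)"
      using \<theta> t by (intro mult_left_mono add_mono mult_right_mono) (auto simp: \<mu>_def)
    also have "\<dots> = \<beta> * t^3 + \<gamma> - \<theta> * (\<beta> * t^3 + \<gamma>)" by (simp add: algebra_simps)
    also have "\<dots> \<le> \<beta> * t^3 + \<gamma> - c * t^2"
    proof -
      have "c * t^2 \<le> max c 0 * t^2" by (intro mult_right_mono) auto
      also have "\<dots> = \<theta> * (3 * a * t^2)" using a0 by (simp add: \<theta>_def)
      also have "\<dots> \<le> \<theta> * (\<beta> * t^3 + \<gamma>)" by (intro mult_left_mono amgm t \<theta>)
      finally show ?thesis by simp
    qed
    finally show "(1 - \<theta>) * \<mu> / 4 * (1 + t^2) powr (3/2) \<le> \<beta> * t^3 - c * t^2 + \<gamma>" by simp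
  qed
qed

section \<open>The nonlinearity in L^2\<close>

text \<open>Scaling by |s| reduces every value to f(1) or f(-1); at the origin, f(0) = 2^p f(0) with
  2^p > 1.\<close>

lemma homogeneous_growth:
  fixes f :: "real \<Rightarrow> real"
  assumes p: "p > 0" and f: "\<forall>l s. l > 0 \<longrightarrow> f (l * s) = l powr p * f s"
  shows "f 0 = 0" "\<bar>f s\<bar> \<le> (\<bar>f 1\<bar> + \<bar>f (- 1)\<bar>) * \<bar>s\<bar> powr p"
proof -
  have "f (2 * 0) = 2 powr p * f 0" using f by (metis zero_less_numeral)
  moreover have "(2::real) powr p > 1" using p by simp
  ultimately show f0: "f 0 = 0" using p by simp
  consider "s = 0" | "s > 0" | "s < 0" by linarith
  then show "\<bar>f s\<bar> \<le> (\<bar>f 1\<bar> + \<bar>f (- 1)\<bar>) * \<bar>s\<bar> powr p"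
  proof cases
    case 2
    then have "f s = s powr p * f 1" using f[rule_format, of s 1] by simp
    then show ?thesis using 2 by (simp add: abs_mult mult.commute mult_left_mono)
  next
    case 3
    then have "f s = \<bar>s\<bar> powr p * f (- 1)" using f[rule_format, of "\<bar>s\<bar>" "-1"] by simp
    then show ?thesis using 3 by (simp add: abs_mult mult.commute mult_left_mono)
  qed (simp add: f0)
qed

text \<open>|f(\<phi>)|^2 is at most a multiple of |\<phi>|^(2p), and 2 \<le> 2p \<le> N bounds this
  power by \<phi>^2 + |\<phi>|^N. An integer N is taken because the embedding is stated for integer
  powers.\<close>

lemma L2_compose_homogeneous:
  assumes p: "p > 1" and f: "\<forall>l s. l > 0 \<longrightarrow> f (l * s) = l powr p * f s" and fc: "continuous_on UNIV f"
    and \<phi>: "sobolev (1/2) \<phi>"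
  shows "L2 (\<lambda>x. f (\<phi> x))"
proof -
  have \<phi>2: "L2 \<phi>" using \<phi> unfolding sobolev_def by (auto dest: is_fourierD(3))
  then have [measurable]: "\<phi> \<in> borel_measurable borel" by (simp add: L2_def)
  have [measurable]: "f \<in> borel_measurable borel" using fc by (rule borel_measurable_continuous_onI)
  obtain N :: nat where N: "2 * p \<le> real N" using real_arch_simple by blast
  have N2: "2 \<le> N" using N p by linarith
  define C where "C = \<bar>f 1\<bar> + \<bar>f (- 1)\<bar>"
  show ?thesis unfolding L2_def
  proof
    show "integrable lborel (\<lambda>x. (f (\<phi> x))\<^sup>2)"
    proof (rule Bochner_Integration.integrable_bound)
      show "integrable lborel (\<lambda>x. C^2 * ((\<phi> x)^2 + \<bar>\<phi> x\<bar> ^ N))"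
        using \<phi>2 half_sobolev_embedding[OF \<phi> N2] unfolding L2_def by auto
      show "AE x in lborel. norm ((f (\<phi> x))\<^sup>2) \<le> norm (C^2 * ((\<phi> x)^2 + \<bar>\<phi> x\<bar> ^ N))"
      proof (intro AE_I2)
        fix x
        have "\<bar>f (\<phi> x)\<bar> ^ 2 \<le> (C * \<bar>\<phi> x\<bar> powr p)^2"
          using homogeneous_growth(2)[OF _ f, of "\<phi> x"] p by (intro power_mono) (auto simp: C_def)
        also have "\<dots> = C^2 * \<bar>\<phi> x\<bar> powr (2 * p)"
          by (simp add: power_mult_distrib power2_eq_square powr_add[symmetric])
        also have "\<bar>\<phi> x\<bar> powr (2 * p) \<le> (\<phi> x)^2 + \<bar>\<phi> x\<bar> ^ N"
        proof (cases "\<bar>\<phi> x\<bar> \<le> 1")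
          case True
          then have "\<bar>\<phi> x\<bar> powr (2 * p) \<le> \<bar>\<phi> x\<bar> powr 2" using p by (intro powr_mono') auto
          also have "\<dots> = (\<phi> x)^2" by (simp add: powr_numeral)
          finally show ?thesis by (rule order_trans) simp
        next
          case False
          then have "\<bar>\<phi> x\<bar> powr (2 * p) \<le> \<bar>\<phi> x\<bar> powr real N" using N by (intro powr_mono) auto
          also have "\<dots> = \<bar>\<phi> x\<bar> ^ N" using False by (intro powr_realpow) auto
          finally show ?thesis by (rule order_trans) simp
        qed
        finally show "norm ((f (\<phi> x))\<^sup>2) \<le> norm (C^2 * ((\<phi> x)^2 + \<bar>\<phi> x\<bar> ^ N))"
          by (simp add: mult_left_mono)
      qed
    qed measurable
  qed measurable
qed

section \<open>The equation on the Fourier side\<close>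

text \<open>Parseval collects the tested equation into the pairing of one function G with
  \<open>FT \<psi>\<close> at -\<xi>, and G vanishes by weighted uniqueness. The dispersive term
  contributes \<xi>|\<xi>|\<Phi> to G, so the weight 1 + \<xi>^2 is just enough.\<close>

lemma solitary_wave_fourier:
  assumes \<Phi>: "is_fourier \<phi> \<Phi>" and W: "is_fourier w W" and \<Phi>W: "AE \<xi> in lborel. \<Phi> \<xi> = \<i> * complex_of_real \<xi> * W \<xi>"
    and F: "is_fourier (\<lambda>x. f (\<phi> x)) F"
    and eq: "\<And>\<psi>. test_fun \<psi> \<Longrightarrow>
               complex_of_real \<beta> * (1 / (2 * complex_of_real pi)) *
                 (LINT \<xi>|lborel. ((- \<i> * complex_of_real (sgn \<xi>)) * (\<i> * complex_of_real \<xi>))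
                     * \<Phi> \<xi> * FT (deriv \<psi>) (- \<xi>))
               - complex_of_real (c * (LINT x|lborel. \<phi> x * deriv \<psi> x))
               + complex_of_real (LINT x|lborel. f (\<phi> x) * deriv \<psi> x)
               = - complex_of_real (\<gamma> * (LINT x|lborel. w x * \<psi> x))"
  shows "AE \<xi> in lborel. complex_of_real (\<beta> * \<bar>\<xi>\<bar>^3 - c * \<xi>^2 + \<gamma>) * W \<xi> = \<i> * complex_of_real \<xi> * F \<xi>"
proof -
  note [measurable] = is_fourierD(4)[OF \<Phi>] is_fourierD(4)[OF W] is_fourierD(4)[OF F]
  note c\<Phi> = is_fourierD(2)[OF \<Phi>] and cW = is_fourierD(2)[OF W] and cF = is_fourierD(2)[OF F]
  \<comment> \<open>\<Phi> is kept here and replaced by i\<xi>W only at the end: in terms of W the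
    growth would be cubic, beyond the weight.\<close>
  define G where "G \<xi> = complex_of_real \<gamma> * W \<xi>
     - \<i> * complex_of_real \<xi> * (complex_of_real (\<beta> * \<bar>\<xi>\<bar> - c) * \<Phi> \<xi> + F \<xi>)" for \<xi>
  have "AE \<xi> in lborel. G \<xi> = 0"
  proof (rule weighted_cL2_FT_zero)
    have "cL2 (\<lambda>\<xi>. (complex_of_real \<gamma> / complex_of_real (1 + \<xi>^2)) * W \<xi>
       - ((\<i> * complex_of_real (\<xi> * (\<beta> * \<bar>\<xi>\<bar> - c)) / complex_of_real (1 + \<xi>^2)) * \<Phi> \<xi>
       + (\<i> * complex_of_real \<xi> / complex_of_real (1 + \<xi>^2)) * F \<xi>))"
    proof (intro cL2_diff cL2_add)
      show "cL2 (\<lambda>\<xi>. (complex_of_real \<gamma> / complex_of_real (1 + \<xi>^2)) * W \<xi>)"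
      proof (rule cL2_mult_bounded[OF cW, where C="\<bar>\<gamma>\<bar>"])
        show "cmod (complex_of_real \<gamma> / complex_of_real (1 + \<xi>^2)) \<le> \<bar>\<gamma>\<bar>" for \<xi>
          using one_plus_square_pos[of \<xi>]
          by (simp add: norm_divide divide_le_eq mult_left_mono[of 1] distrib_left del: of_real_add of_real_power)
      qed measurable
      show "cL2 (\<lambda>\<xi>. (\<i> * complex_of_real \<xi> / complex_of_real (1 + \<xi>^2)) * F \<xi>)"
      proof (rule cL2_mult_bounded[OF cF, where C=1])
        show "cmod (\<i> * complex_of_real \<xi> / complex_of_real (1 + \<xi>^2)) \<le> 1" for \<xi>
          using abs_le_one_plus_square[of \<xi>] one_plus_square_pos[of \<xi>]
          by (simp add: norm_divide norm_mult del: of_real_add of_real_power)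
      qed measurable
      show "cL2 (\<lambda>\<xi>. (\<i> * complex_of_real (\<xi> * (\<beta> * \<bar>\<xi>\<bar> - c)) / complex_of_real (1 + \<xi>^2)) * \<Phi> \<xi>)"
      proof (rule cL2_mult_bounded[OF c\<Phi>, where C="\<bar>\<beta>\<bar> + \<bar>c\<bar>"])
        show "cmod (\<i> * complex_of_real (\<xi> * (\<beta> * \<bar>\<xi>\<bar> - c)) / complex_of_real (1 + \<xi>^2)) \<le> \<bar>\<beta>\<bar> + \<bar>c\<bar>" for \<xi>
        proof -
          have "\<bar>\<xi> * (\<beta> * \<bar>\<xi>\<bar> - c)\<bar> \<le> \<bar>\<xi>\<bar> * (\<bar>\<beta>\<bar> * \<bar>\<xi>\<bar> + \<bar>c\<bar>)"
            unfolding abs_mult[of \<xi>] using abs_triangle_ineq4[of "\<beta> * \<bar>\<xi>\<bar>" c] by (intro mult_left_mono) (auto simp: abs_mult)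
          also have "\<dots> = \<bar>\<beta>\<bar> * \<xi>^2 + \<bar>c\<bar> * \<bar>\<xi>\<bar>" by (simp add: algebra_simps power2_eq_square)
          also have "\<dots> \<le> \<bar>\<beta>\<bar> * (1 + \<xi>^2) + \<bar>c\<bar> * (1 + \<xi>^2)"
            using abs_le_one_plus_square[of \<xi>] by (intro add_mono mult_left_mono) auto
          finally show ?thesis using one_plus_square_pos[of \<xi>]
            by (simp add: norm_divide norm_mult pos_divide_le_eq distrib_right abs_mult del: of_real_add of_real_power of_real_mult of_real_diff)
        qed
      qed measurable
    qed
    then show "cL2 (\<lambda>\<xi>. G \<xi> / complex_of_real (1 + \<xi>^2))"
      by (rule cL2_cong_AE) (auto simp: G_def diff_divide_distrib add_divide_distrib algebra_simps)
    fix \<psi> assume \<psi>: "test_fun \<psi>"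
    note d = test_fun_deriv[OF \<psi>]
    note [measurable] = FT_measurable[OF \<psi>] FT_measurable[OF d]
    \<comment> \<open>|\<xi>| times \<open>FT (deriv \<psi>)\<close> has the modulus of the
      transform of \<psi>'', hence lies in L^2.\<close>
    have i1: "integrable lborel (\<lambda>\<xi>. \<Phi> \<xi> * (complex_of_real \<bar>\<xi>\<bar> * FT (deriv \<psi>) (- \<xi>)))"
    proof (rule cL2_mult_integrable[OF c\<Phi>])
      have "cL2 (\<lambda>\<xi>. FT (deriv (deriv \<psi>)) (- \<xi>))" by (rule FT_reflected_L1_L2(2)[OF test_fun_deriv[OF d]])
      from cL2_integrable[OF this]
      show "cL2 (\<lambda>\<xi>. complex_of_real \<bar>\<xi>\<bar> * FT (deriv \<psi>) (- \<xi>))"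
        by (rule cL2I_bound[rotated]) (simp_all add: FT_deriv[OF d] norm_mult)
    qed
    have i2: "integrable lborel (\<lambda>\<xi>. \<Phi> \<xi> * FT (deriv \<psi>) (- \<xi>))" "integrable lborel (\<lambda>\<xi>. F \<xi> * FT (deriv \<psi>) (- \<xi>))"
      "integrable lborel (\<lambda>\<xi>. W \<xi> * FT \<psi> (- \<xi>))"
      by (intro cL2_mult_integrable FT_reflected_L1_L2 d \<psi> c\<Phi> cW cF)+
    define I where "I = (LINT \<xi>|lborel. \<Phi> \<xi> * (complex_of_real \<bar>\<xi>\<bar> * FT (deriv \<psi>) (- \<xi>)))"
    have "(LINT \<xi>|lborel. G \<xi> * FT \<psi> (- \<xi>)) = (LINT \<xi>|lborel. complex_of_real \<gamma> * (W \<xi> * FT \<psi> (- \<xi>))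
      + (complex_of_real \<beta> * (\<Phi> \<xi> * (complex_of_real \<bar>\<xi>\<bar> * FT (deriv \<psi>) (- \<xi>)))
      - complex_of_real c * (\<Phi> \<xi> * FT (deriv \<psi>) (- \<xi>)) + F \<xi> * FT (deriv \<psi>) (- \<xi>)))"
      by (intro Bochner_Integration.integral_cong refl) (simp add: G_def FT_deriv[OF \<psi>] algebra_simps)
    also have "\<dots> = complex_of_real \<gamma> * (LINT \<xi>|lborel. W \<xi> * FT \<psi> (- \<xi>)) + (complex_of_real \<beta> * I
      - complex_of_real c * (LINT \<xi>|lborel. \<Phi> \<xi> * FT (deriv \<psi>) (- \<xi>)) + (LINT \<xi>|lborel. F \<xi> * FT (deriv \<psi>) (- \<xi>)))"
      using i1 i2 by (simp add: I_def)
    also have "\<dots> = complex_of_real (2 * pi) * (complex_of_real (\<gamma> * (LINT x|lborel. w x * \<psi> x))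
       + (complex_of_real \<beta> * (1 / (2 * complex_of_real pi)) * I
       - complex_of_real (c * (LINT x|lborel. \<phi> x * deriv \<psi> x)) + complex_of_real (LINT x|lborel. f (\<phi> x) * deriv \<psi> x)))"
      unfolding is_fourier_parseval[OF \<Phi> d] is_fourier_parseval[OF F d] is_fourier_parseval[OF W \<psi>]
      by (simp add: field_simps)
    \<comment> \<open>The symbol (-i sgn \<xi>)(i\<xi>) is |\<xi>|.\<close>
    also have "I = (LINT \<xi>|lborel. ((- \<i> * complex_of_real (sgn \<xi>)) * (\<i> * complex_of_real \<xi>)) * \<Phi> \<xi> * FT (deriv \<psi>) (- \<xi>))"
      unfolding I_def by (intro Bochner_Integration.integral_cong refl) (auto simp: abs_sgn mult_ac)
    finally show "(LINT \<xi>|lborel. G \<xi> * FT \<psi> (- \<xi>)) = 0" unfolding eq[OF \<psi>] by simp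
  qed
  then show ?thesis using \<Phi>W
  proof eventually_elim
    case (elim \<xi>)
    have "complex_of_real \<bar>\<xi>\<bar>^3 = complex_of_real \<bar>\<xi>\<bar> * complex_of_real \<xi>^2"
      by (simp add: power3_eq_cube power2_eq_square of_real_mult[symmetric] abs_mult_self_eq del: of_real_mult)
    with elim show ?case
      by (simp add: G_def power2_eq_square algebra_simps)
  qed
qed

section \<open>The bootstrap in the Sobolev scale\<close>

theorem theorem2p2:
  fixes p \<beta> \<gamma> c :: real and f \<phi> :: "real \<Rightarrow> real" and k :: nat
  assumes "p > 1"
    and "Ck 2 f"
    and "\<forall>l s. l > 0 \<longrightarrow> f (l * s) = l powr p * f s"
    and "\<beta> > 0" and "\<gamma> > 0"
    and "c < 3 * (\<beta>^2 * \<gamma> / 4) powr (1/3)"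
    and "Ck k f"
    and "solitary_wave \<beta> \<gamma> c f \<phi>"
  shows "sobolev (real k + 1) \<phi> \<and> inv_deriv_in 1 (real k + 2) \<phi> \<and> inv_deriv_in 2 (real k + 3) \<phi>"
proof -
  obtain \<Phi> w W where \<Phi>: "is_fourier \<phi> \<Phi>" and W: "is_fourier w W"
    and \<Phi>W: "AE \<xi> in lborel. \<Phi> \<xi> = \<i> * complex_of_real \<xi> * W \<xi>"
    and eq: "\<And>\<psi>. test_fun \<psi> \<Longrightarrow>
               complex_of_real \<beta> * (1 / (2 * complex_of_real pi)) *
                 (LINT \<xi>|lborel. ((- \<i> * complex_of_real (sgn \<xi>)) * (\<i> * complex_of_real \<xi>))
                     * \<Phi> \<xi> * FT (deriv \<psi>) (- \<xi>))
               - complex_of_real (c * (LINT x|lborel. \<phi> x * deriv \<psi> x))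
               + complex_of_real (LINT x|lborel. f (\<phi> x) * deriv \<psi> x)
               = - complex_of_real (\<gamma> * (LINT x|lborel. w x * \<psi> x))"
    using assms(8) unfolding solitary_wave_def by blast
  have half: "sobolev (1/2) \<phi>" using assms(8) unfolding solitary_wave_def space_X_def by blast
  have "continuous_on UNIV f" using assms(2) unfolding Ck_def by (metis le0)
  then have f2: "L2 (\<lambda>x. f (\<phi> x))" using L2_compose_homogeneous assms(1,3) half by blast
  then obtain F where F: "is_fourier (\<lambda>x. f (\<phi> x)) F" using is_fourier_exists by blast
  note [measurable] = is_fourierD(4)[OF \<Phi>] is_fourierD(4)[OF W] is_fourierD(4)[OF F]
  define m where "m \<xi> = \<beta> * \<bar>\<xi>\<bar>^3 - c * \<xi>^2 + \<gamma>" for \<xi>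
  have [measurable]: "m \<in> borel_measurable borel" unfolding m_def by measurable
  obtain \<kappa> where \<kappa>: "\<kappa> > 0" "\<And>\<xi>. \<kappa> * (1 + \<xi>^2) powr (3/2) \<le> m \<xi>"
  proof -
    obtain \<kappa> where \<kappa>: "\<kappa> > 0" "\<And>t. t \<ge> 0 \<Longrightarrow> \<kappa> * (1 + t^2) powr (3/2) \<le> \<beta> * t^3 - c * t^2 + \<gamma>"
      using dispersion_positive[OF assms(4-6)] by blast
    show ?thesis
    proof (rule that[OF \<kappa>(1)])
      show "\<kappa> * (1 + \<xi>^2) powr (3/2) \<le> m \<xi>" for \<xi> using \<kappa>(2)[of "\<bar>\<xi>\<bar>"] by (simp add: m_def)
    qed
  qed
  have m0: "m \<xi> > 0" for \<xi>
  proof -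
    have "0 < \<kappa> * (1 + \<xi>^2) powr (3/2)" using \<kappa>(1) one_plus_square_pos[of \<xi>] by simp
    then show ?thesis using \<kappa>(2)[of \<xi>] by linarith
  qed
  \<comment> \<open>The transform of the second antiderivative: W = i\<xi>V and \<Phi> = (i\<xi>)^2
    V almost everywhere. Dividing F by the positive m, instead of W by i\<xi>, avoids the
    singularity at the origin.\<close>
  define V where "V \<xi> = F \<xi> / complex_of_real (m \<xi>)" for \<xi>
  have [measurable]: "V \<in> borel_measurable borel" unfolding V_def by measurable
  have WV: "AE \<xi> in lborel. W \<xi> = \<i> * complex_of_real \<xi> * V \<xi>"
  proof -
    have "AE \<xi> in lborel. complex_of_real (m \<xi>) * W \<xi> = \<i> * complex_of_real \<xi> * F \<xi>"
      unfolding m_def by (rule solitary_wave_fourier[OF \<Phi> W \<Phi>W F eq])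
    then show ?thesis
    proof eventually_elim
      case (elim \<xi>)
      then show ?case using m0[of \<xi>] by (simp add: V_def field_simps)
    qed
  qed
  \<comment> \<open>Squaring m \<ge> \<kappa>(1 + \<xi>^2)^(3/2) gives the factor (1 + \<xi>^2)^3,
    that is three derivatives, since H^s carries the weight (1 + \<xi>^2)^s.\<close>
  have gain: "weighted_L2 (s + 3) V" if "weighted_L2 s F" for s
  proof (rule weighted_L2_bound[OF that, where C="1 / \<kappa>^2"])
    fix \<xi> :: real
    have "(1 + \<xi>^2) powr 3 = ((1 + \<xi>^2) powr (3/2))^2"
      by (simp add: power2_eq_square powr_add[symmetric])
    then have "\<kappa>^2 * (1 + \<xi>^2) powr 3 = (\<kappa> * (1 + \<xi>^2) powr (3/2))^2" by (simp add: power_mult_distrib)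
    also have "\<dots> \<le> (m \<xi>)^2" using \<kappa> by (intro power_mono) auto
    finally have "(1 + \<xi>^2) powr 3 / (m \<xi>)^2 \<le> 1 / \<kappa>^2"
      using \<kappa>(1) m0[of \<xi>] by (simp add: field_simps)
    from mult_right_mono[OF this, of "(1 + \<xi>^2) powr s * (cmod (F \<xi>))^2"]
    show "(1 + \<xi>\<^sup>2) powr (s + 3) * (cmod (V \<xi>))\<^sup>2 \<le> 1 / \<kappa>\<^sup>2 * ((1 + \<xi>\<^sup>2) powr s * (cmod (F \<xi>))\<^sup>2)"
      by (simp add: V_def norm_divide power_divide powr_add mult_ac)
  qed measurable
  have "cL2 F" by (rule is_fourierD(2)[OF F])
  then have F0: "weighted_L2 0 F"
    using one_plus_square_pos by (simp add: weighted_L2_def cL2_def less_imp_neq[symmetric])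
  have "cL2 V" by (rule weighted_L2_cL2[OF gain[OF F0]]) auto
  \<comment> \<open>m is real and even, so V inherits the symmetry of F and is the transform of a
    real function.\<close>
  moreover have "AE \<xi> in lborel. V (- \<xi>) = cnj (V \<xi>)"
    using is_fourier_hermitian[OF F] by eventually_elim (simp add: V_def m_def)
  ultimately obtain v where v: "is_fourier v V" using is_fourier_inverse by blast
  have \<Phi>V: "AE \<xi> in lborel. \<Phi> \<xi> = \<i> * complex_of_real \<xi> * (\<i> * complex_of_real \<xi> * V \<xi>)"
    using \<Phi>W WV by eventually_elim simp
  have W': "is_fourier w (\<lambda>\<xi>. \<i> * complex_of_real \<xi> * V \<xi>)"
    by (rule is_fourier_cong_AE[OF W WV]) measurable
  have \<Phi>': "is_fourier \<phi> (\<lambda>\<xi>. \<i> * complex_of_real \<xi> * (\<i> * complex_of_real \<xi> * V \<xi>))"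
    by (rule is_fourier_cong_AE[OF \<Phi> \<Phi>V]) measurable
  \<comment> \<open>V, i\<xi>V and (i\<xi>)^2 V are the transforms of the second antiderivative, of
    the first and of \<phi>; each factor \<xi> costs one of the three derivatives gained.\<close>
  have step: "sobolev (s + 1) \<phi> \<and> inv_deriv_in 1 (s + 2) \<phi> \<and> inv_deriv_in 2 (s + 3) \<phi>"
    if "sobolev s (\<lambda>x. f (\<phi> x))" for s
  proof -
    have V3: "weighted_L2 (s + 3) V" using that sobolev_iff[OF F] gain by blast
    have V2: "weighted_L2 (s + 2) (\<lambda>\<xi>. \<i> * complex_of_real \<xi> * V \<xi>)"
      using V3 by (intro weighted_L2_deriv) (auto simp: add.assoc)
    have "weighted_L2 (s + 1) (\<lambda>\<xi>. \<i> * complex_of_real \<xi> * (\<i> * complex_of_real \<xi> * V \<xi>))"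
      by (rule weighted_L2_deriv) (use V2 in \<open>auto simp: add.assoc\<close>)
    then have "sobolev (s + 1) \<phi>" using sobolev_iff[OF \<Phi>'] by blast
    moreover have "sobolev (s + 2) w" using V2 sobolev_iff[OF W'] by blast
    then have "inv_deriv_in 1 (s + 2) \<phi>" unfolding inv_deriv_in_def using \<Phi> W \<Phi>W by auto
    moreover have "sobolev (s + 3) v" using V3 sobolev_iff[OF v] by blast
    then have "inv_deriv_in 2 (s + 3) \<phi>" unfolding inv_deriv_in_def
      using \<Phi>' v by (intro exI[of _ v] exI[of _ "\<lambda>\<xi>. \<i> * complex_of_real \<xi> * (\<i> * complex_of_real \<xi> * V \<xi>)"] exI[of _ V])
        (auto simp: power2_eq_square mult.assoc)
    ultimately show ?thesis by blast
  qed
  \<comment> \<open>The induction runs up to j = k because f in C^k provides the composition rule in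
    H^j for 1 \<le> j \<le> k; a last application of \<open>step\<close> yields the claim.\<close>
  have "sobolev (real j) (\<lambda>x. f (\<phi> x))" if "j \<le> k" for j
    using that
  proof (induction j)
    case 0
    then show ?case using sobolev_iff[OF F] F0 by simp
  next
    case (Suc j)
    then have "sobolev (real (Suc j)) \<phi>" using step[of "real j"] by (simp add: add.commute)
    then have "Hk (Suc j) \<phi>" by (rule sobolev_imp_Hk)
    moreover have "f 0 = 0" using homogeneous_growth(1)[OF _ assms(3)] assms(1) by simp
    ultimately have "Hk (Suc j) (\<lambda>x. f (\<phi> x))"
      using Hk_compose[OF Ck_mono[OF assms(7) Suc.prems]] by blast
    then show ?case by (rule Hk_imp_sobolev)
  qed
  from step[OF this[OF order_refl]] show ?thesis .
qed

end
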